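(* Let $\Gamma$ be a finite, triangle-free, inseparable simplicial graph and let $X_\Gamma$ be a proper $\mathrm{CAT}(0)$ space on which $W_\Gamma$ acts geometrically. If $\Gamma$ is non-planar and $\partial X_\Gamma$ is locally connected and contains no local cut points, then $\partial X_\Gamma$ is non-planar.
   Context: $W_\Gamma$ is the right-angled Coxeter group of $\Gamma$ (generators the vertices, $s^2=1$, $st=ts$ for adjacent $s,t$). Geometric action: properly discontinuous, cocompact, by isometries. $\partial X$ is the visual boundary with the cone topology. A subgraph is separating if deleting its vertices disconnects the graph. A triangle-free graph is inseparable if it is connected and has no separating vertex, no separating edge, no cut pair (separating pair of non-adjacent vertices), and no separating vertex suspension (a separating set $\{v,s,t\}$ with $s,t$ non-adjacent neighbours of $v$). A point $p$ of a connected space $Z$ is a local cut point if some connected open neighbourhood $U$ of $p$ has $U\setminus\{p\}$ disconnected. Planar means embeddable in $S^2$. *)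

theory Defs
  imports "HOL-Analysis.Analysis"
begin

definition simplicial_graph :: "('v \<Rightarrow> 'v \<Rightarrow> bool) \<Rightarrow> bool" where
  "simplicial_graph E \<longleftrightarrow> (\<forall>u v. E u v \<longrightarrow> E v u) \<and> (\<forall>v. \<not> E v v)"

definition triangle_free :: "('v \<Rightarrow> 'v \<Rightarrow> bool) \<Rightarrow> bool" where
  "triangle_free E \<longleftrightarrow> \<not> (\<exists>u v w. E u v \<and> E v w \<and> E u w)"

definition connected_on :: "('v \<Rightarrow> 'v \<Rightarrow> bool) \<Rightarrow> 'v set \<Rightarrow> bool" where
  "connected_on E S \<longleftrightarrow>
     (\<forall>u\<in>S. \<forall>w\<in>S. (\<lambda>a b. E a b \<and> a \<in> S \<and> b \<in> S)\<^sup>*\<^sup>* u w)"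

definition separating :: "('v \<Rightarrow> 'v \<Rightarrow> bool) \<Rightarrow> 'v set \<Rightarrow> bool" where
  "separating E T \<longleftrightarrow> \<not> connected_on E (UNIV - T)"

definition inseparable :: "('v \<Rightarrow> 'v \<Rightarrow> bool) \<Rightarrow> bool" where
  "inseparable E \<longleftrightarrow>
     connected_on E UNIV
   \<and> \<not> (\<exists>v. separating E {v})
   \<and> \<not> (\<exists>u v. E u v \<and> separating E {u, v})
   \<and> \<not> (\<exists>u v. u \<noteq> v \<and> \<not> E u v \<and> separating E {u, v})
   \<and> \<not> (\<exists>v s t. E v s \<and> E v t \<and> s \<noteq> t \<and> \<not> E s t \<and> separating E {v, s, t})"

definition planar_graph :: "('v \<Rightarrow> 'v \<Rightarrow> bool) \<Rightarrow> bool" where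
  "planar_graph E \<longleftrightarrow>
    (\<exists>(p :: 'v \<Rightarrow> real^3) (\<gamma> :: 'v \<Rightarrow> 'v \<Rightarrow> real \<Rightarrow> real^3).
       inj p \<and> (\<forall>v. p v \<in> sphere 0 1)
     \<and> (\<forall>u v. E u v \<longrightarrow> arc (\<gamma> u v) \<and> path_image (\<gamma> u v) \<subseteq> sphere 0 1
                     \<and> pathstart (\<gamma> u v) = p u \<and> pathfinish (\<gamma> u v) = p v)
     \<and> (\<forall>u v w. E u v \<longrightarrow> p w \<in> path_image (\<gamma> u v) \<longrightarrow> w = u \<or> w = v)
     \<and> (\<forall>u v a b. E u v \<longrightarrow> E a b \<longrightarrow> {u, v} \<noteq> {a, b} \<longrightarrow>
          path_image (\<gamma> u v) \<inter> path_image (\<gamma> a b) \<subseteq> p ` ({u, v} \<inter> {a, b})))"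

inductive racg_step :: "('v \<Rightarrow> 'v \<Rightarrow> bool) \<Rightarrow> 'v list \<Rightarrow> 'v list \<Rightarrow> bool"
  for E where
  cancel: "racg_step E (xs @ [s, s] @ ys) (xs @ ys)"
| commute: "E s t \<Longrightarrow> racg_step E (xs @ [s, t] @ ys) (xs @ [t, s] @ ys)"

definition racg_equiv :: "('v \<Rightarrow> 'v \<Rightarrow> bool) \<Rightarrow> 'v list \<Rightarrow> 'v list \<Rightarrow> bool" where
  "racg_equiv E = (sup (racg_step E) (racg_step E)\<inverse>\<inverse>)\<^sup>*\<^sup>*"

definition racg_elem :: "('v \<Rightarrow> 'v \<Rightarrow> bool) \<Rightarrow> 'v list \<Rightarrow> 'v list set" where
  "racg_elem E w = {w'. racg_equiv E w w'}"

definition word_act :: "('v \<Rightarrow> 'x \<Rightarrow> 'x) \<Rightarrow> 'v list \<Rightarrow> 'x \<Rightarrow> 'x" where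
  "word_act g w = foldr (\<lambda>v f. g v \<circ> f) w id"

definition isometry :: "('x::metric_space \<Rightarrow> 'x) \<Rightarrow> bool" where
  "isometry f \<longleftrightarrow> bij f \<and> (\<forall>x y. dist (f x) (f y) = dist x y)"

definition geometric_racg_action ::
  "('v \<Rightarrow> 'v \<Rightarrow> bool) \<Rightarrow> ('v \<Rightarrow> 'x::metric_space \<Rightarrow> 'x) \<Rightarrow> bool" where
  "geometric_racg_action E g \<longleftrightarrow>
     (\<forall>v. isometry (g v))
   \<and> (\<forall>v. g v \<circ> g v = id)
   \<and> (\<forall>u v. E u v \<longrightarrow> g u \<circ> g v = g v \<circ> g u)
   \<and> (\<forall>K. compact K \<longrightarrow>
          finite {racg_elem E w | w. word_act g w ` K \<inter> K \<noteq> {}})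
   \<and> (\<exists>K. compact K \<and> (\<Union>w. word_act g w ` K) = UNIV)"

definition proper_space :: "'x::metric_space itself \<Rightarrow> bool" where
  "proper_space _ \<longleftrightarrow> (\<forall>(x::'x) r. compact (cball x r))"

definition geodesic_seg :: "(real \<Rightarrow> 'x::metric_space) \<Rightarrow> 'x \<Rightarrow> 'x \<Rightarrow> bool" where
  "geodesic_seg c x y \<longleftrightarrow> c 0 = x \<and> c (dist x y) = y \<and>
     (\<forall>s\<in>{0..dist x y}. \<forall>t\<in>{0..dist x y}. dist (c s) (c t) = \<bar>s - t\<bar>)"

text \<open>CAT(0): geodesic space in which every geodesic triangle satisfies the
  CAT(0) inequality. Any two points on a triangle lie on two sides sharing a
  vertex x; the comparison triangle (a,b,c) in the Euclidean plane has the same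
  side lengths, and the comparison points are the points at the same distance
  from a on the corresponding sides.\<close>
definition CAT0 :: "'x::metric_space itself \<Rightarrow> bool" where
  "CAT0 _ \<longleftrightarrow>
     (\<forall>x y::'x. \<exists>c. geodesic_seg c x y)
   \<and> (\<forall>(x::'x) y z c1 c2 (a::complex) b c s t.
        geodesic_seg c1 x y \<longrightarrow> geodesic_seg c2 x z \<longrightarrow>
        dist a b = dist x y \<longrightarrow> dist a c = dist x z \<longrightarrow> dist b c = dist y z \<longrightarrow>
        s \<in> {0..dist x y} \<longrightarrow> t \<in> {0..dist x z} \<longrightarrow>
        dist (c1 s) (c2 t) \<le>
          dist (a + of_real (s / dist x y) * (b - a)) (a + of_real (t / dist x z) * (c - a)))"

text \<open>Geodesic rays issuing from the base point x0 (normalised to be constant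
  x0 on negative reals, so that each ray is a unique function).\<close>
definition geodesic_rays_from :: "'x::metric_space \<Rightarrow> (real \<Rightarrow> 'x) set" where
  "geodesic_rays_from x0 = {c. c 0 = x0 \<and> (\<forall>t<0. c t = x0) \<and>
      (\<forall>s\<ge>0. \<forall>t\<ge>0. dist (c s) (c t) = \<bar>s - t\<bar>)}"

text \<open>In a proper CAT(0) space each point of the visual boundary is represented
  by a unique geodesic ray from x0, and the cone topology on the boundary is
  generated by the sets U(c,r,eps) (Bridson-Haefliger II.8.6-8.8).\<close>
definition visual_boundary :: "'x::metric_space \<Rightarrow> (real \<Rightarrow> 'x) topology" where
  "visual_boundary x0 = topology_generated_by
     {{c' \<in> geodesic_rays_from x0. dist (c' r) (c r) < \<epsilon>} | c r \<epsilon>.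
         c \<in> geodesic_rays_from x0 \<and> r > 0 \<and> \<epsilon> > 0}"

definition local_cut_point :: "'a topology \<Rightarrow> 'a \<Rightarrow> bool" where
  "local_cut_point Z p \<longleftrightarrow>
     (\<exists>U. openin Z U \<and> connectedin Z U \<and> p \<in> U \<and> \<not> connectedin Z (U - {p}))"

definition planar_space :: "'a topology \<Rightarrow> bool" where
  "planar_space Z \<longleftrightarrow>
     (\<exists>f :: 'a \<Rightarrow> real^3. f ` topspace Z \<subseteq> sphere 0 1 \<and> embedding_map Z euclidean f)"

end

theory Submission
  imports Defs
begin

text \<open>Suppose that the boundary \<open>Z\<close> lies in the sphere. Every generator \<open>v\<close> acts on \<open>Z\<close> as an involution that swaps
  two disjoint open halves, the ideal points of the two half-spaces of \<open>v\<close>, and fixes the remaining points. The halves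
  \<open>U v\<close> of the half-spaces not containing the identity are disjoint for non-adjacent \<open>u\<close>, \<open>v\<close>, and \<open>U v\<close> is
  invariant under \<open>u\<close> for adjacent \<open>u\<close>, \<open>v\<close>, in which case \<open>u\<close> and \<open>v\<close> have no common fixed point.
  \<open>Z\<close> is connected since the group is one-ended. Each half is connected: otherwise two mirror components
  and a complementary region would share three frontier points (here the absence of local cut points enters), and
  the sphere would contain the complete bipartite graph on three plus three vertices.
  Adding the vertices one after the other, vertex \<open>v\<close> is then represented by a star inside the sphere that avoids the
  complement of \<open>U v\<close> in \<open>Z\<close> and the stars of earlier non-neighbours, and that touches the stars of its earlier
  neighbours; Janiszewski's theorem provides the necessary paths. Contracting the stars draws \<open>\<Gamma>\<close> in the sphere.\<close>

section \<open>Words in right-angled Coxeter groups\<close>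

text \<open>The fixed set of a generator in X need not separate X, so there are no walls to read
  off. Sides are defined coarsely: a point of X gets the side, in the group, of a nearby orbit
  point, and two choices can disagree only where the generator displaces the point by a bounded
  amount. Along a ray the displacement is quasiconvex: either it stays bounded and the ray is fixed
  at infinity, or it is eventually large and the ray has a definite side.

  In the plane the obstacle is that nothing is known about the shape of the fixed sets on the
  boundary. Folding replaces such knowledge: sending a half to its mirror image is a retraction, so
  the complement of a half is connected, and so is a half minus an adjacent one. These sets feed
  Janiszewski's theorem. Triangle-freeness makes the neighbours of a vertex pairwise non-adjacent,
  so their stars are disjoint and can be avoided one at a time. Inseparability gives one-endedness,
  since no vertex and no edge separates the graph. That the boundary is not the whole sphere, so
  that a plane suffices, follows from unicoherence.\<close>

definition exposed :: "('v \<Rightarrow> 'v \<Rightarrow> bool) \<Rightarrow> 'v \<Rightarrow> 'v list \<Rightarrow> bool" where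
  "exposed E v t \<longleftrightarrow> (\<exists>a b. t = a @ v # b \<and> (\<forall>x\<in>set a. E v x))"

definition lmul :: "('v \<Rightarrow> 'v \<Rightarrow> bool) \<Rightarrow> 'v \<Rightarrow> 'v list \<Rightarrow> 'v list" where
  "lmul E v t = (if exposed E v t then remove1 v t else v # t)"

definition reduce :: "('v \<Rightarrow> 'v \<Rightarrow> bool) \<Rightarrow> 'v list \<Rightarrow> 'v list" where
  "reduce E w = foldr (lmul E) w []"

definition reduced :: "('v \<Rightarrow> 'v \<Rightarrow> bool) \<Rightarrow> 'v list \<Rightarrow> bool" where
  "reduced E t \<longleftrightarrow> \<not> (\<exists>a b c s. t = a @ s # b @ s # c \<and> (\<forall>x\<in>set b. E s x))"

text \<open>Equality in the partially commutative monoid, by the projection criterion: words agree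
  up to commutations iff their projections to all pairs of non-commuting letters agree. The pairs
  with \<open>a = b\<close> compare numbers of occurrences. In this form invariance reduces to facts
  about \<open>filter\<close>.\<close>

definition trace_eq :: "('v \<Rightarrow> 'v \<Rightarrow> bool) \<Rightarrow> 'v list \<Rightarrow> 'v list \<Rightarrow> bool" where
  "trace_eq E t t' \<longleftrightarrow> (\<forall>a b. \<not> E a b \<longrightarrow> filter (\<lambda>x. x = a \<or> x = b) t = filter (\<lambda>x. x = a \<or> x = b) t')"

lemma reduce_simps [simp]: "reduce E [] = []" "reduce E (v # w) = lmul E v (reduce E w)"
  by (simp_all add: reduce_def)

lemma reduce_append: "reduce E (u @ w) = foldr (lmul E) u (reduce E w)"
  by (simp add: reduce_def)

locale racg =
  fixes E :: "'v \<Rightarrow> 'v \<Rightarrow> bool"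
  assumes simplicial: "simplicial_graph E"
begin

lemma E_sym: "E u v \<Longrightarrow> E v u" and E_irrefl: "\<not> E v v"
  using simplicial by (auto simp: simplicial_graph_def)

lemma exposed_decomp:
  assumes "exposed E v t"
  obtains a b where "t = a @ v # b" "\<forall>x\<in>set a. E v x" "v \<notin> set a" "remove1 v t = a @ b"
  using assms unfolding exposed_def
  by (metis E_irrefl remove1_append remove1.simps(2))

lemma exposed_Cons_self: "exposed E v (v # t)"
  unfolding exposed_def by (metis append_Nil empty_iff empty_set)

text \<open>Exposure is expressed through projections alone, which makes its invariance under
  \<open>trace_eq\<close> immediate. Membership of \<open>v\<close> keeps \<open>hd\<close> away
  from empty lists.\<close>

lemma exposed_iff_filter:
  "exposed E v t \<longleftrightarrow> v \<in> set t \<and> (\<forall>b. \<not> E v b \<longrightarrow> hd (filter (\<lambda>x. x = v \<or> x = b) t) = v)"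
proof
  assume "exposed E v t"
  then obtain a b where ab: "t = a @ v # b" "\<forall>x\<in>set a. E v x" "v \<notin> set a"
    by (rule exposed_decomp)
  have "hd (filter (\<lambda>x. x = v \<or> x = c) t) = v" if "\<not> E v c" for c
  proof -
    have "filter (\<lambda>x. x = v \<or> x = c) a = []"
      using ab that by (auto simp: filter_empty_conv)
    then show ?thesis using ab by simp
  qed
  then show "v \<in> set t \<and> (\<forall>b. \<not> E v b \<longrightarrow> hd (filter (\<lambda>x. x = v \<or> x = b) t) = v)"
    using ab by auto
next
  assume A: "v \<in> set t \<and> (\<forall>b. \<not> E v b \<longrightarrow> hd (filter (\<lambda>x. x = v \<or> x = b) t) = v)"
  then obtain a b where ab: "t = a @ v # b" "v \<notin> set a"
    by (meson split_list_first)
  have "E v x" if x: "x \<in> set a" for x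
  proof (rule ccontr)
    assume n: "\<not> E v x"
    have "filter (\<lambda>y. y = v \<or> y = x) a \<noteq> []" using x by (auto simp: filter_empty_conv)
    then have "hd (filter (\<lambda>y. y = v \<or> y = x) t) \<in> set (filter (\<lambda>y. y = v \<or> y = x) a)"
      using ab by (metis filter_append hd_append2 hd_in_set)
    then have "hd (filter (\<lambda>y. y = v \<or> y = x) t) \<in> set a" by auto
    then show False using A n ab by metis
  qed
  then show "exposed E v t" using ab by (auto simp: exposed_def)
qed

lemma trace_eq_refl [simp]: "trace_eq E t t" by (simp add: trace_eq_def)
lemma trace_eq_sym: "trace_eq E t t' \<Longrightarrow> trace_eq E t' t" by (simp add: trace_eq_def)
lemma trace_eq_trans: "trace_eq E t t' \<Longrightarrow> trace_eq E t' t'' \<Longrightarrow> trace_eq E t t''"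
  by (simp add: trace_eq_def)

lemma trace_eq_mem: "trace_eq E t t' \<Longrightarrow> x \<in> set t \<longleftrightarrow> x \<in> set t'"
proof -
  assume "trace_eq E t t'"
  then have "filter (\<lambda>y. y = x \<or> y = x) t = filter (\<lambda>y. y = x \<or> y = x) t'"
    using E_irrefl unfolding trace_eq_def by blast
  then have "set (filter (\<lambda>y. y = x \<or> y = x) t) = set (filter (\<lambda>y. y = x \<or> y = x) t')" by simp
  then show ?thesis by auto
qed

lemma trace_eq_exposed: 
  assumes "trace_eq E t t'" shows "exposed E v t \<longleftrightarrow> exposed E v t'"
proof -
  have "filter (\<lambda>x. x = v \<or> x = b) t = filter (\<lambda>x. x = v \<or> x = b) t'" if "\<not> E v b" for b
    using assms that unfolding trace_eq_def by blast
  then show ?thesis using trace_eq_mem[OF assms] by (auto simp: exposed_iff_filter)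
qed

lemma trace_eq_lmul: 
  assumes "trace_eq E t t'" shows "trace_eq E (lmul E v t) (lmul E v t')"
  using trace_eq_exposed[OF assms, of v] assms
  by (auto simp: lmul_def trace_eq_def simp: filter_remove1 remove1_filter_not)

lemma trace_eq_pull:
  assumes "\<forall>x\<in>set a. E v x" shows "trace_eq E (v # a @ b) (a @ v # b)"
  unfolding trace_eq_def
proof (intro allI impI)
  fix c d assume n: "\<not> E c d"
  show "filter (\<lambda>x. x = c \<or> x = d) (v # a @ b) = filter (\<lambda>x. x = c \<or> x = d) (a @ v # b)"
  proof (cases "v = c \<or> v = d")
    case True
    then have "filter (\<lambda>x. x = c \<or> x = d) a = []"
      using assms n E_sym E_irrefl by (auto simp: filter_empty_conv)
    then show ?thesis by simp
  qed auto
qed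

lemma reduced_Cons:
  assumes "reduced E (v # t)" shows "reduced E t" "\<not> exposed E v t"
proof -
  show "reduced E t" using assms unfolding reduced_def
    by (metis append_Cons)
  show "\<not> exposed E v t" using assms unfolding reduced_def exposed_def
    by (metis append_Nil)
qed

lemma reduced_ConsI:
  assumes "reduced E t" "\<not> exposed E v t" shows "reduced E (v # t)"
  unfolding reduced_def
proof (intro notI, elim exE conjE)
  fix a b c s assume eq: "v # t = a @ s # b @ s # c" and b: "\<forall>x\<in>set b. E s x"
  show False
  proof (cases a)
    case Nil
    then show False using eq b assms(2) unfolding exposed_def by auto
  next
    case (Cons x a')
    then have "t = a' @ s # b @ s # c" using eq by simp
    then show False using assms(1) b unfolding reduced_def by blast
  qed
qed

lemma append_eq_split_right:
  "a @ b = c @ v # d \<Longrightarrow> v \<notin> set a \<Longrightarrow> \<exists>e. c = a @ e \<and> b = e @ v # d"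
proof (induction a arbitrary: c)
  case (Cons x a)
  then show ?case by (cases c) auto
qed simp

lemma append_eq_split_left:
  "a @ b = c @ v # d \<Longrightarrow> v \<notin> set b \<Longrightarrow> \<exists>e. a = c @ v # e \<and> d = e @ b"
proof (induction c arbitrary: a)
  case Nil
  then show ?case by (cases a) auto
next
  case (Cons x c)
  then show ?case by (cases a) auto
qed

text \<open>The only new danger is a pair of equal letters that \<open>v\<close> kept apart. Its
  first member then stands in \<open>a\<close> and commutes with \<open>v\<close>, so the pair could
  be cancelled before the removal as well.\<close>

lemma reduced_remove:
  assumes "reduced E (a @ v # b)" "\<forall>x\<in>set a. E v x"
  shows "reduced E (a @ b)" "\<not> exposed E v (a @ b)"
proof -
  show "\<not> exposed E v (a @ b)"
  proof
    assume "exposed E v (a @ b)"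
    then obtain c d where cd: "a @ b = c @ v # d" "\<forall>x\<in>set c. E v x" "v \<notin> set c"
      by (rule exposed_decomp)
    have "v \<notin> set a" using assms E_irrefl by blast
    with cd obtain e where e: "c = a @ e" "b = e @ v # d"
      using append_eq_split_right by metis
    then have "a @ v # b = a @ v # e @ v # d" "\<forall>x\<in>set e. E v x" using cd by auto
    then show False using assms(1) unfolding reduced_def by blast
  qed
  show "reduced E (a @ b)"
    unfolding reduced_def
  proof (intro notI, elim exE conjE)
    fix c d e s assume eq: "a @ b = c @ s # d @ s # e" and d: "\<forall>x\<in>set d. E s x"
    from eq consider f where "a = c @ s # d @ s # f" "e = f @ b"
      | f g where "a = c @ s # f" "d = f @ g" "b = g @ s # e"
      | f where "c = a @ f" "b = f @ s # d @ s # e"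
      by (auto simp: append_eq_append_conv2 append_eq_Cons_conv Cons_eq_append_conv)
    then show False
    proof cases
      case 1
      then have "a @ v # b = c @ s # d @ s # (f @ v # b)" by simp
      then show False using assms(1) d unfolding reduced_def by blast
    next
      case 2
      then have "a @ v # b = c @ s # (f @ v # g) @ s # e" by simp
      moreover have "\<forall>x\<in>set (f @ v # g). E s x" using d 2 assms(2) E_sym by auto
      ultimately show False using assms(1) unfolding reduced_def by blast
    next
      case 3
      then have "a @ v # b = (a @ v # f) @ s # d @ s # e" by simp
      then show False using assms(1) d unfolding reduced_def by blast
    qed
  qed
qed

lemma reduced_lmul: "reduced E t \<Longrightarrow> reduced E (lmul E v t)"
proof (cases "exposed E v t")
  case True
  assume "reduced E t"
  moreover obtain a b where "t = a @ v # b" "\<forall>x\<in>set a. E v x" "remove1 v t = a @ b"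
    using True by (rule exposed_decomp)
  ultimately show ?thesis using True reduced_remove(1)[of a v b] by (simp add: lmul_def)
qed (simp add: lmul_def reduced_ConsI)

lemma reduced_reduce: "reduced E (reduce E w)"
  by (induction w) (auto simp: reduced_lmul, simp add: reduced_def)

lemma reduce_reduced: "reduced E t \<Longrightarrow> reduce E t = t"
proof (induction t)
  case (Cons v t)
  then show ?case using reduced_Cons[of v t] by (simp add: lmul_def)
qed simp

lemma exposed_lmul_self: "reduced E t \<Longrightarrow> exposed E v (lmul E v t) \<longleftrightarrow> \<not> exposed E v t"
proof (cases "exposed E v t")
  case True
  assume "reduced E t"
  then show ?thesis using True 
    by (metis exposed_decomp lmul_def reduced_remove(2))
next
  case False
  then show ?thesis by (simp add: lmul_def exposed_Cons_self)
qed

lemma exposed_lmul_adj: 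
  assumes "E u v" shows "exposed E v (lmul E u t) \<longleftrightarrow> exposed E v t"
proof -
  have ne: "u \<noteq> v" using assms E_irrefl by auto
  have *: "filter (\<lambda>x. x = v \<or> x = b) (lmul E u t) = filter (\<lambda>x. x = v \<or> x = b) t" if "\<not> E v b" for b
  proof -
    have "\<not> (u = v \<or> u = b)" using that assms E_sym ne by auto
    then show ?thesis by (auto simp: lmul_def filter_remove1)
  qed
  have "v \<in> set (lmul E u t) \<longleftrightarrow> v \<in> set t" using ne by (auto simp: lmul_def in_set_remove1)
  with * show ?thesis unfolding exposed_iff_filter by auto
qed

lemma exposed_exposed_adj:
  assumes "exposed E u t" "exposed E v t" "u \<noteq> v" shows "E u v"
proof -
  obtain a b where ab: "t = a @ u # b" "\<forall>x\<in>set a. E u x" using assms(1) by (rule exposed_decomp)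
  obtain c d where cd: "t = c @ v # d" "\<forall>x\<in>set c. E v x" using assms(2) by (rule exposed_decomp)
  have "a @ u # b = c @ v # d" using ab cd by simp
  then have "v \<in> set a \<or> u \<in> set c"
    using assms(3) by (auto simp: append_eq_append_conv2 Cons_eq_append_conv append_eq_Cons_conv)
  then show ?thesis using ab cd E_sym by blast
qed

text \<open>Only equality up to \<open>trace_eq\<close> can hold: a letter removed from the interior
  of the word returns at its front.\<close>

lemma lmul_lmul_self: assumes "reduced E t" shows "trace_eq E (lmul E v (lmul E v t)) t"
proof (cases "exposed E v t")
  case True
  then obtain a b where ab: "t = a @ v # b" "\<forall>x\<in>set a. E v x" "remove1 v t = a @ b" by (rule exposed_decomp)
  have "\<not> exposed E v (a @ b)" using reduced_remove ab assms by metis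
  then have "lmul E v (lmul E v t) = v # a @ b" using True ab by (simp add: lmul_def)
  then show ?thesis using ab trace_eq_pull by simp
next
  case False
  then show ?thesis by (simp add: lmul_def exposed_Cons_self)
qed

lemma lmul_commute: 
  assumes "E u v" shows "trace_eq E (lmul E u (lmul E v t)) (lmul E v (lmul E u t))"
proof -
  have ne: "u \<noteq> v" using assms E_irrefl by auto
  have e: "exposed E u (lmul E v t) = exposed E u t" "exposed E v (lmul E u t) = exposed E v t"
    using exposed_lmul_adj assms E_sym by blast+
  show ?thesis
    unfolding trace_eq_def
  proof (intro allI impI)
    fix a b assume n: "\<not> E a b"
    then have "\<not> ((u = a \<or> u = b) \<and> (v = a \<or> v = b))" using assms ne E_sym by auto
    then show "filter (\<lambda>x. x = a \<or> x = b) (lmul E u (lmul E v t)) = filter (\<lambda>x. x = a \<or> x = b) (lmul E v (lmul E u t))"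
      unfolding lmul_def[of E u "lmul E v t"] lmul_def[of E v "lmul E u t"] e
      by (auto simp: lmul_def remove1_commute filter_remove1 remove1_filter_not)
  qed
qed

lemma trace_eq_foldr: "trace_eq E t t' \<Longrightarrow> trace_eq E (foldr (lmul E) u t) (foldr (lmul E) u t')"
  by (induction u) (auto intro: trace_eq_lmul)

text \<open>Van der Waerden's trick: the generators act by \<open>lmul\<close> on reduced words
  modulo \<open>trace_eq\<close>, and this action satisfies the defining relations. Hence the class
  of the reduced word depends only on the group element.\<close>

lemma racg_step_reduce: "racg_step E w w' \<Longrightarrow> trace_eq E (reduce E w) (reduce E w')"
proof (induction rule: racg_step.induct)
  case (cancel xs s ys)
  show ?case unfolding reduce_append
    by (rule trace_eq_foldr) (simp add: lmul_lmul_self reduced_reduce)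
next
  case (commute s t xs ys)
  then show ?case unfolding reduce_append
    by (intro trace_eq_foldr) (simp add: lmul_commute)
qed

lemma racg_equiv_reduce: assumes "racg_equiv E w w'" shows "trace_eq E (reduce E w) (reduce E w')"
  using assms unfolding racg_equiv_def
proof (induction rule: rtranclp_induct)
  case (step y z)
  then have "trace_eq E (reduce E y) (reduce E z)"
    using racg_step_reduce trace_eq_sym by (auto simp: sup_fun_def)
  then show ?case using step trace_eq_trans by blast
qed simp


text \<open>The half-space of \<open>v\<close> not containing the identity: the elements that have a reduced word starting with \<open>v\<close>.\<close>
definition hs :: "'v \<Rightarrow> 'v list \<Rightarrow> bool" where
  "hs v w \<longleftrightarrow> exposed E v (reduce E w)"

section \<open>The group: words modulo the relations\<close>

lemma racg_equiv_refl [simp]: "racg_equiv E w w" by (simp add: racg_equiv_def)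

lemma racg_equiv_sym: "racg_equiv E w w' \<Longrightarrow> racg_equiv E w' w"
proof -
  have "symp (sup (racg_step E) (racg_step E)\<inverse>\<inverse>)" by (auto simp: symp_def)
  then show "racg_equiv E w w' \<Longrightarrow> racg_equiv E w' w"
    unfolding racg_equiv_def by (metis sympD symp_rtranclp)
qed

lemma racg_equiv_trans [trans]: "racg_equiv E w w' \<Longrightarrow> racg_equiv E w' w'' \<Longrightarrow> racg_equiv E w w''"
  by (simp add: racg_equiv_def)

lemma racg_equiv_step: "racg_step E w w' \<Longrightarrow> racg_equiv E w w'"
  unfolding racg_equiv_def by (rule r_into_rtranclp) auto

lemma racg_step_ctx: "racg_step E w w' \<Longrightarrow> racg_step E (a @ w @ b) (a @ w' @ b)"
proof (induction rule: racg_step.induct)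
  case (cancel xs s ys)
  show ?case using racg_step.cancel[of E "a @ xs" s "ys @ b"] by simp
next
  case (commute s t xs ys)
  then show ?case using racg_step.commute[of E s t "a @ xs" "ys @ b"] by simp
qed

lemma racg_equiv_ctx: "racg_equiv E w w' \<Longrightarrow> racg_equiv E (a @ w @ b) (a @ w' @ b)"
  unfolding racg_equiv_def
proof (induction rule: rtranclp_induct)
  case (step y z)
  then have "(sup (racg_step E) (racg_step E)\<inverse>\<inverse>) (a @ y @ b) (a @ z @ b)"
    using racg_step_ctx by auto
  then show ?case using step by (meson rtranclp.rtrancl_into_rtrancl)
qed simp

lemma racg_equiv_append: "racg_equiv E u u' \<Longrightarrow> racg_equiv E w w' \<Longrightarrow> racg_equiv E (u @ w) (u' @ w')"
  using racg_equiv_ctx[of u u' "[]" w] racg_equiv_ctx[of w w' u' "[]"] racg_equiv_trans by auto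

lemma racg_equiv_Cons: "racg_equiv E w w' \<Longrightarrow> racg_equiv E (v # w) (v # w')"
  using racg_equiv_append[of "[v]" "[v]"] by simp

lemma racg_equiv_cancel: "racg_equiv E (a @ s # s # b) (a @ b)"
  using racg_equiv_step[OF racg_step.cancel[of E a s b]] by simp

lemma racg_equiv_swap: "E s t \<Longrightarrow> racg_equiv E (a @ s # t # b) (a @ t # s # b)"
  using racg_equiv_step[OF racg_step.commute[of E s t a b]] by simp

lemma racg_equiv_pull:
  assumes "\<forall>x\<in>set a. E v x" shows "racg_equiv E (a @ v # b) (v # a @ b)"
  using assms
proof (induction a)
  case (Cons x a)
  then have "racg_equiv E (x # (a @ v # b)) (x # (v # a @ b))" by (intro racg_equiv_Cons) auto
  moreover have "racg_equiv E (x # v # a @ b) (v # x # a @ b)"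
    using racg_equiv_swap[of x v "[]" "a @ b"] Cons E_sym by auto
  ultimately show ?case using racg_equiv_trans by simp
qed simp

lemma racg_equiv_lmul: "racg_equiv E (v # w) (lmul E v w)"
proof (cases "exposed E v w")
  case True
  then obtain a b where ab: "w = a @ v # b" "\<forall>x\<in>set a. E v x" "remove1 v w = a @ b" by (rule exposed_decomp)
  have "racg_equiv E (v # a @ v # b) (v # v # a @ b)"
    by (intro racg_equiv_Cons racg_equiv_pull ab)
  also have "racg_equiv E \<dots> (a @ b)" using racg_equiv_cancel[of "[]"] by simp
  finally show ?thesis using True ab by (simp add: lmul_def)
qed (simp add: lmul_def)

lemma racg_equiv_reduce_self: "racg_equiv E w (reduce E w)"
proof (induction w)
  case (Cons v w)
  then have "racg_equiv E (v # w) (v # reduce E w)" by (rule racg_equiv_Cons)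
  also have "racg_equiv E \<dots> (lmul E v (reduce E w))" by (rule racg_equiv_lmul)
  finally show ?case by simp
qed simp

lemma racg_equiv_rev: assumes "racg_equiv E w w'" shows "racg_equiv E (rev w) (rev w')"
proof -
  have s: "racg_step E (rev x) (rev y)" if "racg_step E x y" for x y
    using that
  proof (induction rule: racg_step.induct)
    case (cancel xs s ys)
    show ?case using racg_step.cancel[of E "rev ys" s "rev xs"] by simp
  next
    case (commute s t xs ys)
    then show ?case using racg_step.commute[of E t s "rev ys" "rev xs"] E_sym by simp
  qed
  show ?thesis using assms unfolding racg_equiv_def
  proof (induction rule: rtranclp_induct)
    case (step y z)
    then have "(sup (racg_step E) (racg_step E)\<inverse>\<inverse>) (rev y) (rev z)" using s by auto
    then show ?case using step by (meson rtranclp.rtrancl_into_rtrancl)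
  qed simp
qed

lemma racg_equiv_inv_left: "racg_equiv E (rev w @ w) []"
proof (induction w)
  case (Cons v w)
  have "racg_equiv E (rev w @ v # v # w) (rev w @ w)" by (rule racg_equiv_cancel)
  then show ?case using Cons racg_equiv_trans by simp
qed simp

lemma racg_equiv_inv_right: "racg_equiv E (w @ rev w) []"
  using racg_equiv_inv_left[of "rev w"] by simp

lemma racg_equiv_cancel_Cons: "racg_equiv E (s # s # w) w"
  using racg_equiv_cancel[of "[]"] by simp

lemma hs_cong: "racg_equiv E w w' \<Longrightarrow> hs v w \<longleftrightarrow> hs v w'"
  unfolding hs_def using racg_equiv_reduce trace_eq_exposed by blast

lemma hs_Cons_self: "hs v (v # w) \<longleftrightarrow> \<not> hs v w"
  by (simp add: hs_def exposed_lmul_self reduced_reduce)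

lemma hs_Cons_adj: "E u v \<Longrightarrow> hs v (u # w) \<longleftrightarrow> hs v w"
  by (simp add: hs_def exposed_lmul_adj)

lemma hs_hs_adj: "hs u w \<Longrightarrow> hs v w \<Longrightarrow> u \<noteq> v \<Longrightarrow> E u v"
  unfolding hs_def by (rule exposed_exposed_adj)

section \<open>Right multiplication, wall crossings and centralizers\<close>

lemma reduced_rev: "reduced E (rev t) \<longleftrightarrow> reduced E t"
proof -
  have "reduced E (rev t)" if r: "reduced E t" for t
    unfolding reduced_def
  proof (intro notI, elim exE conjE)
    fix a b c s assume "rev t = a @ s # b @ s # c" and b: "\<forall>x\<in>set b. E s x"
    then have "t = rev (a @ s # b @ s # c)" by (metis rev_rev_ident)
    then have "t = rev c @ s # rev b @ s # rev a" by simp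
    then show False using r b unfolding reduced_def by (metis set_rev)
  qed
  from this[of t] this[of "rev t"] show ?thesis by auto
qed

text \<open>If appending \<open>s\<close> destroys reducedness, then an \<open>s\<close> inside
  \<open>t\<close> can be moved to the right end, where the two cancel. This is the statement about
  left ends, read backwards.\<close>

lemma reduced_snoc_dest:
  assumes "reduced E t" "\<not> reduced E (t @ [s])"
  obtains a b where "t = a @ s # b" "\<forall>x\<in>set b. E s x" "reduced E (a @ b)" "racg_equiv E t (a @ b @ [s])"
    "racg_equiv E (t @ [s]) (a @ b)"
proof -
  have "exposed E s (rev t)"
    using assms reduced_ConsI[of "rev t" s] reduced_rev by (metis rev.simps(2) rev_rev_ident)
  then obtain a b where ab: "rev t = a @ s # b" "\<forall>x\<in>set a. E s x" by (rule exposed_decomp)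
  then have t: "t = rev b @ s # rev a"
    by (metis append.assoc append_Cons append_Nil rev.simps(2) rev_append rev_rev_ident)
  have "reduced E (a @ b)" using reduced_remove(1)[of a s b] ab assms(1) reduced_rev by metis
  then have r: "reduced E (rev b @ rev a)" using reduced_rev by (metis rev_append)
  have "racg_equiv E (rev t) (s # a @ b)" using ab racg_equiv_pull by simp
  from racg_equiv_rev[OF this] have e: "racg_equiv E t (rev b @ rev a @ [s])" by simp
  then have "racg_equiv E (t @ [s]) ((rev b @ rev a) @ s # s # [])"
    using racg_equiv_append[OF e racg_equiv_refl[of "[s]"]] by simp
  also have "racg_equiv E \<dots> (rev b @ rev a)" using racg_equiv_cancel[of "rev b @ rev a" s "[]"] by simp
  finally show ?thesis using that[OF t _ r e] ab(2) by simp
qed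

lemma exposed_snoc:
  assumes "exposed E v (t @ [s])" "\<not> exposed E v t"
  shows "s = v" "\<forall>x\<in>set t. E v x"
proof -
  obtain a b where ab: "t @ [s] = a @ v # b" "\<forall>x\<in>set a. E v x" using assms(1) by (rule exposed_decomp)
  have "b = []"
  proof (rule ccontr)
    assume "b \<noteq> []"
    then obtain c x where "b = c @ [x]" by (meson rev_exhaust)
    then have "t = a @ v # c" using ab(1) by simp
    then show False using assms(2) ab(2) by (auto simp: exposed_def)
  qed
  then show "s = v" "\<forall>x\<in>set t. E v x" using ab by auto
qed

lemma exposed_append: "exposed E v t \<Longrightarrow> exposed E v (t @ u)"
  by (force simp: exposed_def)

lemma hs_snoc_reduced:
  assumes "reduced E t" "reduced E (t @ [s])" "hs v (t @ [s]) \<noteq> hs v t"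
  shows "racg_equiv E (v # t) (t @ [s])"
proof -
  have "exposed E v (t @ [s]) \<noteq> exposed E v t" using assms by (simp add: hs_def reduce_reduced)
  then have "exposed E v (t @ [s])" "\<not> exposed E v t" using exposed_append by blast+
  from exposed_snoc[OF this] show ?thesis
    using racg_equiv_pull[of t v "[]"] racg_equiv_sym by auto
qed

text \<open>Right multiplication by a generator leaves a half-space only by crossing its wall.\<close>
lemma hs_snoc:
  assumes "hs v (w @ [s]) \<noteq> hs v w" shows "racg_equiv E (v # w) (w @ [s])"
proof -
  define t where "t = reduce E w"
  have t: "racg_equiv E w t" "reduced E t" by (auto simp: t_def racg_equiv_reduce_self reduced_reduce)
  have ts: "racg_equiv E (w @ [s]) (t @ [s])" using t racg_equiv_append by auto
  have ne: "hs v (t @ [s]) \<noteq> hs v t" using assms hs_cong[OF t(1)] hs_cong[OF ts] by auto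
  have "racg_equiv E (v # t) (t @ [s])"
  proof (cases "reduced E (t @ [s])")
    case True then show ?thesis using hs_snoc_reduced t ne by blast
  next
    case False
    then obtain a b where ab: "t = a @ s # b" "\<forall>x\<in>set b. E s x" "reduced E (a @ b)"
      "racg_equiv E t (a @ b @ [s])" "racg_equiv E (t @ [s]) (a @ b)"
      using reduced_snoc_dest t by metis
    \<comment> \<open>The roles are now exchanged: \<open>t @ [s]\<close> represents the shorter
      element \<open>a @ b\<close>, and \<open>t\<close> arises from \<open>a @ b\<close> by
      appending \<open>s\<close>. If \<open>(a @ b) @ [s]\<close> were not reduced either,
      \<open>t\<close> would contain two letters \<open>s\<close> that cancel.\<close>
    show ?thesis
    proof (cases "reduced E ((a @ b) @ [s])")
      case True
      have "hs v ((a @ b) @ [s]) \<noteq> hs v (a @ b)" using ne ab(4,5) hs_cong by (metis append_assoc)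
      then have "racg_equiv E (v # a @ b) ((a @ b) @ [s])" using hs_snoc_reduced[OF ab(3) True] by simp
      then have e: "racg_equiv E (v # a @ b) t" using ab(4) racg_equiv_sym racg_equiv_trans by (metis append_assoc)
      have "racg_equiv E (v # t) (v # v # a @ b)" using e racg_equiv_Cons racg_equiv_sym by blast
      also have "racg_equiv E \<dots> (a @ b)" by (rule racg_equiv_cancel_Cons)
      also have "racg_equiv E \<dots> (t @ [s])" using ab(5) racg_equiv_sym by blast
      finally show ?thesis .
    next
      case False
      then obtain c d where cd: "a @ b = c @ s # d" "\<forall>x\<in>set d. E s x"
        using reduced_snoc_dest[OF ab(3)] by metis
      have "s \<notin> set b" using ab(2) E_irrefl by blast
      with cd(1) obtain e where e: "a = c @ s # e" "d = e @ b"
        using append_eq_split_left by metis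
      then have "t = c @ s # e @ s # b" "\<forall>x\<in>set e. E s x" using ab cd by auto
      then show ?thesis using t(2) unfolding reduced_def by blast
    qed
  qed
  moreover have "racg_equiv E (v # w) (v # t)" using t racg_equiv_Cons by blast
  ultimately show ?thesis using ts racg_equiv_sym racg_equiv_trans by blast
qed

text \<open>If \<open>u\<close> is not exposed in \<open>t\<close>, then passing from
  \<open>t\<close> to \<open>t @ [u]\<close>, which equals \<open>u # t\<close> in the group, enters
  the half-space of \<open>u\<close>. So the appended \<open>u\<close> can be moved to the front,
  past every letter of \<open>t\<close>. An exposed \<open>u\<close> is stripped off first.\<close>

lemma commuting_reduced_letters:
  assumes "reduced E t" "racg_equiv E (t @ [u]) (u # t)"
  shows "set t \<subseteq> insert u {x. E u x}"
proof -
  have A: "\<forall>x\<in>set t. E u x" if "reduced E t" "racg_equiv E (t @ [u]) (u # t)" "\<not> exposed E u t" for t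
  proof -
    have "\<not> hs u t" using that by (simp add: hs_def reduce_reduced)
    then have h: "hs u (t @ [u])" using hs_cong[OF that(2)] hs_Cons_self by simp
    show ?thesis
    proof (cases "reduced E (t @ [u])")
      case True
      then have "exposed E u (t @ [u])" using h by (simp add: hs_def reduce_reduced)
      then show ?thesis using exposed_snoc that(3) by blast
    next
      case False
      obtain a b where ab: "t = a @ u # b" "\<forall>x\<in>set b. E u x" "reduced E (a @ b)"
        and "racg_equiv E t (a @ b @ [u])" and ab4: "racg_equiv E (t @ [u]) (a @ b)"
        by (rule reduced_snoc_dest[OF \<open>reduced E t\<close> False])
      have "exposed E u (a @ b)" using h hs_cong[OF ab4] ab(3) by (simp add: hs_def reduce_reduced)
      then obtain c d where cd: "a @ b = c @ u # d" "\<forall>x\<in>set c. E u x" by (rule exposed_decomp)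
      have "u \<notin> set b" using ab(2) E_irrefl by blast
      with cd(1) obtain e where e: "a = c @ u # e"
        using append_eq_split_left by metis
      then have "exposed E u t" using ab cd by (auto simp: exposed_def)
      then show ?thesis using that by blast
    qed
  qed
  show ?thesis
  proof (cases "exposed E u t")
    case False then show ?thesis using A assms by auto
  next
    case True
    then obtain a b where ab: "t = a @ u # b" "\<forall>x\<in>set a. E u x" by (rule exposed_decomp)
    have e: "racg_equiv E t (u # a @ b)" using ab racg_equiv_pull by simp
    have "racg_equiv E (u # (a @ b) @ [u]) (t @ [u])" 
      using racg_equiv_append[OF racg_equiv_sym[OF e] racg_equiv_refl[of "[u]"]] by simp
    also have "racg_equiv E \<dots> (u # t)" by (rule assms)
    finally have "racg_equiv E (u # u # (a @ b) @ [u]) (u # u # t)" by (rule racg_equiv_Cons)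
    then have "racg_equiv E ((a @ b) @ [u]) t"
      using racg_equiv_cancel_Cons racg_equiv_sym racg_equiv_trans by meson
    then have "racg_equiv E ((a @ b) @ [u]) (u # a @ b)" using e racg_equiv_trans by blast
    then have "\<forall>x\<in>set (a @ b). E u x" using A reduced_remove assms(1) ab by metis
    then show ?thesis using ab by auto
  qed
qed

lemma reduced_two_letters:
  assumes "reduced E t" "set t \<subseteq> {u, v}" "E u v" shows "length t \<le> 2"
proof (rule ccontr)
  assume "\<not> length t \<le> 2"
  then obtain x y z r where t: "t = x # y # z # r"
    by (cases t; cases "tl t"; cases "tl (tl t)") auto
  have "x = y \<or> (x = z \<and> E x y) \<or> y = z"
    using assms(2,3) t E_sym by auto
  then consider "t = [] @ x # [] @ x # (z # r)" | "t = [] @ x # [y] @ x # r" "E x y" | "t = [x] @ y # [] @ y # r"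
    using t by auto
  then show False
  proof cases
    case 1 then show False using assms(1) unfolding reduced_def by (metis empty_iff empty_set)
  next
    case 2
    then have "\<forall>a\<in>set [y]. E x a" by simp
    then show False using assms(1) 2(1) unfolding reduced_def by blast
  next
    case 3 then show False using assms(1) unfolding reduced_def by (metis empty_iff empty_set)
  qed
qed

text \<open>In a triangle-free graph adjacent vertices have no common neighbour, so an element
  commuting with both \<open>u\<close> and \<open>v\<close> is written in these two letters, which
  generate a group of order four.\<close>

lemma centralizer_edge:
  assumes tf: "triangle_free E" and e: "E u v"
    and "racg_equiv E (g @ [u]) (u # g)" "racg_equiv E (g @ [v]) (v # g)"
  shows "length (reduce E g) \<le> 2"
proof -
  define t where "t = reduce E g"
  have t: "racg_equiv E g t" "reduced E t" by (auto simp: t_def racg_equiv_reduce_self reduced_reduce)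
  have "racg_equiv E (t @ [x]) (x # t)" if "racg_equiv E (g @ [x]) (x # g)" for x
    using racg_equiv_append[OF racg_equiv_sym[OF t(1)] racg_equiv_refl[of "[x]"]] 
      racg_equiv_Cons[OF t(1), of x] that racg_equiv_trans by blast
  then have "set t \<subseteq> insert u {x. E u x}" "set t \<subseteq> insert v {x. E v x}"
    using commuting_reduced_letters[OF t(2)] assms(3,4) by auto
  moreover have "\<not> (E u x \<and> E v x)" for x
    using tf e unfolding triangle_free_def by blast
  ultimately have "set t \<subseteq> {u, v}" by blast
  then show ?thesis using reduced_two_letters t(2) e t_def by blast
qed

section \<open>Word length and one-endedness\<close>

definition wlen :: "'v list \<Rightarrow> nat" where "wlen w = length (reduce E w)"

text \<open>Each \<open>lmul\<close> changes the length by one, up or down according to exposure,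
  which \<open>trace_eq\<close> preserves. So lengths can be followed together with trace classes
  through the steps of an equivalence.\<close>

lemma wlen_cong: assumes "racg_equiv E w w'" shows "wlen w = wlen w'"
proof -
  have l: "length (lmul E v t) + 2 * (if exposed E v t then 1 else 0) = length t + 1" for v t
  proof (cases "exposed E v t")
    case True
    then have "v \<in> set t" using exposed_iff_filter by blast
    then have "length t \<noteq> 0" by auto
    then show ?thesis using True \<open>v \<in> set t\<close> by (simp add: lmul_def length_remove1)
  qed (simp add: lmul_def)
  have L: "length (lmul E v t) = length (lmul E v t')" if "length t = length t'" "trace_eq E t t'" for v t t'
    using l[of v t] l[of v t'] that trace_eq_exposed[OF that(2), of v] by simp
  have F: "length (foldr (lmul E) u t) = length (foldr (lmul E) u t')" if "length t = length t'" "trace_eq E t t'" for u t t'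
    using that by (induction u) (auto intro!: L trace_eq_foldr)
  have S: "wlen w = wlen w'" if "racg_step E w w'" for w w'
    using that
  proof (induction rule: racg_step.induct)
    case (cancel xs s ys)
    have "length (lmul E s (lmul E s (reduce E ys))) = length (reduce E ys)"
      using l[of s "lmul E s (reduce E ys)"] l[of s "reduce E ys"] exposed_lmul_self[OF reduced_reduce, of s ys]
      by (simp split: if_splits)
    then show ?case unfolding wlen_def reduce_append
      by (intro F) (simp_all add: lmul_lmul_self reduced_reduce)
  next
    case (commute s t xs ys)
    then have e: "exposed E s (lmul E t (reduce E ys)) = exposed E s (reduce E ys)"
      "exposed E t (lmul E s (reduce E ys)) = exposed E t (reduce E ys)"
      using exposed_lmul_adj E_sym by blast+
    have "length (lmul E s (lmul E t (reduce E ys))) = length (lmul E t (lmul E s (reduce E ys)))"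
      using l[of s "lmul E t (reduce E ys)"] l[of t "reduce E ys"] l[of t "lmul E s (reduce E ys)"] l[of s "reduce E ys"]
      unfolding e by simp
    then show ?case unfolding wlen_def reduce_append
      using commute by (intro F) (simp_all add: lmul_commute)
  qed
  show ?thesis using assms unfolding racg_equiv_def
  proof (induction rule: rtranclp_induct)
    case (step y z)
    then show ?case using S by (auto simp: sup_fun_def)
  qed simp
qed

lemma wlen_Cons: "hs s w \<Longrightarrow> wlen w = Suc (wlen (s # w))" "\<not> hs s w \<Longrightarrow> wlen (s # w) = Suc (wlen w)"
proof -
  assume h: "hs s w"
  then have "s \<in> set (reduce E w)" unfolding hs_def using exposed_iff_filter by blast
  moreover from this have "length (reduce E w) \<noteq> 0" by auto
  ultimately show "wlen w = Suc (wlen (s # w))"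
    using h by (simp add: wlen_def hs_def lmul_def length_remove1)
qed (simp add: wlen_def hs_def lmul_def)

text \<open>Removing the (at most two, pairwise adjacent) generators that shorten an element leaves a connected graph,
  so a path in the Cayley graph can be pushed off balls of growing radius.\<close>
lemma one_ended:
  assumes tf: "triangle_free E" and ins: "inseparable E"
    and nonadj: "a \<noteq> b" "\<not> E a b"
    and inv: "\<And>w w'. racg_equiv E w w' \<Longrightarrow> f w = f w'"
    and loc: "\<And>w s. n \<le> wlen w \<Longrightarrow> n \<le> wlen (s # w) \<Longrightarrow> f w = f (s # w)"
    and "n \<le> wlen w" "n \<le> wlen w'"
  shows "f w = f w'"
  using inv loc assms(7,8)
proof (induction n arbitrary: f w w')
  case 0
  have "f u = f []" for u
  proof (induction u)
    case (Cons s u)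
    then show ?case using 0(2)[of u s] by simp
  qed simp
  then show ?case by metis
next
  case (Suc n)
  note inv = Suc.prems(1) and loc = Suc.prems(2)
  define up where "up w = (SOME s. \<not> hs s w)" for w
  have conn: "connected_on E (UNIV - {s. hs s w})" for w
  proof -
    consider u v where "{s. hs s w} = {u, v}" "E u v" | u where "{s. hs s w} = {u}" | "{s. hs s w} = {}"
    proof (cases "\<exists>u v. u \<noteq> v \<and> hs u w \<and> hs v w")
      case True
      then obtain u v where uv: "u \<noteq> v" "hs u w" "hs v w" by blast
      have "x = u \<or> x = v" if "hs x w" for x
      proof (rule ccontr)
        assume "\<not> (x = u \<or> x = v)"
        then have "E u v" "E v x" "E u x" using hs_hs_adj uv that by blast+
        then show False using tf unfolding triangle_free_def by blast
      qed
      then have "{s. hs s w} = {u, v}" using uv by auto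
      moreover have "E u v" using hs_hs_adj uv by blast
      ultimately show ?thesis using that(1) by simp
    next
      case False
      show ?thesis
      proof (cases "\<exists>u. hs u w")
        case True
        then obtain u where "hs u w" by blast
        then have "{s. hs s w} = {u}" using False by auto
        then show ?thesis using that(2) by simp
      next
        case False
        then show ?thesis using that(3) by simp
      qed
    qed
    then show ?thesis
    proof cases
      case 1
      then show ?thesis using ins by (auto simp: inseparable_def separating_def)
    next
      case 2
      then show ?thesis using ins by (auto simp: inseparable_def separating_def)
    next
      case 3
      then show ?thesis using ins by (auto simp: inseparable_def separating_def)
    qed
  qed
  have ex: "\<exists>s. \<not> hs s w" for w using hs_hs_adj nonadj by blast
  then have up: "\<not> hs (up w) w" for w unfolding up_def by (rule someI_ex)
  have hsc: "hs s (t # w) \<longleftrightarrow> hs s w" if "E t s" for s t w using hs_Cons_adj that by blast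
  have nb: "f (s # w) = f (t # w)" if w: "wlen w = n" and s: "\<not> hs s w" and t: "\<not> hs t w" for s t w
  proof -
    have "(\<lambda>a b. E a b \<and> a \<in> UNIV - {s. hs s w} \<and> b \<in> UNIV - {s. hs s w})\<^sup>*\<^sup>* s t"
      using conn[of w] s t unfolding connected_on_def by blast
    then show ?thesis
    proof (induction rule: rtranclp_induct)
      case (step y z)
      then have yz: "E y z" "\<not> hs y w" "\<not> hs z w" by auto
      have l: "wlen (y # w) = Suc n" "wlen (z # w) = Suc n" using wlen_Cons yz w by auto
      have "\<not> hs z (y # w)" "\<not> hs y (z # w)" using hsc[of y z w] hsc[of z y w] yz E_sym by auto
      \<comment> \<open>The top of the commuting square over \<open>w\<close>: from
        \<open>y # w\<close> and \<open>z # w\<close> one climbs to the same element, of length n +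
        2, and both edges lie where \<open>loc\<close> applies.\<close>
      then have l2: "wlen (z # y # w) = Suc (Suc n)" "wlen (y # z # w) = Suc (Suc n)" using wlen_Cons l by auto
      have "f (y # w) = f (z # y # w)" using loc[of "y # w" z] l l2 by simp
      also have "\<dots> = f (y # z # w)" using inv racg_equiv_swap[of z y "[]" w] yz E_sym by simp
      also have "\<dots> = f (z # w)" using loc[of "z # w" y] l l2 by simp
      finally show ?case using step by simp
    qed simp
  qed
  \<comment> \<open>The function is extended inwards by one sphere: on elements of length n it takes
    the value at any longer neighbour, and \<open>nb\<close> makes the choice irrelevant. Since
    \<open>up\<close> depends only on the half-spaces, \<open>f'\<close> is still a function on the
    group.\<close>
  define f' where "f' w = (if Suc n \<le> wlen w then f w else f (up w # w))" for w
  have up_cong: "up w = up w'" if "racg_equiv E w w'" for w w'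
    unfolding up_def using hs_cong[OF that] by simp
  have key: "f' w = f (s # w)" if "wlen w = n" "\<not> hs s w" for s w
    using nb[OF that(1) up that(2)] that(1) by (simp add: f'_def)
  have "f' w = f' w'"
  proof (rule Suc.IH)
    show "f' w = f' w'" if "racg_equiv E w w'" for w w'
      using inv[OF that] wlen_cong[OF that] up_cong[OF that] inv[OF racg_equiv_Cons[OF that]]
      by (simp add: f'_def)
    show "f' w = f' (s # w)" if "n \<le> wlen w" "n \<le> wlen (s # w)" for w s
    proof (cases "hs s w")
      case True
      then have l: "wlen w = Suc (wlen (s # w))" using wlen_Cons by blast
      show ?thesis
      proof (cases "wlen (s # w) = n")
        case True
        have "\<not> hs s (s # w)" using \<open>hs s w\<close> hs_Cons_self by simp
        then have "f' (s # w) = f (s # s # w)" using key True by blast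
        also have "\<dots> = f w" by (rule inv[OF racg_equiv_cancel_Cons])
        finally show ?thesis using l True by (simp add: f'_def)
      next
        case False
        then show ?thesis using l that loc[of w s] by (simp add: f'_def)
      qed
    next
      case False
      then have l: "wlen (s # w) = Suc (wlen w)" using wlen_Cons by blast
      show ?thesis
      proof (cases "wlen w = n")
        case True
        then show ?thesis using key False l by (simp add: f'_def)
      next
        case False
        then show ?thesis using l that loc[of w s] by (simp add: f'_def)
      qed
    qed
  qed (use Suc.prems in auto)
  then show ?case using Suc.prems by (simp add: f'_def)
qed

lemma wlen_unbounded:
  assumes "a \<noteq> b" "\<not> E a b" shows "\<exists>w. wlen w = n"
proof -
  have "\<exists>w. wlen w = n \<and> (hs a w \<longrightarrow> \<not> hs b w)"
  proof (induction n)
    case 0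
    then show ?case by (intro exI[of _ "[]"]) (auto simp: wlen_def hs_def exposed_def)
  next
    case (Suc n)
    then obtain w where w: "wlen w = n" by blast
    obtain s where "\<not> hs s w" using hs_hs_adj assms by blast
    then show ?case using wlen_Cons(2)[of s w] w hs_hs_adj assms by (intro exI[of _ "s # w"]) auto
  qed
  then show ?thesis by blast
qed

end

section \<open>Drawing graphs in the plane\<close>

definition balls :: "real \<Rightarrow> complex list \<Rightarrow> complex set" where
  "balls r cs = (\<Union>c\<in>set cs. ball c r)"

text \<open>The head is the ball attached last. Recursion strips balls until the first one, whose
  centre \<open>last cs\<close> becomes the centre of the star.\<close>

fun ball_chain :: "real \<Rightarrow> complex list \<Rightarrow> bool" where
  "ball_chain r [] \<longleftrightarrow> False"
| "ball_chain r [c] \<longleftrightarrow> True"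
| "ball_chain r (c # cs) \<longleftrightarrow> ball_chain r cs \<and> ball c r \<inter> balls r cs \<noteq> {}"

lemma open_balls [simp]: "open (balls r cs)" by (auto simp: balls_def)

lemma balls_Cons: "balls r (c # cs) = ball c r \<union> balls r cs" by (auto simp: balls_def)

lemma open_segment_in_ball:
  fixes q :: "'a::euclidean_space"
  assumes "q \<in> ball c r" "x \<in> cball c r" shows "open_segment q x \<subseteq> ball c r"
proof -
  have "0 < r" using assms(1) by (metis ball_eq_empty empty_iff not_le)
  then have "q \<in> interior (ball c r)" "x \<in> closure (ball c r)" using assms by auto
  from in_interior_closure_convex_segment[OF convex_ball this] show ?thesis
    by (simp add: interior_open)
qed

text \<open>The point \<open>q\<close> is any interior point of the ball. If the segments met
  elsewhere, they would lie on one ray from \<open>q\<close>, and the nearer endpoint would be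
  interior to a segment whose inner points belong to the open ball.\<close>

lemma segments_meet_in_centre:
  fixes q :: "'a::euclidean_space"
  assumes q: "q \<in> ball c r" and x: "x \<in> sphere c r" and y: "y \<in> sphere c r" and "x \<noteq> y"
  shows "closed_segment q x \<inter> closed_segment q y \<subseteq> {q}"
proof -
  have A: False if x: "x \<in> sphere c r" and y: "y \<in> sphere c r" and ne: "x \<noteq> y"
    and s: "0 < s" "s < t" "t \<le> 1" and eq: "(1 - s) *\<^sub>R q + s *\<^sub>R x = (1 - t) *\<^sub>R q + t *\<^sub>R y" for x y s t
  proof -
    have "t *\<^sub>R y = (t - s) *\<^sub>R q + s *\<^sub>R x" using eq by (simp add: algebra_simps)
    then have "(1/t) *\<^sub>R (t *\<^sub>R y) = (1/t) *\<^sub>R ((t - s) *\<^sub>R q + s *\<^sub>R x)" by simp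
    then have y2: "y = (1 - s/t) *\<^sub>R q + (s/t) *\<^sub>R x"
      using s by (simp add: scaleR_add_right diff_divide_distrib)
    have "q \<noteq> x" using q x by auto
    then have "y \<in> open_segment q x"
      using s y2 by (auto simp: in_segment intro!: exI[of _ "s/t"])
    then have "y \<in> ball c r" using open_segment_in_ball[of q c r x] q x by auto
    then show False using y by auto
  qed
  show ?thesis
  proof
    fix z assume "z \<in> closed_segment q x \<inter> closed_segment q y"
    then have "\<exists>s. z = (1 - s) *\<^sub>R q + s *\<^sub>R x \<and> 0 \<le> s \<and> s \<le> 1"
      and "\<exists>t. z = (1 - t) *\<^sub>R q + t *\<^sub>R y \<and> 0 \<le> t \<and> t \<le> 1"
      by (simp_all add: in_segment) (metis)+
    then obtain s t where s: "z = (1 - s) *\<^sub>R q + s *\<^sub>R x" "0 \<le> s" "s \<le> 1"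
      and t: "z = (1 - t) *\<^sub>R q + t *\<^sub>R y" "0 \<le> t" "t \<le> 1"
      by blast
    consider "s = 0" | "t = 0" | "0 < s" "s < t" | "0 < t" "t < s" | "s = t" "0 < s" using s t by linarith
    then show "z \<in> {q}"
    proof cases
      case 3 then show ?thesis using A[OF x y \<open>x \<noteq> y\<close>, of s t] s t by auto
    next
      case 4 then show ?thesis using A[OF y x \<open>x \<noteq> y\<close>[symmetric], of t s] s t by auto
    next
      case 5 then have "x = y" using s t by auto
      then show ?thesis using \<open>x \<noteq> y\<close> by blast
    qed (use s t in auto)
  qed
qed

text \<open>The star is pulled back ball by ball: inside the last ball, straight segments towards a point of the
  earlier balls carry the given frontier points to distinct frontier points of the earlier union.\<close>
lemma star_in_ball_chain:
  assumes "ball_chain r cs" "0 < r" "inj_on x J" "\<And>j. j \<in> J \<Longrightarrow> x j \<in> frontier (balls r cs)"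
  shows "\<exists>K. (\<forall>j\<in>J. path (K j) \<and> pathstart (K j) = last cs \<and> pathfinish (K j) = x j \<and>
      path_image (K j) \<subseteq> insert (x j) (balls r cs)) \<and>
    (\<forall>j\<in>J. \<forall>k\<in>J. j \<noteq> k \<longrightarrow> path_image (K j) \<inter> path_image (K k) \<subseteq> {last cs})"
  using assms
proof (induction r cs arbitrary: x rule: ball_chain.induct)
  case (1 r) then show ?case by simp
next
  case (2 r c)
  have sph: "x j \<in> sphere c r" if "j \<in> J" for j
    using 2(4)[OF that] \<open>0 < r\<close> by (auto simp: balls_def frontier_ball)
  have c: "c \<in> ball c r" using \<open>0 < r\<close> by simp
  show ?case
  proof (intro exI[of _ "\<lambda>j. linepath c (x j)"] conjI ballI impI)
    fix j assume j: "j \<in> J"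
    have "open_segment c (x j) \<subseteq> ball c r" using open_segment_in_ball[OF c] sph[OF j] by auto
    then show "path_image (linepath c (x j)) \<subseteq> insert (x j) (balls r [c])"
      using c by (auto simp: balls_def closed_segment_eq_open)
    fix k assume k: "k \<in> J" "j \<noteq> k"
    then have "x j \<noteq> x k" using 2(3) j by (auto dest: inj_onD)
    then show "path_image (linepath c (x j)) \<inter> path_image (linepath c (x k)) \<subseteq> {last [c]}"
      using segments_meet_in_centre[OF c sph[OF j] sph[OF k(1)]] by simp
  qed auto
next
  case (3 r c d cs)
  let ?O = "balls r (d # cs)"
  have chain: "ball_chain r (d # cs)" and "ball c r \<inter> ?O \<noteq> {}" using 3(2) by auto
  then obtain q where q: "q \<in> ball c r" "q \<in> ?O" by blast
  have fr: "x j \<in> frontier (ball c r \<union> ?O)" if "j \<in> J" for j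
    using 3(5)[OF that] by (simp only: balls_Cons)
  then have out: "x j \<notin> ball c r" "x j \<notin> ?O" if "j \<in> J" for j
    using that open_Un[OF open_ball[of c r] open_balls[of r "d # cs"]] 
    by (auto simp: frontier_def interior_open)
  have sph: "x j \<in> sphere c r" if "j \<in> J" "x j \<notin> closure ?O" for j
    using fr[OF that(1)] out[OF that(1)] that(2) \<open>0 < r\<close> by (auto simp: frontier_def closure_Un)
  \<comment> \<open>Points in the closure of the earlier balls stay in place. Any other point lies
    on the sphere of the newest ball and slides along the segment towards \<open>q\<close> until it
    first reaches that closure. The segment outside it becomes the end of the leg.\<close>
  define moved where "moved j \<longleftrightarrow> x j \<notin> closure ?O" for j
  have "\<exists>y. y \<in> frontier ?O \<and> y \<in> open_segment q (x j) \<and> closed_segment y (x j) - {y} \<subseteq> - closure ?O" 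
    if j: "j \<in> J" "moved j" for j
  proof -
    let ?g = "linepath (x j) q"
    have "pathstart ?g \<in> closure (- closure ?O)" 
      using j closure_subset[of "- closure ?O"] by (auto simp: moved_def)
    moreover have "pathfinish ?g \<notin> - closure ?O" using q closure_subset by auto
    ultimately obtain u where u: "0 \<le> u" "u \<le> 1" "?g u \<in> frontier (- closure ?O)" 
        "path_image (subpath 0 u ?g) - {?g u} \<subseteq> interior (- closure ?O)"
      using subpath_to_frontier[of ?g] by (metis path_linepath)
    define y where "y = ?g u"
    have sub: "path_image (subpath 0 u ?g) = closed_segment y (x j)"
    proof -
      have "path_image (subpath 0 u ?g) = (\<lambda>t. (1 - t) *\<^sub>R x j + t *\<^sub>R q) ` {0..u}"
        using u by (simp add: path_image_subpath linepath_def)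
      also have "\<dots> = closed_segment (x j) y"
      proof
        show "(\<lambda>t. (1 - t) *\<^sub>R x j + t *\<^sub>R q) ` {0..u} \<subseteq> closed_segment (x j) y"
        proof
          fix z assume "z \<in> (\<lambda>t. (1 - t) *\<^sub>R x j + t *\<^sub>R q) ` {0..u}"
          then obtain t where t: "0 \<le> t" "t \<le> u" "z = (1 - t) *\<^sub>R x j + t *\<^sub>R q" by auto
          show "z \<in> closed_segment (x j) y"
          proof (cases "u = 0")
            case True then show ?thesis using t by simp
          next
            case False
            then have "z = (1 - t/u) *\<^sub>R x j + (t/u) *\<^sub>R y" unfolding y_def linepath_def t(3) 
              by (simp add: algebra_simps)
            then show ?thesis using t False u by (auto simp: in_segment intro!: exI[of _ "t/u"])
          qed
        qed
        show "closed_segment (x j) y \<subseteq> (\<lambda>t. (1 - t) *\<^sub>R x j + t *\<^sub>R q) ` {0..u}"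
        proof
          fix z assume "z \<in> closed_segment (x j) y"
          then obtain t where t: "0 \<le> t" "t \<le> 1" "z = (1 - t) *\<^sub>R x j + t *\<^sub>R y" by (auto simp: in_segment)
          then have "z = (1 - t*u) *\<^sub>R x j + (t*u) *\<^sub>R q" unfolding y_def linepath_def by (simp add: algebra_simps)
          moreover have "0 \<le> t * u" "t * u \<le> u" using t u by (auto simp: mult_left_le_one_le)
          ultimately show "z \<in> (\<lambda>t. (1 - t) *\<^sub>R x j + t *\<^sub>R q) ` {0..u}" by auto
        qed
      qed
      finally show ?thesis by (simp add: closed_segment_commute)
    qed
    have "y \<in> closure ?O" using u(3) unfolding y_def frontier_complement[of "closure ?O"]
      by (simp add: frontier_def)
    have "frontier (closure ?O) \<subseteq> frontier ?O" using interior_mono[OF closure_subset, of ?O] by (auto simp: frontier_def)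
    then have yfr: "y \<in> frontier ?O" using u(3) unfolding y_def frontier_complement by blast
    then have "y \<notin> ?O" by (simp add: frontier_def interior_open)
    then have "y \<noteq> q" "y \<noteq> x j" using q j \<open>y \<in> closure ?O\<close> by (auto simp: moved_def)
    moreover have "y \<in> closed_segment q (x j)" unfolding y_def closed_segment_commute[of q] 
      using u linepath_in_path[of u] by auto
    ultimately have "y \<in> open_segment q (x j)" by (simp add: open_segment_def)
    moreover have "closed_segment y (x j) - {y} \<subseteq> - closure ?O"
      using u(4) interior_subset unfolding sub y_def[symmetric] by blast
    ultimately show ?thesis using yfr by blast
  qed
  then obtain y0 where y0: "\<And>j. j \<in> J \<Longrightarrow> moved j \<Longrightarrow> y0 j \<in> frontier ?O \<and> y0 j \<in> open_segment q (x j) \<and>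
      closed_segment (y0 j) (x j) - {y0 j} \<subseteq> - closure ?O" by metis
  define y where "y j = (if moved j then y0 j else x j)" for j
  have ym: "y j \<in> frontier ?O" "y j \<in> open_segment q (x j)" "closed_segment (y j) (x j) - {y j} \<subseteq> - closure ?O"
    if "j \<in> J" "moved j" for j using y0[OF that] that by (auto simp: y_def)
  have yball: "y j \<in> ball c r" if "j \<in> J" "moved j" for j
    using ym(2)[OF that] open_segment_in_ball[OF q(1), of "x j"] sph[of j] that unfolding moved_def by auto
  have yfr: "y j \<in> frontier ?O" if "j \<in> J" for j
  proof (cases "moved j")
    case False
    then show ?thesis using out[OF that] by (simp add: y_def moved_def frontier_def interior_open)
  qed (use ym that in auto)
  have yO: "y j \<notin> ?O" "y j \<in> closure ?O" if "j \<in> J" for j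
    using yfr[OF that] by (simp_all add: frontier_def interior_open)
  have seg: "closed_segment (y j) (x j) \<subseteq> closed_segment q (x j)" if "j \<in> J" for j
  proof (cases "moved j")
    case True
    then have "y j \<in> closed_segment q (x j)" using ym[OF that] by (simp add: open_segment_def)
    then show ?thesis by (simp add: subset_closed_segment)
  next
    case False
    then show ?thesis by (simp add: y_def)
  qed
  have qseg: "q \<notin> closed_segment (y j) (x j)" if "j \<in> J" for j
  proof (cases "moved j")
    case True
    have "q \<noteq> y j" using yO[OF that] q by auto
    moreover have "q \<in> closure ?O" using q closure_subset by blast
    ultimately show ?thesis using ym(3)[OF that True] by blast
  next
    case False
    then have "y j = x j" by (simp add: y_def)
    then show ?thesis using yO[OF that] q by auto
  qed
  have seg_disj: "closed_segment (y j) (x j) \<inter> closed_segment (y k) (x k) = {}" if jk: "j \<in> J" "k \<in> J" "j \<noteq> k" for j k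
  proof -
    have ne: "x j \<noteq> x k" using 3(4) jk by (auto dest: inj_onD)
    consider "moved j" "moved k" | "\<not> moved j" | "\<not> moved k" by blast
    then show ?thesis
    proof cases
      case 1
      then have "closed_segment q (x j) \<inter> closed_segment q (x k) \<subseteq> {q}"
        using segments_meet_in_centre[OF q(1) sph sph ne] jk by (auto simp: moved_def)
      then show ?thesis using seg[OF jk(1)] seg[OF jk(2)] qseg[OF jk(1)] by blast
    next
      case 2
      then have yj: "y j = x j" "x j \<in> closure ?O" by (auto simp: y_def moved_def)
      show ?thesis
      proof (cases "moved k")
        case True
        have "x j \<noteq> y k" using yball[OF jk(2) True] out[OF jk(1)] by auto
        then show ?thesis using ym(3)[OF jk(2) True] yj by auto
      qed (use yj ne in \<open>auto simp: y_def\<close>)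
    next
      case 3
      then have yj: "y k = x k" "x k \<in> closure ?O" by (auto simp: y_def moved_def)
      show ?thesis
      proof (cases "moved j")
        case True
        have "x k \<noteq> y j" using yball[OF jk(1) True] out[OF jk(2)] by auto
        then show ?thesis using ym(3)[OF jk(1) True] yj by auto
      qed (use yj ne in \<open>auto simp: y_def\<close>)
    qed
  qed
  have "inj_on y J" 
  proof (rule inj_onI, rule ccontr)
    fix j k assume "j \<in> J" "k \<in> J" "y j = y k" "j \<noteq> k"
    then show False using seg_disj[of j k] by (metis disjoint_iff ends_in_segment(1))
  qed
  from "3.IH"[OF chain \<open>0 < r\<close> this yfr] obtain K where
    K: "\<And>j. j \<in> J \<Longrightarrow> path (K j) \<and> pathstart (K j) = last (d # cs) \<and> pathfinish (K j) = y j \<and>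
          path_image (K j) \<subseteq> insert (y j) ?O"
    and Kd: "\<And>j k. j \<in> J \<Longrightarrow> k \<in> J \<Longrightarrow> j \<noteq> k \<Longrightarrow> path_image (K j) \<inter> path_image (K k) \<subseteq> {last (d # cs)}"
    by metis
  define L where "L j = K j +++ linepath (y j) (x j)" for j
  have img: "path_image (L j) = path_image (K j) \<union> closed_segment (y j) (x j)" if "j \<in> J" for j
    using K[OF that] by (simp add: L_def path_image_join)
  have KS: "path_image (K j) \<inter> closed_segment (y k) (x k) = {}" if jk: "j \<in> J" "k \<in> J" "j \<noteq> k" for j k
  proof -
    have "?O \<inter> closed_segment (y k) (x k) = {}"
    proof (cases "moved k")
      case True
      then show ?thesis using ym(3)[OF jk(2) True] yO[OF jk(2)] closure_subset[of ?O] by auto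
    next
      case False
      then have "y k = x k" by (simp add: y_def)
      then show ?thesis using yO[OF jk(2)] by auto
    qed
    moreover have "y j \<notin> closed_segment (y k) (x k)" using seg_disj[OF jk] by auto
    ultimately show ?thesis using K[OF jk(1)] by blast
  qed
  show ?case
  proof (intro exI[of _ L] conjI ballI impI)
    fix j assume j: "j \<in> J"
    show "path (L j)" using K[OF j] by (simp add: L_def)
    show "pathstart (L j) = last (c # d # cs)" "pathfinish (L j) = x j" using K[OF j] by (simp_all add: L_def)
    have "closed_segment (y j) (x j) \<subseteq> insert (x j) (ball c r)"
    proof (cases "moved j")
      case True
      have "open_segment (y j) (x j) \<subseteq> ball c r"
        using open_segment_in_ball[OF yball[OF j True], of "x j"] sph[OF j] True by (auto simp: moved_def)
      then show ?thesis using yball[OF j True] by (auto simp: closed_segment_eq_open)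
    qed (simp add: y_def)
    then show "path_image (L j) \<subseteq> insert (x j) (balls r (c # d # cs))"
      using K[OF j] unfolding img[OF j] balls_Cons[of r c] by auto
    fix k assume k: "k \<in> J" "j \<noteq> k"
    have "path_image (K j) \<inter> path_image (K k) \<subseteq> {last (d # cs)}" by (rule Kd[OF j k])
    then show "path_image (L j) \<inter> path_image (L k) \<subseteq> {last (c # d # cs)}"
      using KS[OF j k] KS[OF k(1) j k(2)[symmetric]] seg_disj[OF j k] unfolding img[OF j] img[OF k(1)] by auto
  qed
qed

text \<open>The balls of a finite subcover are attached greedily: as long as some remain,
  connectedness of \<open>T\<close> forces one of them to meet the union of those already
  used.\<close>

lemma connected_ball_chain_cover:
  assumes T: "compact T" "connected T" "T \<noteq> {}" and "0 < r"
  obtains cs where "ball_chain r cs" "set cs \<subseteq> T" "T \<subseteq> balls r cs"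
proof -
  have "T \<subseteq> (\<Union>c\<in>T. ball c r)" using \<open>0 < r\<close> by auto
  from compactE_image[OF T(1) _ this] obtain F where F: "F \<subseteq> T" "finite F" "T \<subseteq> (\<Union>c\<in>F. ball c r)" by auto
  have "\<exists>cs'. ball_chain r cs' \<and> set cs' = F" if "ball_chain r cs" "set cs \<subseteq> F" for cs
    using that
  proof (induction "card (F - set cs)" arbitrary: cs rule: less_induct)
    case less
    show ?case
    proof (cases "set cs = F")
      case True then show ?thesis using less by blast
    next
      case False
      let ?A = "balls r cs" and ?B = "\<Union>c\<in>F - set cs. ball c r"
      have "cs \<noteq> []" using less(2) by auto
      then obtain a where a: "a \<in> set cs" by (meson list.set_sel(1))
      then have "a \<in> ?A" using centre_in_ball \<open>0 < r\<close> unfolding balls_def by blast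
      then have "a \<in> ?A \<inter> T" using less(3) F(1) a by blast
      then have "?A \<inter> T \<noteq> {}" by blast
      moreover obtain b where "b \<in> F - set cs" using False less(3) by blast
      then have "b \<in> ?B \<inter> T" using F(1) \<open>0 < r\<close> centre_in_ball by blast
      then have "?B \<inter> T \<noteq> {}" by blast
      moreover have "T \<subseteq> ?A \<union> ?B" using F(3) by (auto simp: balls_def)
      ultimately have "?A \<inter> ?B \<noteq> {}" using connectedD[OF T(2), of ?A ?B] by auto
      then obtain c where c: "c \<in> F - set cs" "ball c r \<inter> ?A \<noteq> {}" by blast
      then have "ball_chain r (c # cs)" using less(2) \<open>cs \<noteq> []\<close> by (cases cs) auto
      moreover have "set (c # cs) \<subseteq> F" using c less(3) by auto
      moreover have "card (F - set (c # cs)) < card (F - set cs)"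
        using c F(2) by (intro psubset_card_mono) auto
      ultimately show ?thesis using less(1) by blast
    qed
  qed
  moreover obtain c where "c \<in> F" using F T(3) by blast
  ultimately obtain cs where "ball_chain r cs" "set cs = F" 
    using ball_chain.simps(2)[of r c] by (metis empty_subsetI insert_subset list.simps(15) empty_set)
  then show ?thesis using that F by (simp add: balls_def)
qed

section \<open>Plane drawings obtained from continua\<close>

definition plane_graph :: "('v \<Rightarrow> 'v \<Rightarrow> bool) \<Rightarrow> bool" where
  "plane_graph E \<longleftrightarrow>
    (\<exists>(p :: 'v \<Rightarrow> complex) (\<gamma> :: 'v \<Rightarrow> 'v \<Rightarrow> real \<Rightarrow> complex).
       inj p
     \<and> (\<forall>u v. E u v \<longrightarrow> arc (\<gamma> u v) \<and> pathstart (\<gamma> u v) = p u \<and> pathfinish (\<gamma> u v) = p v)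
     \<and> (\<forall>u v w. E u v \<longrightarrow> p w \<in> path_image (\<gamma> u v) \<longrightarrow> w = u \<or> w = v)
     \<and> (\<forall>u v a b. E u v \<longrightarrow> E a b \<longrightarrow> {u, v} \<noteq> {a, b} \<longrightarrow>
          path_image (\<gamma> u v) \<inter> path_image (\<gamma> a b) \<subseteq> p ` ({u, v} \<inter> {a, b})))"

text \<open>The path is trimmed twice: read backwards it is stopped on first reaching the frontier
  of \<open>A\<close>, and the remainder, read forwards again, on first reaching the frontier of
  \<open>B\<close>.\<close>

lemma subpath_between_open_sets:
  fixes e :: "real \<Rightarrow> 'a::real_normed_vector"
  assumes "open A" "open B" "closure A \<inter> closure B = {}" 
    and e: "path e" "pathstart e \<in> A" "pathfinish e \<in> B"
  obtains s where "path s" "path_image s \<subseteq> path_image e - A - B" "pathstart s \<in> frontier A" "pathfinish s \<in> frontier B"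
proof -
  have "path (reversepath e)" "pathstart (reversepath e) \<in> closure (- A)" "pathfinish (reversepath e) \<notin> - A"
    using e assms(3) closure_subset by (auto intro!: closure_subset[THEN subsetD])
  then obtain h where h: "path h" "pathstart h = pathfinish e" "path_image h \<subseteq> path_image e"
      "path_image h - {pathfinish h} \<subseteq> interior (- A)" "pathfinish h \<in> frontier (- A)"
    using exists_path_subpath_to_frontier by (metis path_image_reversepath pathstart_reversepath)
  have hf: "pathfinish h \<in> frontier A" using h(5) by (simp add: frontier_complement)
  then have "pathfinish h \<notin> A" "pathfinish h \<in> closure A" using assms(1) by (auto simp: frontier_def interior_open)
  then have hA: "path_image h \<inter> A = {}" using h(4) interior_subset by blast
  have "pathfinish h \<notin> B" using \<open>pathfinish h \<in> closure A\<close> assms(3) closure_subset by blast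
  then have "path (reversepath h)" "pathstart (reversepath h) \<in> closure (- B)" "pathfinish (reversepath h) \<notin> - B"
    using e h by (auto intro!: closure_subset[THEN subsetD])
  then obtain s where s: "path s" "pathstart s = pathfinish h" "path_image s \<subseteq> path_image h"
      "path_image s - {pathfinish s} \<subseteq> interior (- B)" "pathfinish s \<in> frontier (- B)"
    using exists_path_subpath_to_frontier by (metis path_image_reversepath pathstart_reversepath)
  have sf: "pathfinish s \<in> frontier B" using s(5) by (simp add: frontier_complement)
  then have "pathfinish s \<notin> B" using assms(2) by (auto simp: frontier_def interior_open)
  then have sB: "path_image s \<inter> B = {}" using s(4) interior_subset by blast
  show ?thesis
    by (rule that[of s]) (use s h hf sf hA sB in auto)
qed

lemma disjoint_compacts_separated:
  fixes P :: "('a::euclidean_space set \<times> 'a set) set"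
  assumes "finite P" "\<And>A B. (A, B) \<in> P \<Longrightarrow> compact A \<and> compact B \<and> A \<inter> B = {}"
  shows "\<exists>r>0. \<forall>(A, B)\<in>P. \<forall>a\<in>A. \<forall>b\<in>B. r < dist a b"
  using assms
proof (induction P rule: finite_induct)
  case empty
  then show ?case by (auto intro: exI[of _ 1])
next
  case (insert AB P)
  obtain A B where AB: "AB = (A, B)" by fastforce
  obtain r where r: "0 < r" "\<forall>(A, B)\<in>P. \<forall>a\<in>A. \<forall>b\<in>B. r < dist a b" using insert by auto
  have "compact A" "closed B" "A \<inter> B = {}" using insert(4) AB compact_imp_closed by auto
  then obtain d where d: "0 < d" "\<forall>a\<in>A. \<forall>b\<in>B. d \<le> dist a b" using separate_compact_closed by meson
  show ?case
  proof (intro exI[of _ "min r (d/2)"] conjI)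
    show "\<forall>(A, B)\<in>insert AB P. \<forall>a\<in>A. \<forall>b\<in>B. min r (d/2) < dist a b"
    proof (clarify)
      fix C D a b assume "(C, D) \<in> insert AB P" "a \<in> C" "b \<in> D"
      then consider "(C, D) \<in> P" | "C = A" "D = B" using AB by auto
      then show "min r (d/2) < dist a b"
      proof cases
        case 1 then have "r < dist a b" using r(2) \<open>a \<in> C\<close> \<open>b \<in> D\<close> by fast
        then show ?thesis by simp
      next
        case 2 then have "d \<le> dist a b" using d(2) \<open>a \<in> C\<close> \<open>b \<in> D\<close> by fast
        then show ?thesis using d(1) by simp
      qed
    qed
  qed (use r d in auto)
qed

text \<open>Contracting disjoint continua to points: thicken each continuum to a chain of balls and replace it by a star.\<close>
lemma plane_graph_of_continua:
  fixes E :: "'v::finite \<Rightarrow> 'v \<Rightarrow> bool" and T :: "'v \<Rightarrow> complex set" and e :: "'v \<Rightarrow> 'v \<Rightarrow> real \<Rightarrow> complex"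
  assumes sym: "\<And>u v. E u v \<Longrightarrow> E v u" and irr: "\<And>u. \<not> E u u"
    and T: "\<And>v. compact (T v)" "\<And>v. connected (T v)" "\<And>v. T v \<noteq> {}"
    and Td: "\<And>u v. u \<noteq> v \<Longrightarrow> T u \<inter> T v = {}"
    and e: "\<And>u v. E u v \<Longrightarrow> path (e u v) \<and> pathstart (e u v) \<in> T u \<and> pathfinish (e u v) \<in> T v"
    and erev: "\<And>u v. E u v \<Longrightarrow> path_image (e v u) = path_image (e u v)"
    and eT: "\<And>u v w. E u v \<Longrightarrow> w \<noteq> u \<Longrightarrow> w \<noteq> v \<Longrightarrow> path_image (e u v) \<inter> T w = {}"
    and ed: "\<And>u v a b. E u v \<Longrightarrow> E a b \<Longrightarrow> {u, v} \<noteq> {a, b} \<Longrightarrow> path_image (e u v) \<inter> path_image (e a b) = {}"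
  shows "plane_graph E"
proof -
  define P where "P = (\<lambda>(u, v). (T u, T v)) ` {(u, v). u \<noteq> v} \<union> 
     (\<lambda>(u, v, w). (path_image (e u v), T w)) ` {(u, v, w). E u v \<and> w \<noteq> u \<and> w \<noteq> v}"
  have "finite P" unfolding P_def by simp
  moreover have "compact A \<and> compact B \<and> A \<inter> B = {}" if "(A, B) \<in> P" for A B
  proof -
    from that consider u v where "A = T u" "B = T v" "u \<noteq> v"
      | u v w where "A = path_image (e u v)" "B = T w" "E u v" "w \<noteq> u" "w \<noteq> v"
      unfolding P_def by auto
    then show ?thesis
    proof cases
      case 1 then show ?thesis using T(1) Td by simp
    next
      case 2 then show ?thesis using T(1) eT[OF 2(3-5)] e[OF 2(3)] compact_path_image[of "e u v"] by simp
    qed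
  qed
  ultimately obtain r0 where r0: "0 < r0" "\<forall>(A, B)\<in>P. \<forall>a\<in>A. \<forall>b\<in>B. r0 < dist a b"
    using disjoint_compacts_separated[of P] by auto
  \<comment> \<open>Sets more than \<open>2 * r\<close> apart keep disjoint closed neighbourhoods of
    radius \<open>r\<close>, which contain the closures of the ball chains.\<close>
  define r where "r = r0 / 2"
  have r: "0 < r" using r0 by (simp add: r_def)
  have rT: "2 * r < dist a b" if "u \<noteq> v" "a \<in> T u" "b \<in> T v" for u v a b
  proof -
    have "(T u, T v) \<in> P" using that unfolding P_def by auto
    then show ?thesis using r0 that unfolding r_def by fastforce
  qed
  have re: "2 * r < dist a b" if "E u v" "w \<noteq> u" "w \<noteq> v" "a \<in> path_image (e u v)" "b \<in> T w" for u v w a b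
  proof -
    have "(path_image (e u v), T w) \<in> P" using that unfolding P_def by (intro UnI2 image_eqI[where x="(u, v, w)"]) auto
    then show ?thesis using r0 that unfolding r_def by fastforce
  qed
  have "\<exists>cs. ball_chain r cs \<and> set cs \<subseteq> T v \<and> T v \<subseteq> balls r cs" for v
    using connected_ball_chain_cover[OF T(1)[of v] T(2)[of v] T(3)[of v] r] by metis
  then obtain cs where cs: "\<And>v. ball_chain r (cs v)" "\<And>v. set (cs v) \<subseteq> T v" "\<And>v. T v \<subseteq> balls r (cs v)" by metis
  define O' where "O' v = balls r (cs v)" for v
  have opn: "open (O' v)" for v by (simp add: O'_def)
  have cl: "\<exists>t\<in>T v. dist t x \<le> r" if "x \<in> closure (O' v)" for x v
  proof -
    have "closure (O' v) \<subseteq> (\<Union>c\<in>set (cs v). cball c r)" unfolding O'_def balls_def 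
      using ball_subset_cball by (intro closure_minimal closed_UN) (auto simp: less_imp_le)
    then show ?thesis using that cs(2)[of v] by fastforce
  qed
  have Odisj: "closure (O' u) \<inter> closure (O' v) = {}" if ne: "u \<noteq> v" for u v
  proof (rule ccontr)
    assume "closure (O' u) \<inter> closure (O' v) \<noteq> {}"
    then obtain x s t where "s \<in> T u" "dist s x \<le> r" "t \<in> T v" "dist t x \<le> r" using cl by blast
    moreover have "dist s t \<le> dist s x + dist t x" by (metis dist_commute dist_triangle)
    ultimately show False using rT[OF ne, of s t] by linarith
  qed
  have eO: "path_image (e u v) \<inter> closure (O' w) = {}" if ne: "E u v" "w \<noteq> u" "w \<noteq> v" for u v w
  proof (rule ccontr)
    assume "path_image (e u v) \<inter> closure (O' w) \<noteq> {}"
    then obtain x t where "x \<in> path_image (e u v)" "t \<in> T w" "dist t x \<le> r" using cl by blast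
    then show False using re[OF ne, of x t] r by (simp add: dist_commute)
  qed
  have "\<exists>s. path s \<and> path_image s \<subseteq> path_image (e u v) - O' u - O' v \<and> pathstart s \<in> frontier (O' u) \<and> pathfinish s \<in> frontier (O' v)"
    if "E u v" for u v
  proof -
    have "u \<noteq> v" using irr that by blast
    have "pathstart (e u v) \<in> O' u" "pathfinish (e u v) \<in> O' v" using e[OF that] cs(3) unfolding O'_def by blast+
    then show ?thesis 
      using subpath_between_open_sets[OF opn opn Odisj[OF \<open>u \<noteq> v\<close>], of "e u v"] e[OF that] by metis
  qed
  then obtain s0 where s0: "\<And>u v. E u v \<Longrightarrow> path (s0 u v) \<and> path_image (s0 u v) \<subseteq> path_image (e u v) - O' u - O' v \<and> 
     pathstart (s0 u v) \<in> frontier (O' u) \<and> pathfinish (s0 u v) \<in> frontier (O' v)" by metis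
  \<comment> \<open>The two orientations of an edge were trimmed independently. An ordering of the
    vertices selects one of them, so that the stars at both ends are attached to the same
    path.\<close>
  obtain idx :: "'v \<Rightarrow> nat" where idx: "inj idx" by (meson finite_imp_inj_to_nat_seg finite_class.finite_UNIV)
  define s where "s u v = (if idx u < idx v then s0 u v else reversepath (s0 v u))" for u v
  have s: "path (s u v)" "path_image (s u v) \<subseteq> path_image (e u v) - O' u - O' v" 
     "pathstart (s u v) \<in> frontier (O' u)" "pathfinish (s u v) \<in> frontier (O' v)" if "E u v" for u v
    using s0[OF that] s0[OF sym[OF that]] erev[OF that] unfolding s_def by auto
  have srev: "pathfinish (s u v) = pathstart (s v u)" if "E u v" for u v
  proof -
    have "idx u \<noteq> idx v" using idx irr that by (metis injD)
    then show ?thesis unfolding s_def by auto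
  qed
  have sO: "path_image (s u v) \<inter> O' w = {}" if "E u v" for u v w
    using s(2)[OF that] eO[OF that, of w] closure_subset[of "O' w"] by blast
  have sd: "path_image (s u v) \<inter> path_image (s a b) = {}" if "E u v" "E a b" "{u, v} \<noteq> {a, b}" for u v a b
    using s(2)[OF that(1)] s(2)[OF that(2)] ed[OF that] by blast
  have start_in: "pathstart (s u v) \<in> path_image (s u v)" for u v by (rule pathstart_in_path_image)
  have "\<exists>K. (\<forall>v\<in>{v. E u v}. path (K v) \<and> pathstart (K v) = last (cs u) \<and> pathfinish (K v) = pathstart (s u v) \<and>
      path_image (K v) \<subseteq> insert (pathstart (s u v)) (balls r (cs u))) \<and>
    (\<forall>v\<in>{v. E u v}. \<forall>k\<in>{v. E u v}. v \<noteq> k \<longrightarrow> path_image (K v) \<inter> path_image (K k) \<subseteq> {last (cs u)})" for u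
  proof (rule star_in_ball_chain[OF cs(1) r])
    show "inj_on (\<lambda>v. pathstart (s u v)) {v. E u v}"
    proof (rule inj_onI, rule ccontr)
      fix v w assume v: "v \<in> {v. E u v}" "w \<in> {v. E u v}" "pathstart (s u v) = pathstart (s u w)" "v \<noteq> w"
      then have "{u, v} \<noteq> {u, w}" by (auto simp: doubleton_eq_iff)
      then show False using sd[of u v u w] v start_in[of u v] start_in[of u w] by auto
    qed
  qed (use s(3) O'_def in auto)
  then obtain K where K: "\<And>u v. E u v \<Longrightarrow> path (K u v) \<and> pathstart (K u v) = last (cs u) \<and> pathfinish (K u v) = pathstart (s u v) \<and>
      path_image (K u v) \<subseteq> insert (pathstart (s u v)) (O' u)"
    and Kd: "\<And>u v k. E u v \<Longrightarrow> E u k \<Longrightarrow> v \<noteq> k \<Longrightarrow> path_image (K u v) \<inter> path_image (K u k) \<subseteq> {last (cs u)}"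
    unfolding O'_def by (metis mem_Collect_eq)
  define p where "p v = last (cs v)" for v
  have pO: "p v \<in> O' v" for v
  proof -
    have "cs v \<noteq> []" using cs(1)[of v] by auto
    then have "p v \<in> set (cs v)" by (simp add: p_def)
    then show ?thesis using r centre_in_ball unfolding O'_def balls_def by blast
  qed
  have OO: "O' u \<inter> O' v = {}" if "u \<noteq> v" for u v using Odisj[OF that] closure_subset by blast
  have "inj p" using pO OO by (intro injI) (metis disjoint_iff)
  define L where "L u v = path_image (K u v) \<union> path_image (s u v) \<union> path_image (K v u)" for u v
  \<comment> \<open>The concatenation of two legs and a connecting path may intersect itself; only
    an arc inside its image is retained, and all disjointness is checked on the larger set
    \<open>L u v\<close>.\<close>
  have "\<exists>g. arc g \<and> path_image g \<subseteq> L u v \<and> pathstart g = p u \<and> pathfinish g = p v" if uv: "E u v" for u v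
  proof -
    have "u \<noteq> v" using irr uv by blast
    then have "p u \<noteq> p v" using \<open>inj p\<close> by (simp add: inj_eq)
    let ?g = "K u v +++ s u v +++ reversepath (K v u)"
    have "path ?g" "pathstart ?g = p u" "pathfinish ?g = p v"
      using K[OF uv] K[OF sym[OF uv]] s[OF uv] srev[OF uv] by (auto simp: p_def)
    moreover have "path_image ?g = L u v"
      using K[OF uv] K[OF sym[OF uv]] s[OF uv] srev[OF uv] by (auto simp: L_def path_image_join)
    ultimately show ?thesis using path_contains_arc[of ?g "p u" "p v"] \<open>p u \<noteq> p v\<close> by metis
  qed
  then obtain \<gamma> where \<gamma>: "\<And>u v. E u v \<Longrightarrow> arc (\<gamma> u v) \<and> path_image (\<gamma> u v) \<subseteq> L u v \<and> pathstart (\<gamma> u v) = p u \<and> pathfinish (\<gamma> u v) = p v"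
    by metis
  have Ksub: "path_image (K u v) \<subseteq> insert (pathstart (s u v)) (O' u)" if "E u v" for u v using K[OF that] by blast
  have KK: "path_image (K u v) \<inter> path_image (K a b) \<subseteq> p ` ({u} \<inter> {a})" 
    if uv: "E u v" and ab: "E a b" and ne: "(u, v) \<noteq> (a, b)" for u v a b
  proof (cases "u = a")
    case True
    then show ?thesis using Kd[of u v b] uv ab ne by (auto simp: p_def)
  next
    case False
    have 1: "pathstart (s u v) \<notin> O' a" "pathstart (s a b) \<notin> O' u"
      using sO[OF uv, of a] sO[OF ab, of u] start_in by blast+
    have "pathstart (s u v) \<noteq> pathstart (s a b)"
      using s(3)[OF uv] s(3)[OF ab] Odisj[OF False] by (auto simp: frontier_def)
    then show ?thesis using Ksub[OF uv] Ksub[OF ab] OO[OF False] 1 by blast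
  qed
  have Ks: "path_image (K u v) \<inter> path_image (s a b) = {}" if uv: "E u v" and ab: "E a b" and ne: "{u, v} \<noteq> {a, b}" for u v a b
    using Ksub[OF uv] sO[OF ab, of u] sd[OF uv ab ne] start_in[of u v] by blast
  have img: "p ` ({u} \<inter> {a}) \<subseteq> p ` ({u, v} \<inter> {a, b})" "p ` ({v} \<inter> {a}) \<subseteq> p ` ({u, v} \<inter> {a, b})"
     "p ` ({u} \<inter> {b}) \<subseteq> p ` ({u, v} \<inter> {a, b})" "p ` ({v} \<inter> {b}) \<subseteq> p ` ({u, v} \<inter> {a, b})" for u v a b by auto
  show ?thesis
    unfolding plane_graph_def
  proof (intro exI conjI allI impI)
    show "inj p" by fact
  next
    fix u v assume "E u v"
    then show "arc (\<gamma> u v)" "pathstart (\<gamma> u v) = p u" "pathfinish (\<gamma> u v) = p v" using \<gamma> by blast+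
  next
    fix u v w assume uv: "E u v" and "p w \<in> path_image (\<gamma> u v)"
    then have "p w \<in> L u v" using \<gamma> by blast
    moreover have "p w \<notin> path_image (s u v)" using sO[OF uv, of w] pO[of w] by blast
    moreover have "pathstart (s u v) \<noteq> p w" using sO[OF uv, of w] pO[of w] start_in[of u v] by auto
    moreover have "pathstart (s v u) \<noteq> p w" using sO[OF sym[OF uv], of w] pO[of w] start_in[of v u] by auto
    ultimately have "p w \<in> O' u \<or> p w \<in> O' v" using Ksub[OF uv] Ksub[OF sym[OF uv]] unfolding L_def by auto
    then show "w = u \<or> w = v" using pO[of w] OO by blast
  next
    fix u v a b assume uv: "E u v" and ab: "E a b" and ne: "{u, v} \<noteq> {a, b}"
    have ne': "(u, v) \<noteq> (a, b)" "(u, v) \<noteq> (b, a)" "(v, u) \<noteq> (a, b)" "(v, u) \<noteq> (b, a)" using ne by auto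
    have ne2: "{v, u} \<noteq> {a, b}" "{a, b} \<noteq> {u, v}" "{b, a} \<noteq> {u, v}" using ne by auto
    note vu = sym[OF uv] and ba = sym[OF ab]
    let ?R = "p ` ({u, v} \<inter> {a, b})"
    have "path_image (K u v) \<inter> path_image (K a b) \<subseteq> ?R" "path_image (K u v) \<inter> path_image (K b a) \<subseteq> ?R"
       "path_image (K v u) \<inter> path_image (K a b) \<subseteq> ?R" "path_image (K v u) \<inter> path_image (K b a) \<subseteq> ?R"
      using KK[OF uv ab ne'(1)] KK[OF uv ba ne'(2)] KK[OF vu ab ne'(3)] KK[OF vu ba ne'(4)] img[of u a v b] img[of v b u a] by auto
    moreover have "path_image (K u v) \<inter> path_image (s a b) \<subseteq> ?R" "path_image (K v u) \<inter> path_image (s a b) \<subseteq> ?R"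
      "path_image (s u v) \<inter> path_image (K a b) \<subseteq> ?R" "path_image (s u v) \<inter> path_image (K b a) \<subseteq> ?R"
      using Ks[OF uv ab ne] Ks[OF vu ab ne2(1)] Ks[OF ab uv ne2(2)] Ks[OF ba uv ne2(3)] by auto
    moreover have "path_image (s u v) \<inter> path_image (s a b) \<subseteq> ?R" using sd[OF uv ab ne] by simp
    ultimately have "L u v \<inter> L a b \<subseteq> ?R" unfolding L_def Int_Un_distrib Int_Un_distrib2 by (intro Un_least)
    then show "path_image (\<gamma> u v) \<inter> path_image (\<gamma> a b) \<subseteq> ?R" using \<gamma>[OF uv] \<gamma>[OF ab] by blast
  qed
qed

text \<open>A system of continua touching in single points; the contact of \<open>X x\<close> and \<open>X y\<close> is the endpoint of a path
  attached to one of the two. Cutting the attached paths shortly before their endpoints reduces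
  to disjoint continua joined by short paths.\<close>
lemma plane_graph_of_contacts:
  fixes E H :: "'v::finite \<Rightarrow> 'v \<Rightarrow> bool" and Y X :: "'v \<Rightarrow> complex set" and q :: "'v \<Rightarrow> 'v \<Rightarrow> real \<Rightarrow> complex"
  assumes tf: "\<And>u v w. E u v \<Longrightarrow> E v w \<Longrightarrow> \<not> E u w" and sym: "\<And>u v. E u v \<Longrightarrow> E v u" and irr: "\<And>u. \<not> E u u"
    and Y: "\<And>v. compact (Y v)" "\<And>v. connected (Y v)" "\<And>v. Y v \<noteq> {}"
    and EH: "\<And>u v. E u v \<longleftrightarrow> H u v \<or> H v u" and asym: "\<And>u v. \<not> (H u v \<and> H v u)"
    and q: "\<And>x y. H x y \<Longrightarrow> path (q x y)" "\<And>x y. H x y \<Longrightarrow> pathstart (q x y) \<in> Y x"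
    and X: "\<And>x. X x = Y x \<union> (\<Union>y\<in>{y. H x y}. path_image (q x y))"
    and fin: "\<And>x y. H x y \<Longrightarrow> pathfinish (q x y) \<in> X y" "\<And>x y. H x y \<Longrightarrow> pathfinish (q x y) \<notin> Y x"
    and once: "\<And>x y t. H x y \<Longrightarrow> 0 \<le> t \<Longrightarrow> t < 1 \<Longrightarrow> q x y t \<noteq> pathfinish (q x y)"
    and other: "\<And>x y z. H x y \<Longrightarrow> H x z \<Longrightarrow> z \<noteq> y \<Longrightarrow> pathfinish (q x y) \<notin> path_image (q x z)"
    and Xd: "\<And>x y. x \<noteq> y \<Longrightarrow> \<not> E x y \<Longrightarrow> X x \<inter> X y = {}"
    and Xc: "\<And>x y. H x y \<Longrightarrow> X x \<inter> X y \<subseteq> {pathfinish (q x y)}"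
  shows "plane_graph E"
proof -
  define t where "t x y = pathfinish (q x y)" for x y
  have tX: "t x y \<in> X x" "t x y \<in> X y" if "H x y" for x y
    using fin[OF that] X[of x] that pathfinish_in_path_image[of "q x y"] by (auto simp: t_def)
  \<comment> \<open>A common contact point of two different pairs would lie in the sets of three
    distinct vertices. Sets of non-adjacent vertices are disjoint, so these three vertices would
    form a triangle.\<close>
  have tdist: "t x y \<noteq> t a b" if h: "H x y" "H a b" "(x, y) \<noteq> (a, b)" for x y a b
  proof
    assume eq: "t x y = t a b"
    have meet: "u = v \<or> E u v" if "t x y \<in> X u" "t x y \<in> X v" for u v using Xd that by blast
    have E: "E x y" "E a b" using h EH by auto
    then have "x \<noteq> y" "a \<noteq> b" using irr by auto
    then have "a \<notin> {x, y} \<or> b \<notin> {x, y}" using h asym by auto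
    then obtain c where c: "c \<notin> {x, y}" "c = a \<or> c = b" by blast
    then have "t x y \<in> X c" using tX[OF h(2)] eq by auto
    then have "E x c" "E y c" using meet tX[OF h(1)] c(1) by blast+
    then show False using tf E by blast
  qed
  define P where "P = (\<lambda>((x, y), (a, b)). ({t x y}, {t a b})) ` {((x, y), (a, b)). t x y \<noteq> t a b}"
  have "finite P" unfolding P_def by simp
  moreover have "compact A \<and> compact B \<and> A \<inter> B = {}" if "(A, B) \<in> P" for A B
    using that unfolding P_def by auto
  ultimately obtain r where r: "0 < r" "\<forall>(A, B)\<in>P. \<forall>a\<in>A. \<forall>b\<in>B. r < dist a b"
    using disjoint_compacts_separated[of P] by auto
  have rt: "r < dist (t x y) (t a b)" if "H x y" "H a b" "(x, y) \<noteq> (a, b)" for x y a b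
  proof -
    have "({t x y}, {t a b}) \<in> P" unfolding P_def using tdist[OF that]
      by (intro image_eqI[where x="((x, y), (a, b))"]) auto
    then show ?thesis using r(2) by fastforce
  qed
  \<comment> \<open>The cutting time: from \<open>d\<close> on, the path stays within
    \<open>r / 2\<close> of its contact point, so the tails of different pairs lie in disjoint
    balls.\<close>
  have "\<exists>d. 0 \<le> d \<and> d < 1 \<and> (\<forall>s. d \<le> s \<longrightarrow> s \<le> 1 \<longrightarrow> dist (q x y s) (t x y) < r / 2)" if "H x y" for x y
  proof -
    have "continuous_on {0..1} (q x y)" using q(1)[OF that] by (simp add: path_def)
    then obtain e where e: "0 < e" "\<And>s. s \<in> {0..1} \<Longrightarrow> dist s 1 < e \<Longrightarrow> dist (q x y s) (q x y 1) < r / 2"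
      using r(1) unfolding continuous_on_iff by (metis atLeastAtMost_iff half_gt_zero order_refl zero_le_one)
    show ?thesis
    proof (intro exI[of _ "max 0 (1 - e/2)"] conjI allI impI)
      fix s assume "max 0 (1 - e / 2) \<le> s" "s \<le> (1::real)"
      then have "s \<in> {0..1}" "dist s 1 < e" using e(1) by (auto simp: dist_real_def)
      then show "dist (q x y s) (t x y) < r / 2" using e(2) by (simp add: t_def pathfinish_def)
    qed (use e in auto)
  qed
  then obtain d where d: "\<And>x y. H x y \<Longrightarrow> 0 \<le> d x y \<and> d x y < 1"
    and dq: "\<And>x y s. H x y \<Longrightarrow> d x y \<le> s \<Longrightarrow> s \<le> 1 \<Longrightarrow> dist (q x y s) (t x y) < r / 2" by metis
  define T where "T x = Y x \<union> (\<Union>y\<in>{y. H x y}. q x y ` {0..d x y})" for x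
  have qpi: "q x y ` {0..d x y} \<subseteq> path_image (q x y)" if "H x y" for x y
    using d[OF that] by (auto simp: path_image_def)
  have TX: "T x \<subseteq> X x" for x unfolding T_def X using qpi by blast
  define s where "s x y = (if H x y then subpath (d x y) 1 (q x y) else reversepath (subpath (d y x) 1 (q y x)))" for x y
  have simg: "path_image (subpath (d x y) 1 (q x y)) = q x y ` {d x y..1}" if "H x y" for x y
    using d[OF that] by (simp add: path_image_subpath)
  have sball: "path_image (subpath (d x y) 1 (q x y)) \<subseteq> ball (t x y) (r/2)" if "H x y" for x y
    using dq[OF that] by (auto simp: simg[OF that] dist_commute)
  have sX: "path_image (subpath (d x y) 1 (q x y)) \<subseteq> X x" if "H x y" for x y
    unfolding simg[OF that] X using d[OF that] that by (auto simp: path_image_def)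
  have far: "t a b \<notin> ball (t x y) (r/2)" if "H x y" "H a b" "(x, y) \<noteq> (a, b)" for x y a b
    using rt[OF that] r(1) by auto
  \<comment> \<open>The set of \<open>y\<close> is cut too, but it keeps the contact point: the
    discarded tails of \<open>y\<close> are near other contact points, at distance more than
    \<open>r\<close> from this one.\<close>
  have tT: "t x y \<in> T y" if h: "H x y" for x y
  proof -
    have "t x y \<in> X y" using tX[OF h] by simp
    moreover have "t x y \<in> q y z ` {0..d y z}" if z: "H y z" "t x y \<in> path_image (q y z)" for z
    proof -
      obtain u where u: "t x y = q y z u" "0 \<le> u" "u \<le> 1" using z(2) by (auto simp: path_image_def)
      have "(y, z) \<noteq> (x, y)" using h irr EH by auto
      then have "t x y \<notin> ball (t y z) (r/2)" using far[OF z(1) h] by simp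
      then have "\<not> d y z \<le> u" using dq[OF z(1), of u] u by (auto simp: dist_commute)
      then show ?thesis using u by auto
    qed
    ultimately show ?thesis unfolding T_def X by blast
  qed
  have tnT: "t x y \<notin> T x" if h: "H x y" for x y
  proof -
    have "t x y \<notin> q x z ` {0..d x z}" if z: "H x z" for z
    proof (cases "z = y")
      case True
      then show ?thesis using once[OF h] d[OF h] by (force simp: t_def)
    next
      case False
      then show ?thesis using other[OF h z False] qpi[OF z] by (auto simp: t_def)
    qed
    then show ?thesis using fin(2)[OF h] by (auto simp: T_def t_def)
  qed
  show ?thesis
  proof (rule plane_graph_of_continua[where T = T and e = s])
    show "E v u" if "E u v" for u v using sym that .
    show "\<not> E u u" for u by (rule irr)
    show "compact (T v)" for v
    proof -
      have "compact (q v y ` {0..d v y})" if "H v y" for y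
        using q(1)[OF that] d[OF that] 
        by (intro compact_continuous_image) (auto simp: path_def intro: continuous_on_subset)
      then show ?thesis unfolding T_def by (intro compact_Un Y compact_UN) auto
    qed
    show "connected (T v)" for v
    proof -
      have "connected (Y v \<union> q v y ` {0..d v y})" if "H v y" for y
      proof (rule connected_Un)
        show "connected (q v y ` {0..d v y})" using q(1)[OF that] d[OF that] 
          by (intro connected_continuous_image) (auto simp: path_def intro: continuous_on_subset)
        have "q v y 0 \<in> Y v" using q(2)[OF that] by (simp add: pathstart_def)
        then show "Y v \<inter> q v y ` {0..d v y} \<noteq> {}" using d[OF that] by auto
      qed (rule Y)
      then have "connected (\<Union>(insert (Y v) ((\<lambda>y. Y v \<union> q v y ` {0..d v y}) ` {y. H v y})))"
        using Y by (intro connected_Union) auto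
      moreover have "\<Union>(insert (Y v) ((\<lambda>y. Y v \<union> q v y ` {0..d v y}) ` {y. H v y})) = T v"
        unfolding T_def by auto
      ultimately show ?thesis by simp
    qed
    show "T v \<noteq> {}" for v using Y(3)[of v] by (auto simp: T_def)
    show "T u \<inter> T v = {}" if "u \<noteq> v" for u v
    proof (cases "E u v")
      case False
      then show ?thesis using Xd[OF that] TX by blast
    next
      case True
      have "T x \<inter> T y = {}" if "H x y" for x y
        using Xc[OF that] TX[of x] TX[of y] tnT[OF that] by (auto simp: t_def)
      then show ?thesis using True EH by blast
    qed
    show "path (s u v) \<and> pathstart (s u v) \<in> T u \<and> pathfinish (s u v) \<in> T v" if "E u v" for u v
    proof -
      have A: "path (subpath (d x y) 1 (q x y)) \<and> pathstart (subpath (d x y) 1 (q x y)) \<in> T x \<and>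
         pathfinish (subpath (d x y) 1 (q x y)) \<in> T y" if "H x y" for x y
      proof (intro conjI)
        show "path (subpath (d x y) 1 (q x y))" using q(1)[OF that] d[OF that] by (simp add: path_subpath)
        show "pathstart (subpath (d x y) 1 (q x y)) \<in> T x" using that d[OF that] by (auto simp: T_def)
        show "pathfinish (subpath (d x y) 1 (q x y)) \<in> T y" using tT[OF that] by (simp add: t_def pathfinish_def subpath_def)
      qed
      show ?thesis
      proof (cases "H u v")
        case True then show ?thesis using A[OF True] by (simp add: s_def)
      next
        case False then have "H v u" using that EH by blast
        then show ?thesis using A[of v u] False by (simp add: s_def)
      qed
    qed
    show "path_image (s v u) = path_image (s u v)" if "E u v" for u v
      using that EH asym[of u v] by (auto simp: s_def)
    show "path_image (s u v) \<inter> T w = {}" if "E u v" "w \<noteq> u" "w \<noteq> v" for u v w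
    proof -
      have "path_image (subpath (d x y) 1 (q x y)) \<inter> T w = {}" if h: "H x y" "w \<noteq> x" "w \<noteq> y" for x y
      proof (cases "E x w")
        case False
        then show ?thesis using Xd[of x w] h sX[OF h(1)] TX[of w] by blast
      next
        case True
        then obtain a b where ab: "H a b" "(a, b) = (x, w) \<or> (a, b) = (w, x)" using EH by blast
        then have "X x \<inter> X w \<subseteq> {t a b}" using Xc[OF ab(1)] by (auto simp: t_def)
        moreover have "t a b \<notin> path_image (subpath (d x y) 1 (q x y))"
          using far[OF h(1) ab(1)] sball[OF h(1)] ab(2) h by auto
        ultimately show ?thesis using sX[OF h(1)] TX[of w] by blast
      qed
      then show ?thesis using that EH by (auto simp: s_def)
    qed
    show "path_image (s u v) \<inter> path_image (s a b) = {}" if "E u v" "E a b" "{u, v} \<noteq> {a, b}" for u v a b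
    proof -
      have A: "path_image (subpath (d x y) 1 (q x y)) \<inter> path_image (subpath (d a b) 1 (q a b)) = {}"
        if h: "H x y" "H a b" "(x, y) \<noteq> (a, b)" for x y a b
      proof -
        have "ball (t x y) (r/2) \<inter> ball (t a b) (r/2) = {}"
        proof (rule ccontr)
          assume "ball (t x y) (r/2) \<inter> ball (t a b) (r/2) \<noteq> {}"
          then obtain z where "dist (t x y) z < r/2" "dist (t a b) z < r/2" by auto
          moreover have "dist (t x y) (t a b) \<le> dist (t x y) z + dist (t a b) z" by (rule dist_triangle2)
          ultimately show False using rt[OF h] by linarith
        qed
        then show ?thesis using sball[OF h(1)] sball[OF h(2)] by blast
      qed
      have B: "\<exists>x y. H x y \<and> {x, y} = {u, v} \<and> path_image (s u v) = path_image (subpath (d x y) 1 (q x y))" if "E u v" for u v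
        using that EH by (auto simp: s_def)
      obtain x y where xy: "H x y" "{x, y} = {u, v}" "path_image (s u v) = path_image (subpath (d x y) 1 (q x y))" 
        using B[OF \<open>E u v\<close>] by blast
      obtain x' y' where xy': "H x' y'" "{x', y'} = {a, b}" "path_image (s a b) = path_image (subpath (d x' y') 1 (q x' y'))" 
        using B[OF \<open>E a b\<close>] by blast
      have "(x, y) \<noteq> (x', y')" using xy xy' that(3) by auto
      from A[OF xy(1) xy'(1) this] show ?thesis using xy xy' by simp
    qed
  qed
qed

text \<open>Let \<open>S\<close> be the side of the Jordan curve formed by \<open>c1\<close> and
  \<open>c2\<close> that does not contain \<open>m3\<close>; it avoids \<open>c3\<close>, and
  \<open>z\<close> lies on the other side. A point of \<open>S\<close> reaches \<open>z\<close>
  through \<open>m1\<close> off \<open>c2\<close> and \<open>c3\<close>, and through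
  \<open>m2\<close> off \<open>c1\<close> and \<open>c3\<close>. The two obstacles meet exactly in
  the arc \<open>c3\<close>, so Janiszewski's theorem joins the point to \<open>z\<close> off the
  Jordan curve, a contradiction.\<close>

lemma theta_curve_separates:
  fixes c1 c2 c3 :: "real \<Rightarrow> complex"
  assumes arcs: "arc c1" "arc c2" "arc c3"
    and ends: "pathstart c1 = P" "pathstart c2 = P" "pathstart c3 = P"
      "pathfinish c1 = Q" "pathfinish c2 = Q" "pathfinish c3 = Q"
    and int: "path_image c1 \<inter> path_image c2 = {P, Q}" "path_image c1 \<inter> path_image c3 = {P, Q}"
      "path_image c2 \<inter> path_image c3 = {P, Q}"
    and m: "m1 \<in> path_image c1" "m2 \<in> path_image c2" "m3 \<in> path_image c3" "m1 \<notin> {P, Q}" "m2 \<notin> {P, Q}" "m3 \<notin> {P, Q}"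
    and cc: "connected_component (- (path_image c2 \<union> path_image c3)) z m1"
      "connected_component (- (path_image c1 \<union> path_image c3)) z m2"
      "connected_component (- (path_image c1 \<union> path_image c2)) z m3"
  shows False
proof -
  let ?C1 = "path_image c1" and ?C2 = "path_image c2" and ?C3 = "path_image c3"
  let ?c = "c1 +++ reversepath c2"
  have sp: "simple_path ?c" using arcs ends int by (intro simple_path_join_loop) (auto simp: arc_reversepath)
  have cl: "pathfinish ?c = pathstart ?c" using ends by simp
  have J: "path_image ?c = ?C1 \<union> ?C2" using ends by (simp add: path_image_join)
  note jio = Jordan_inside_outside[OF sp cl, unfolded J]
  let ?J = "?C1 \<union> ?C2"
  have "m3 \<notin> ?J" using m(3,6) int by auto
  then have "m3 \<in> inside ?J \<or> m3 \<in> outside ?J" using inside_Un_outside[of ?J] by blast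
  moreover have "inside ?J \<inter> outside ?J = {}" "inside ?J \<union> outside ?J = - ?J" by simp_all
  ultimately obtain S S' where S: "S \<noteq> {}" "connected S" "open S" "open S'" "frontier S = ?J" "m3 \<in> S'" "S \<inter> S' = {}" "S \<union> S' = - ?J"
    using jio by (metis Int_commute Un_commute)
  have side: "x \<in> S'" if x: "connected_component (- ?J) m3 x" for x
  proof -
    obtain T where T: "connected T" "T \<subseteq> - ?J" "m3 \<in> T" "x \<in> T" using x by (auto simp: connected_component_def)
    have "S \<inter> T = {}"
      using connectedD[OF T(1), of S S'] S T by blast
    then show ?thesis using T S by blast
  qed
  have z: "z \<in> S'" by (rule side[OF connected_component_sym[OF cc(3)]])
  have "connected (?C3 - {P, Q})"
    using connected_simple_path_endless[of c3] arcs(3) ends by (simp add: arc_imp_simple_path)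
  moreover have "?C3 - {P, Q} \<subseteq> - ?J" using int by blast
  ultimately have "x \<in> S'" if "x \<in> ?C3 - {P, Q}" for x
    by (intro side) (use that m in \<open>auto simp: connected_component_def\<close>)
  moreover have PQ: "P \<in> ?J" "Q \<in> ?J" using int by auto
  have SC: "S \<inter> ?C1 = {}" "S \<inter> ?C2 = {}" using S(8) by blast+
  moreover have "S \<inter> {P, Q} = {}" using PQ S(8) by blast
  ultimately have SC3: "S \<inter> ?C3 = {}" using S(7) by blast
  have mn: "m1 \<notin> ?C2" "m1 \<notin> ?C3" "m2 \<notin> ?C1" "m2 \<notin> ?C3" using m int by auto
  obtain w where w: "w \<in> S" using S by blast
  have conn: "connected (insert m S)" if "m \<in> ?J" for m
  proof (rule connected_intermediate_closure[OF S(2)])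
    have "m \<in> closure S" using that S(5) unfolding frontier_def by blast
    then show "insert m S \<subseteq> closure S" using closure_subset by blast
  qed blast
  have 1: "connected_component (- (?C2 \<union> ?C3)) w m1"
  proof -
    have "insert m1 S \<subseteq> - (?C2 \<union> ?C3)" using SC SC3 mn by auto
    then show ?thesis using conn[of m1] m(1) w unfolding connected_component_def by blast
  qed
  have 2: "connected_component (- (?C1 \<union> ?C3)) w m2"
  proof -
    have "insert m2 S \<subseteq> - (?C1 \<union> ?C3)" using SC SC3 mn by auto
    then show ?thesis using conn[of m2] m(2) w unfolding connected_component_def by blast
  qed
  have "connected_component (- ((?C2 \<union> ?C3) \<union> (?C1 \<union> ?C3))) w z"
  proof (rule Janiszewski)
    show "compact (?C2 \<union> ?C3)" "closed (?C1 \<union> ?C3)"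
      using arcs by (auto intro: compact_Un closed_Un compact_arc_image closed_arc_image)
    have "(?C2 \<union> ?C3) \<inter> (?C1 \<union> ?C3) = ?C3" using int by blast
    then show "connected ((?C2 \<union> ?C3) \<inter> (?C1 \<union> ?C3))" using arcs by (simp add: connected_arc_image)
    show "connected_component (- (?C2 \<union> ?C3)) w z" using 1 cc(1) connected_component_sym connected_component_trans by metis
    show "connected_component (- (?C1 \<union> ?C3)) w z" using 2 cc(2) connected_component_sym connected_component_trans by metis
  qed
  then have "connected_component (- ?J) w z" by (rule connected_component_of_subset) blast
  then have "connected_component (- ?J) m3 w" using cc(3) connected_component_sym connected_component_trans by metis
  then show False using side w S(7) by blast
qed

section \<open>The complete bipartite graph on three plus three vertices\<close>

definition K33 :: "bool \<times> bool option \<Rightarrow> bool \<times> bool option \<Rightarrow> bool" where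
  "K33 x y \<longleftrightarrow> fst x \<noteq> fst y"

text \<open>Two vertices of one class are the ends of a theta curve whose three arcs run through the
  vertices of the other class. The third vertex reaches each of these while avoiding the other two
  arcs, which \<open>theta_curve_separates\<close> excludes.\<close>

lemma not_plane_graph_K33: "\<not> plane_graph K33"
proof
  assume "plane_graph K33"
  then obtain p :: "bool \<times> bool option \<Rightarrow> complex" and g where p: "inj p"
    and g: "\<And>u v. K33 u v \<Longrightarrow> arc (g u v) \<and> pathstart (g u v) = p u \<and> pathfinish (g u v) = p v"
    and pg: "\<And>u v w. K33 u v \<Longrightarrow> p w \<in> path_image (g u v) \<Longrightarrow> w = u \<or> w = v"
    and gg: "\<And>u v a b. K33 u v \<Longrightarrow> K33 a b \<Longrightarrow> {u, v} \<noteq> {a, b} \<Longrightarrow>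
          path_image (g u v) \<inter> path_image (g a b) \<subseteq> p ` ({u, v} \<inter> {a, b})"
    unfolding plane_graph_def by metis
  define a where "a i = (False, i :: bool option)" for i
  define d where "d i = (True, i :: bool option)" for i
  define d1 where "d1 = d None"
  define d2 where "d2 = d (Some True)"
  define d3 where "d3 = d (Some False)"
  have dd: "d1 \<noteq> d2" "d1 \<noteq> d3" "d2 \<noteq> d3" "a i \<noteq> d1" "a i \<noteq> d2" "a i \<noteq> d3" for i
    by (auto simp: d1_def d2_def d3_def d_def a_def)
  have K: "K33 d1 (a i)" "K33 (a i) d2" "K33 d3 (a i)" for i by (auto simp: K33_def d1_def d2_def d3_def d_def a_def)
  define c where "c i = g d1 (a i) +++ g (a i) d2" for i
  have img: "path_image (c i) = path_image (g d1 (a i)) \<union> path_image (g (a i) d2)" for i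
    using g[OF K(1)] g[OF K(2)] by (simp add: c_def path_image_join)
  have arc: "arc (c i)" for i
  proof -
    have "path_image (g d1 (a i)) \<inter> path_image (g (a i) d2) \<subseteq> p ` ({d1, a i} \<inter> {a i, d2})"
      using dd by (intro gg K) (auto simp: doubleton_eq_iff)
    moreover have "{d1, a i} \<inter> {a i, d2} = {a i}" using dd by auto
    ultimately have "path_image (g d1 (a i)) \<inter> path_image (g (a i) d2) \<subseteq> {pathstart (g (a i) d2)}"
      using g[OF K(2), of i] by simp
    then show ?thesis unfolding c_def using g[OF K(1), of i] g[OF K(2), of i] arc_join by metis
  qed
  have ends: "pathstart (c i) = p d1" "pathfinish (c i) = p d2" for i
    using g[OF K(1)] g[OF K(2)] by (auto simp: c_def)
  have ai: "a i \<noteq> a j" if "i \<noteq> j" for i j using that by (simp add: a_def)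
  have int: "path_image (c i) \<inter> path_image (c j) = {p d1, p d2}" if "i \<noteq> j" for i j
  proof
    have "path_image (g d1 (a i)) \<inter> path_image (g d1 (a j)) \<subseteq> p ` ({d1, a i} \<inter> {d1, a j})"
      "path_image (g d1 (a i)) \<inter> path_image (g (a j) d2) \<subseteq> p ` ({d1, a i} \<inter> {a j, d2})"
      "path_image (g (a i) d2) \<inter> path_image (g d1 (a j)) \<subseteq> p ` ({a i, d2} \<inter> {d1, a j})"
      "path_image (g (a i) d2) \<inter> path_image (g (a j) d2) \<subseteq> p ` ({a i, d2} \<inter> {a j, d2})"
      using dd ai[OF that] by (intro gg K; auto simp: doubleton_eq_iff)+
    moreover have "p ` ({d1, a i} \<inter> {d1, a j}) \<subseteq> {p d1, p d2}" "p ` ({d1, a i} \<inter> {a j, d2}) \<subseteq> {p d1, p d2}"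
      "p ` ({a i, d2} \<inter> {d1, a j}) \<subseteq> {p d1, p d2}" "p ` ({a i, d2} \<inter> {a j, d2}) \<subseteq> {p d1, p d2}"
      using dd ai[OF that] by auto
    ultimately show "path_image (c i) \<inter> path_image (c j) \<subseteq> {p d1, p d2}" unfolding img by blast
    show "{p d1, p d2} \<subseteq> path_image (c i) \<inter> path_image (c j)"
      using ends pathstart_in_path_image[of "c i"] pathstart_in_path_image[of "c j"]
        pathfinish_in_path_image[of "c i"] pathfinish_in_path_image[of "c j"] by auto
  qed
  have m: "p (a i) \<in> path_image (c i)" "p (a i) \<notin> {p d1, p d2}" for i
  proof -
    have "p (a i) \<in> path_image (g d1 (a i))" using g[OF K(1), of i] pathfinish_in_path_image by metis
    then show "p (a i) \<in> path_image (c i)" using img by blast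
    show "p (a i) \<notin> {p d1, p d2}" using p dd by (auto simp: inj_eq)
  qed
  have cc: "connected_component (- (path_image (c j) \<union> path_image (c k))) (p d3) (p (a i))" if "i \<noteq> j" "i \<noteq> k" for i j k
  proof -
    have "path_image (g d3 (a i)) \<inter> path_image (c l) = {}" if "i \<noteq> l" for l
    proof -
      have "path_image (g d3 (a i)) \<inter> path_image (g d1 (a l)) \<subseteq> p ` ({d3, a i} \<inter> {d1, a l})"
        "path_image (g d3 (a i)) \<inter> path_image (g (a l) d2) \<subseteq> p ` ({d3, a i} \<inter> {a l, d2})"
        using dd ai[OF that] by (intro gg K; auto simp: doubleton_eq_iff)+
      moreover have "{d3, a i} \<inter> {d1, a l} = {}" "{d3, a i} \<inter> {a l, d2} = {}" using dd ai[OF that] by auto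
      ultimately show ?thesis unfolding img by auto
    qed
    then have "path_image (g d3 (a i)) \<subseteq> - (path_image (c j) \<union> path_image (c k))" using that by blast
    moreover have "connected (path_image (g d3 (a i)))" "p d3 \<in> path_image (g d3 (a i))" "p (a i) \<in> path_image (g d3 (a i))"
      using g[OF K(3), of i] pathstart_in_path_image[of "g d3 (a i)"] pathfinish_in_path_image[of "g d3 (a i)"] 
      by (auto simp: connected_arc_image)
    ultimately show ?thesis unfolding connected_component_def by blast
  qed
  show False
    by (rule theta_curve_separates[where ?c1.0 = "c None" and ?c2.0 = "c (Some True)" and ?c3.0 = "c (Some False)"
          and P = "p d1" and Q = "p d2" and z = "p d3"
          and ?m1.0 = "p (a None)" and ?m2.0 = "p (a (Some True))" and ?m3.0 = "p (a (Some False))"];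
        (rule arc ends int m cc; simp)?)
qed

lemma planar_graph_of_plane_graph:
  fixes E :: "'v \<Rightarrow> 'v \<Rightarrow> bool"
  assumes "plane_graph E" shows "planar_graph E"
proof -
  obtain p :: "'v \<Rightarrow> complex" and g where p: "inj p"
    and g: "\<And>u v. E u v \<Longrightarrow> arc (g u v) \<and> pathstart (g u v) = p u \<and> pathfinish (g u v) = p v"
    and pg: "\<And>u v w. E u v \<Longrightarrow> p w \<in> path_image (g u v) \<Longrightarrow> w = u \<or> w = v"
    and gg: "\<And>u v a b. E u v \<Longrightarrow> E a b \<Longrightarrow> {u, v} \<noteq> {a, b} \<Longrightarrow>
          path_image (g u v) \<inter> path_image (g a b) \<subseteq> p ` ({u, v} \<inter> {a, b})"
    using assms unfolding plane_graph_def by metis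
  \<comment> \<open>The plane is placed at height 1 and projected centrally to the unit sphere. The
    third coordinate of the image recovers the norm, whence injectivity.\<close>
  define h :: "complex \<Rightarrow> real^3" where "h z = (\<chi> i. if i = 1 then Re z else if i = 2 then Im z else 1)" for z
  define f where "f z = h z /\<^sub>R norm (h z)" for z
  have comp: "h z $ 1 = Re z" "h z $ 2 = Im z" "h z $ 3 = 1" for z by (simp_all add: h_def)
  have nz: "h z \<noteq> 0" for z
  proof
    assume "h z = 0"
    then have "h z $ 3 = 0" by simp
    then show False by (simp add: comp)
  qed
  have "continuous_on UNIV h"
    unfolding h_def
  proof (rule continuous_on_vec_lambda)
    fix i :: 3
    show "continuous_on UNIV (\<lambda>z. if i = 1 then Re z else if i = 2 then Im z else 1)"
      by (cases "i = 1"; cases "i = 2") (auto intro!: continuous_intros)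
  qed
  then have cf: "continuous_on UNIV f" unfolding f_def using nz by (intro continuous_intros) auto
  have "inj f"
  proof (rule injI)
    fix z w assume eq: "f z = f w"
    have "f z $ 3 = f w $ 3" using eq by simp
    then have "norm (h z) = norm (h w)" by (simp add: f_def comp)
    then have "h z = h w" using eq nz by (simp add: f_def)
    then have "h z $ 1 = h w $ 1" "h z $ 2 = h w $ 2" by simp_all
    then show "z = w" by (simp add: comp complex_eq_iff)
  qed
  have sph: "f z \<in> sphere 0 1" for z using nz by (simp add: f_def)
  have arcf: "arc (f \<circ> c)" if "arc c" for c
    using that \<open>inj f\<close> cf unfolding arc_def
    by (auto intro!: path_continuous_image comp_inj_on intro: continuous_on_subset inj_on_subset)
  show ?thesis
    unfolding planar_graph_def
  proof (intro exI conjI allI impI)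
    show "inj (f \<circ> p)" using \<open>inj f\<close> p by (rule inj_compose)
    show "(f \<circ> p) v \<in> sphere 0 1" for v using sph by simp
  next
    fix u v assume uv: "E u v"
    show "arc (f \<circ> g u v)" using arcf g[OF uv] by blast
    show "path_image (f \<circ> g u v) \<subseteq> sphere 0 1" using sph by (auto simp: path_image_def)
    show "pathstart (f \<circ> g u v) = (f \<circ> p) u" "pathfinish (f \<circ> g u v) = (f \<circ> p) v"
      using g[OF uv] by (simp_all add: pathstart_compose pathfinish_compose)
  next
    fix u v w assume "E u v" "(f \<circ> p) w \<in> path_image (f \<circ> g u v)"
    then show "w = u \<or> w = v" using pg[of u v w] \<open>inj f\<close> by (auto simp: path_image_compose inj_image_mem_iff)
  next
    fix u v a b assume h: "E u v" "E a b" "{u, v} \<noteq> {a, b}"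
    have "f ` path_image (g u v) \<inter> f ` path_image (g a b) = f ` (path_image (g u v) \<inter> path_image (g a b))"
      using \<open>inj f\<close> by (simp add: image_Int)
    also have "\<dots> \<subseteq> f ` p ` ({u, v} \<inter> {a, b})" using gg[OF h] by (rule image_mono)
    finally show "path_image (f \<circ> g u v) \<inter> path_image (f \<circ> g a b) \<subseteq> (f \<circ> p) ` ({u, v} \<inter> {a, b})"
      by (simp add: path_image_compose image_comp)
  qed
qed

section \<open>Path connectedness of open subsets of Peano continua\<close>

text \<open>Polygonal paths with vertices in \<open>Z\<close> and mesh \<open>d\<close>. Building
  them from binary joins instead of lists fixes the parametrisation: a refinement copies the joins,
  so path and refinement can be compared at equal times.\<close>

inductive segment_chain :: "'a::real_normed_vector set \<Rightarrow> real \<Rightarrow> (real \<Rightarrow> 'a) \<Rightarrow> bool" for Z d where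
  line: "x \<in> Z \<Longrightarrow> y \<in> Z \<Longrightarrow> dist x y < d \<Longrightarrow> segment_chain Z d (linepath x y)"
| join: "segment_chain Z d p \<Longrightarrow> segment_chain Z d q \<Longrightarrow> pathfinish p = pathstart q \<Longrightarrow> segment_chain Z d (p +++ q)"

lemma segment_chain_ends: "segment_chain Z d p \<Longrightarrow> path p \<and> pathstart p \<in> Z \<and> pathfinish p \<in> Z"
  by (induction rule: segment_chain.induct) auto

lemma segment_chain_near: 
  assumes "segment_chain Z d p" shows "path_image p \<subseteq> (\<Union>z\<in>Z. ball z d)"
  using assms
proof (induction rule: segment_chain.induct)
  case (line x y)
  have "0 < d" using line by (meson le_less_trans zero_le_dist)
  then have "closed_segment x y \<subseteq> ball x d" using line by (intro closed_segment_subset) auto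
  then show ?case using line by auto
next
  case (join p q)
  then show ?case by (auto simp: path_image_join)
qed

lemma segment_chain_mono: "segment_chain C d p \<Longrightarrow> C \<subseteq> Z \<Longrightarrow> segment_chain Z d p"
  by (induction rule: segment_chain.induct) (auto intro: segment_chain.intros)

lemma segment_chain_reverse: 
  assumes "segment_chain Z d p" shows "segment_chain Z d (reversepath p)"
  using assms
proof (induction rule: segment_chain.induct)
  case (line x y)
  then show ?case using segment_chain.line[of y Z x d] by (simp add: reversepath_linepath dist_commute)
next
  case (join p q)
  then show ?case using segment_chain.join[of Z d "reversepath q" "reversepath p"] 
    by (simp add: reversepath_joinpaths)
qed

lemma connected_segment_chain:
  assumes "connected C" "a \<in> C" "b \<in> C" "0 < d"
  shows "\<exists>p. segment_chain C d p \<and> pathstart p = a \<and> pathfinish p = b"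
proof (rule connected_equivalence_relation[OF assms(1-3)])
  fix x y assume "\<exists>p. segment_chain C d p \<and> pathstart p = x \<and> pathfinish p = y"
  then show "\<exists>p. segment_chain C d p \<and> pathstart p = y \<and> pathfinish p = x"
    by (metis segment_chain_reverse pathfinish_reversepath pathstart_reversepath)
next
  fix x y z assume "\<exists>p. segment_chain C d p \<and> pathstart p = x \<and> pathfinish p = y"
    "\<exists>p. segment_chain C d p \<and> pathstart p = y \<and> pathfinish p = z"
  then show "\<exists>p. segment_chain C d p \<and> pathstart p = x \<and> pathfinish p = z"
    by (metis segment_chain.join pathfinish_join pathstart_join)
next
  fix x assume x: "x \<in> C"
  show "\<exists>T. openin (top_of_set C) T \<and> x \<in> T \<and> (\<forall>y\<in>T. \<exists>p. segment_chain C d p \<and> pathstart p = x \<and> pathfinish p = y)"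
  proof (intro exI[of _ "C \<inter> ball x d"] conjI ballI)
    fix y assume "y \<in> C \<inter> ball x d"
    then show "\<exists>p. segment_chain C d p \<and> pathstart p = x \<and> pathfinish p = y"
      using x by (intro exI[of _ "linepath x y"]) (auto intro: segment_chain.line)
  qed (use x assms(4) in auto)
qed

definition locally_connected_set :: "'a::topological_space set \<Rightarrow> bool" where
  "locally_connected_set Z \<longleftrightarrow> (\<forall>W x. openin (top_of_set Z) W \<longrightarrow> x \<in> W \<longrightarrow>
     (\<exists>N. openin (top_of_set Z) N \<and> connected N \<and> x \<in> N \<and> N \<subseteq> W))"

text \<open>The distance \<open>d\<close> is a Lebesgue number of a cover by open sets whose traces
  on \<open>Z\<close> are connected and small.\<close>

lemma uniformly_locally_connected:
  fixes Z :: "'a::euclidean_space set"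
  assumes "compact Z" "locally_connected_set Z" "0 < e"
  shows "\<exists>d>0. \<forall>x\<in>Z. \<forall>y\<in>Z. dist x y < d \<longrightarrow> (\<exists>C. connected C \<and> C \<subseteq> Z \<and> C \<subseteq> ball x e \<and> x \<in> C \<and> y \<in> C)"
proof -
  have "\<exists>G. open G \<and> connected (Z \<inter> G) \<and> z \<in> G \<and> Z \<inter> G \<subseteq> ball z (e/2)" if "z \<in> Z" for z
  proof -
    have "openin (top_of_set Z) (Z \<inter> ball z (e/2))" "z \<in> Z \<inter> ball z (e/2)" using that assms(3) by auto
    then obtain N where "openin (top_of_set Z) N" "connected N" "z \<in> N" "N \<subseteq> Z \<inter> ball z (e/2)"
      using assms(2) unfolding locally_connected_set_def by meson
    then show ?thesis by (metis openin_open IntE le_inf_iff)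
  qed
  then obtain G where G: "\<And>z. z \<in> Z \<Longrightarrow> open (G z) \<and> connected (Z \<inter> G z) \<and> z \<in> G z \<and> Z \<inter> G z \<subseteq> ball z (e/2)" by metis
  then have "Z \<subseteq> \<Union>(G ` Z)" "\<And>g. g \<in> G ` Z \<Longrightarrow> open g" by auto
  then obtain d where d: "0 < d" "\<And>x. x \<in> Z \<Longrightarrow> \<exists>g \<in> G ` Z. ball x d \<subseteq> g"
    using Heine_Borel_lemma[OF assms(1)] by metis
  show ?thesis
  proof (intro exI[of _ d] conjI ballI impI)
    fix x y assume xy: "x \<in> Z" "y \<in> Z" "dist x y < d"
    obtain z where z: "z \<in> Z" "ball x d \<subseteq> G z" using d(2)[OF xy(1)] by auto
    have "x \<in> G z" "y \<in> G z" using z xy d(1) by auto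
    have "Z \<inter> G z \<subseteq> ball x e"
    proof
      fix w assume "w \<in> Z \<inter> G z"
      then have "dist z w < e/2" "dist z x < e/2" using G[OF z(1)] \<open>x \<in> G z\<close> xy(1) by auto
      then have "dist x w < e/2 + e/2" using dist_triangle[of x w z] by (simp add: dist_commute)
      then show "w \<in> ball x e" by simp
    qed
    then show "\<exists>C. connected C \<and> C \<subseteq> Z \<and> C \<subseteq> ball x e \<and> x \<in> C \<and> y \<in> C"
      using G[OF z(1)] xy \<open>x \<in> G z\<close> \<open>y \<in> G z\<close> by (intro exI[of _ "Z \<inter> G z"]) auto
  qed (rule d)
qed

text \<open>Each segment is replaced by a finer chain through a small connected set. At any time the
  new path is within \<open>2 * e\<close> of the starting point of the segment (\<open>e\<close> for
  the set, \<open>e\<close> for the mesh), and the old one within \<open>e\<close>: hence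
  \<open>3 * e\<close>.\<close>

lemma segment_chain_refine:
  assumes "segment_chain Z d p" "0 < d'" "d \<le> e" "d' \<le> e"
    and ulc: "\<And>x y. x \<in> Z \<Longrightarrow> y \<in> Z \<Longrightarrow> dist x y < d \<Longrightarrow> \<exists>C. connected C \<and> C \<subseteq> Z \<and> C \<subseteq> ball x e \<and> x \<in> C \<and> y \<in> C"
  shows "\<exists>q. segment_chain Z d' q \<and> pathstart q = pathstart p \<and> pathfinish q = pathfinish p \<and>
     (\<forall>t\<in>{0..1}. dist (q t) (p t) \<le> 3 * e)"
  using assms(1)
proof (induction rule: segment_chain.induct)
  case (line x y)
  obtain C where C: "connected C" "C \<subseteq> Z" "C \<subseteq> ball x e" "x \<in> C" "y \<in> C" using ulc[OF line] by blast
  obtain q where q: "segment_chain C d' q" "pathstart q = x" "pathfinish q = y"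
    using connected_segment_chain[OF C(1,4,5) assms(2)] by blast
  have "dist (q t) (linepath x y t) \<le> 3 * e" if t: "t \<in> {0..1}" for t
  proof -
    have "q t \<in> path_image q" using t by (auto simp: path_image_def)
    then obtain z where "z \<in> C" "dist z (q t) < d'" using segment_chain_near[OF q(1)] by auto
    moreover have "dist x z < e" using \<open>z \<in> C\<close> C(3) by auto
    ultimately have "dist x (q t) < 2 * e" using dist_triangle[of x "q t" z] assms(4) by simp
    moreover have "dist x (linepath x y t) \<le> e"
    proof -
      have "linepath x y t \<in> closed_segment x y" using t linepath_in_path by blast
      moreover have "closed_segment x y \<subseteq> cball x e" using line assms(3) 
        by (intro closed_segment_subset) (auto intro: order_trans[OF zero_le_dist, of x y])
      ultimately show ?thesis by auto
    qed
    ultimately show ?thesis using dist_triangle[of "q t" "linepath x y t" x] by (simp add: dist_commute)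
  qed
  then show ?case using q segment_chain_mono C(2) by (intro exI[of _ q]) auto
next
  case (join p1 p2)
  then obtain q1 q2 where q: "segment_chain Z d' q1" "pathstart q1 = pathstart p1" "pathfinish q1 = pathfinish p1"
    "\<forall>t\<in>{0..1}. dist (q1 t) (p1 t) \<le> 3 * e" "segment_chain Z d' q2" "pathstart q2 = pathstart p2" "pathfinish q2 = pathfinish p2"
    "\<forall>t\<in>{0..1}. dist (q2 t) (p2 t) \<le> 3 * e" by metis
  then show ?case using join(3)
    by (intro exI[of _ "q1 +++ q2"] conjI ballI segment_chain.join) (auto simp: joinpaths_def pathstart_def pathfinish_def)
qed

text \<open>Successive refinements converge uniformly. With \<open>f k = e / 16 * (1/2) ^ k\<close>
  the displacements \<open>3 * f k\<close> add up to \<open>3 * e / 8\<close>, and the initial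
  segment stays within \<open>e / 16\<close> of \<open>x\<close>, so the limit stays in the ball. It
  lies in the closed set \<open>Z\<close> because the meshes tend to 0.\<close>

lemma peano_local_paths:
  fixes Z :: "'a::euclidean_space set"
  assumes Z: "compact Z" "locally_connected_set Z" and e: "0 < e"
  shows "\<exists>d>0. \<forall>x\<in>Z. \<forall>y\<in>Z. dist x y < d \<longrightarrow> 
    (\<exists>p. path p \<and> path_image p \<subseteq> Z \<inter> ball x e \<and> pathstart p = x \<and> pathfinish p = y)"
proof -
  define f where "f k = e / 16 * (1/2) ^ k" for k :: nat
  have f0: "0 < f k" for k using e by (simp add: f_def)
  have "\<exists>d. 0 < d \<and> d \<le> f k \<and> (\<forall>x\<in>Z. \<forall>y\<in>Z. dist x y < d \<longrightarrow> (\<exists>C. connected C \<and> C \<subseteq> Z \<and> C \<subseteq> ball x (f k) \<and> x \<in> C \<and> y \<in> C))" for k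
  proof -
    obtain d where "0 < d" "\<forall>x\<in>Z. \<forall>y\<in>Z. dist x y < d \<longrightarrow> (\<exists>C. connected C \<and> C \<subseteq> Z \<and> C \<subseteq> ball x (f k) \<and> x \<in> C \<and> y \<in> C)"
      using uniformly_locally_connected[OF Z f0] by blast
    then show ?thesis using f0[of k] by (intro exI[of _ "min d (f k)"]) auto
  qed
  then obtain d where d: "\<And>k. 0 < d k" "\<And>k. d k \<le> f k" 
    and ulc: "\<And>k x y. x \<in> Z \<Longrightarrow> y \<in> Z \<Longrightarrow> dist x y < d k \<Longrightarrow> \<exists>C. connected C \<and> C \<subseteq> Z \<and> C \<subseteq> ball x (f k) \<and> x \<in> C \<and> y \<in> C"
    by metis
  define D where "D k = Min (d ` {..k})" for k
  have D: "0 < D k" "D k \<le> d k" "D (Suc k) \<le> D k" for k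
    using d(1) by (auto simp: D_def intro!: Min_antimono)
  show ?thesis
  proof (intro exI[of _ "D 0"] conjI ballI impI)
    fix x y assume xy: "x \<in> Z" "y \<in> Z" "dist x y < D 0"
    define S where "S k p \<longleftrightarrow> segment_chain Z (D k) p \<and> pathstart p = x \<and> pathfinish p = y" for k p
    have "\<exists>P. \<forall>n. S n (P n) \<and> (\<forall>t\<in>{0..1}. dist (P (Suc n) t) (P n t) \<le> 3 * f n) \<and> P 0 = linepath x y"
    proof -
      have "S 0 (linepath x y)" using xy by (auto simp: S_def intro: segment_chain.line)
      moreover have "\<exists>q. S (Suc n) q \<and> (\<forall>t\<in>{0..1}. dist (q t) (p t) \<le> 3 * f n)" if "S n p" for n p
      proof -
        have "\<exists>q. segment_chain Z (D (Suc n)) q \<and> pathstart q = pathstart p \<and> pathfinish q = pathfinish p \<and>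
           (\<forall>t\<in>{0..1}. dist (q t) (p t) \<le> 3 * f n)"
        proof (rule segment_chain_refine[where d = "D n"])
          show "segment_chain Z (D n) p" using that by (simp add: S_def)
          show "D n \<le> f n" using D(2) d(2) order_trans by blast
          then show "D (Suc n) \<le> f n" using D(3) order_trans by blast
          fix x y assume "x \<in> Z" "y \<in> Z" "dist x y < D n"
          then show "\<exists>C. connected C \<and> C \<subseteq> Z \<and> C \<subseteq> ball x (f n) \<and> x \<in> C \<and> y \<in> C"
            using ulc D(2) less_le_trans by meson
        qed (rule D)
        then show ?thesis using that unfolding S_def by metis
      qed
      ultimately obtain P where P: "P 0 = linepath x y" "\<And>n. S n (P n) \<and> (\<forall>t\<in>{0..1}. dist (P (Suc n) t) (P n t) \<le> 3 * f n)"
        using dependent_nat_choice[of "\<lambda>n p. S n p \<and> (n = 0 \<longrightarrow> p = linepath x y)" "\<lambda>n p q. \<forall>t\<in>{0..1}. dist (q t) (p t) \<le> 3 * f n"]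
        by (metis nat.simps(3))
      then show ?thesis by blast
    qed
    then obtain P where P: "\<And>n. S n (P n)" "\<And>n t. t \<in> {0..1} \<Longrightarrow> dist (P (Suc n) t) (P n t) \<le> 3 * f n" "P 0 = linepath x y"
      by metis
    have sumf: "summable (\<lambda>k. 3 * f k)" "(\<Sum>k. 3 * f k) = 3 * e / 8"
    proof -
      have "(\<lambda>k. (1/2) ^ k) sums (2::real)" using geometric_sums[of "1/2::real"] by simp
      then have "(\<lambda>k. 3 * e / 16 * (1/2) ^ k) sums (3 * e / 16 * 2)" by (rule sums_mult)
      then have "(\<lambda>k. 3 * f k) sums (3 * e / 8)" by (simp add: f_def algebra_simps)
      then show "summable (\<lambda>k. 3 * f k)" "(\<Sum>k. 3 * f k) = 3 * e / 8" by (auto simp: sums_iff)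
    qed
    define h where "h n t = P (Suc n) t - P n t" for n t
    define g where "g t = P 0 t + (\<Sum>n. h n t)" for t
    have hn: "norm (h n t) \<le> 3 * f n" if "t \<in> {0..1}" for n t using P(2)[OF that] by (simp add: h_def dist_norm)
    have ul: "uniform_limit {0..1} (\<lambda>n t. \<Sum>i<n. h i t) (\<lambda>t. \<Sum>i. h i t) sequentially"
      using Weierstrass_m_test[of "{0..1}" h "\<lambda>k. 3 * f k"] hn sumf(1) by auto
    have tele: "(\<Sum>i<n. h i t) = P n t - P 0 t" for n t
      unfolding h_def by (rule sum_lessThan_telescope)
    have lim: "(\<lambda>n. P n t) \<longlonglongrightarrow> g t" if "t \<in> {0..1}" for t
    proof -
      have "(\<lambda>n. P n t - P 0 t) \<longlonglongrightarrow> (\<Sum>i. h i t)" using tendsto_uniform_limitI[OF ul that] by (simp add: tele)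
      then have "(\<lambda>n. P 0 t + (P n t - P 0 t)) \<longlonglongrightarrow> g t" unfolding g_def by (intro tendsto_intros)
      then show ?thesis by simp
    qed
    have cP: "continuous_on {0..1} (P n)" for n
      using P(1)[of n] segment_chain_ends unfolding S_def path_def by blast
    have "continuous_on {0..1} (\<lambda>t. \<Sum>i. h i t)"
      by (rule uniform_limit_theorem[OF _ ul]) (auto simp: tele intro!: always_eventually continuous_on_diff cP)
    then have "path g" unfolding path_def g_def by (intro continuous_intros cP)
    moreover have "pathstart g = x"
    proof -
      have "(\<lambda>n. P n 0) = (\<lambda>n. x)" using P(1) by (auto simp: S_def pathstart_def)
      then show ?thesis using lim[of 0] by (simp add: pathstart_def LIMSEQ_const_iff)
    qed
    moreover have "pathfinish g = y"
    proof -
      have "(\<lambda>n. P n 1) = (\<lambda>n. y)" using P(1) by (auto simp: S_def pathfinish_def)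
      then show ?thesis using lim[of 1] by (simp add: pathfinish_def LIMSEQ_const_iff)
    qed
    moreover have "g t \<in> Z" if t: "t \<in> {0..1}" for t
    proof -
      have "\<exists>z\<in>Z. dist z (P n t) < D n" for n
      proof -
        have "P n t \<in> path_image (P n)" using t by (auto simp: path_image_def)
        moreover have "path_image (P n) \<subseteq> (\<Union>z\<in>Z. ball z (D n))" using segment_chain_near P(1) unfolding S_def by blast
        ultimately have "P n t \<in> (\<Union>z\<in>Z. ball z (D n))" by blast
        then show ?thesis by simp
      qed
      then obtain z where z: "\<And>n. z n \<in> Z" "\<And>n. dist (z n) (P n t) < D n" by metis
      have "(\<lambda>n. f n) \<longlonglongrightarrow> 0"
        using summable_LIMSEQ_zero[OF sumf(1)] tendsto_mult_right_zero[of "\<lambda>n. 3 * f n" _ "1/3"] by simp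
      then have "(\<lambda>n. dist (z n) (P n t)) \<longlonglongrightarrow> 0"
        by (rule real_tendsto_sandwich[OF _ _ tendsto_const, rotated 2])
          (auto intro!: always_eventually less_imp_le[OF less_le_trans[OF z(2)]] order_trans[OF D(2) d(2)])
      then have "(\<lambda>n. z n - P n t) \<longlonglongrightarrow> 0" by (simp add: dist_norm tendsto_norm_zero_iff)
      from tendsto_add[OF this lim[OF t]] have "z \<longlonglongrightarrow> g t" by simp
      then show ?thesis using closed_sequentially[OF compact_imp_closed[OF Z(1)]] z(1) by blast
    qed
    moreover have "dist x (g t) < e" if t: "t \<in> {0..1}" for t
    proof -
      have "norm (\<Sum>i. h i t) \<le> 3 * e / 8"
        using norm_suminf_le[of "\<lambda>i. h i t" "\<lambda>k. 3 * f k"] hn[OF t] sumf by simp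
      then have "dist (P 0 t) (g t) \<le> 3 * e / 8" by (simp add: g_def dist_norm)
      moreover have "dist x (P 0 t) \<le> f 0"
      proof -
        have "linepath x y t \<in> closed_segment x y" using t linepath_in_path by blast
        moreover have "closed_segment x y \<subseteq> cball x (f 0)"
          using xy(3) D(2)[of 0] d(2)[of 0] f0[of 0] by (intro closed_segment_subset) auto
        ultimately show ?thesis using P(3) by auto
      qed
      moreover have "f 0 < e / 2" using e by (simp add: f_def)
      ultimately show ?thesis using dist_triangle[of x "g t" "P 0 t"] e by linarith
    qed
    ultimately show "\<exists>p. path p \<and> path_image p \<subseteq> Z \<inter> ball x e \<and> pathstart p = x \<and> pathfinish p = y"
      by (intro exI[of _ g]) (auto simp: path_image_def)
  qed (rule D)
qed

text \<open>The Mazurkiewicz-Moore-Menger theorem for relatively open sets. Since \<open>W\<close>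
  is open in \<open>Z\<close>, paths in \<open>Z\<close> between sufficiently close points stay
  inside \<open>W\<close>, and connectedness globalises this.\<close>

lemma peano_path_connected:
  fixes Z :: "'a::euclidean_space set"
  assumes Z: "compact Z" "locally_connected_set Z" and W: "openin (top_of_set Z) W" "connected W"
  shows "path_connected W"
  unfolding path_connected_def
proof (intro ballI)
  fix a b assume ab: "a \<in> W" "b \<in> W"
  show "\<exists>g. path g \<and> path_image g \<subseteq> W \<and> pathstart g = a \<and> pathfinish g = b"
  proof (rule connected_equivalence_relation[OF W(2) ab])
    fix x y assume "\<exists>g. path g \<and> path_image g \<subseteq> W \<and> pathstart g = x \<and> pathfinish g = y"
    then show "\<exists>g. path g \<and> path_image g \<subseteq> W \<and> pathstart g = y \<and> pathfinish g = x"
      by (metis path_image_reversepath path_reversepath pathfinish_reversepath pathstart_reversepath)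
  next
    fix x y z assume "\<exists>g. path g \<and> path_image g \<subseteq> W \<and> pathstart g = x \<and> pathfinish g = y"
      "\<exists>g. path g \<and> path_image g \<subseteq> W \<and> pathstart g = y \<and> pathfinish g = z"
    then show "\<exists>g. path g \<and> path_image g \<subseteq> W \<and> pathstart g = x \<and> pathfinish g = z"
      by (metis path_join_imp pathfinish_join pathstart_join path_image_join Un_least)
  next
    fix x assume x: "x \<in> W"
    obtain e where e: "0 < e" "Z \<inter> ball x e \<subseteq> W"
      using W(1) x unfolding openin_contains_ball by (metis inf_commute)
    obtain d where d: "0 < d" "\<And>y. y \<in> Z \<Longrightarrow> dist x y < d \<Longrightarrow> \<exists>p. path p \<and> path_image p \<subseteq> Z \<inter> ball x e \<and> pathstart p = x \<and> pathfinish p = y"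
      using peano_local_paths[OF Z e(1)] x openin_imp_subset[OF W(1)] by (metis subsetD)
    show "\<exists>T. openin (top_of_set W) T \<and> x \<in> T \<and> (\<forall>y\<in>T. \<exists>g. path g \<and> path_image g \<subseteq> W \<and> pathstart g = x \<and> pathfinish g = y)"
    proof (intro exI[of _ "W \<inter> ball x d"] conjI ballI)
      fix y assume "y \<in> W \<inter> ball x d"
      then have "y \<in> Z" "dist x y < d" using openin_imp_subset[OF W(1)] by auto
      then show "\<exists>g. path g \<and> path_image g \<subseteq> W \<and> pathstart g = x \<and> pathfinish g = y" using d(2) e(2) by (meson subset_trans)
    qed (use x d(1) in auto)
  qed
qed

section \<open>Halves of planar Peano continua\<close>

lemma path_to_first_hit:
  fixes g :: "real \<Rightarrow> 'a::real_normed_vector"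
  assumes g: "path g" and S: "closed S" "pathstart g \<notin> S" "pathfinish g \<in> S"
  obtains h where "path h" "pathstart h = pathstart g" "path_image h \<subseteq> path_image g" "pathfinish h \<in> S"
    "\<And>t. 0 \<le> t \<Longrightarrow> t < 1 \<Longrightarrow> h t \<notin> S"
proof -
  have "pathfinish g \<notin> - S" using S by simp
  from subpath_to_frontier_explicit[OF g this] obtain u where u: "0 \<le> u" "u \<le> 1"
    "\<And>x. 0 \<le> x \<and> x < u \<Longrightarrow> g x \<in> interior (- S)" "g u \<notin> interior (- S)" by metis
  have o: "interior (- S) = - S" using S(1) by (simp add: interior_open open_Compl)
  have "u \<noteq> 0" using u(4) S(2) o by (auto simp: pathstart_def)
  show ?thesis
  proof (rule that[of "subpath 0 u g"])
    show "path (subpath 0 u g)" using g u by (simp add: path_subpath)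
    show "pathstart (subpath 0 u g) = pathstart g" by (simp add: pathstart_def subpath_def)
    show "path_image (subpath 0 u g) \<subseteq> path_image g" using u by (simp add: path_image_subpath_subset)
    show "pathfinish (subpath 0 u g) \<in> S" using u(4) o by (simp add: pathfinish_def subpath_def)
    fix t :: real assume "0 \<le> t" "t < 1"
    then have "0 \<le> u * t" "u * t < u" using u(1) \<open>u \<noteq> 0\<close> by auto
    then show "subpath 0 u g t \<notin> S" using u(3) o by (auto simp: subpath_def)
  qed
qed

lemma component_openin:
  fixes Z :: "'a::euclidean_space set"
  assumes lc: "locally_connected_set Z" and U: "openin (top_of_set Z) U"
  shows "openin (top_of_set Z) (connected_component_set U c)"
proof (subst openin_subopen, intro ballI)
  fix x assume x: "x \<in> connected_component_set U c"
  then have "x \<in> U" using connected_component_subset by blast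
  then obtain N where N: "openin (top_of_set Z) N" "connected N" "x \<in> N" "N \<subseteq> U"
    using lc U unfolding locally_connected_set_def by meson
  have "N \<subseteq> connected_component_set U x" using N by (simp add: connected_component_maximal)
  also have "\<dots> = connected_component_set U c" using x connected_component_eq by blast
  finally show "\<exists>T. openin (top_of_set Z) T \<and> x \<in> T \<and> T \<subseteq> connected_component_set U c" using N by blast
qed

lemma finite_set_in_connected_compact:
  fixes R :: "'a::real_normed_vector set" and y :: "bool option \<Rightarrow> 'a"
  assumes "path_connected R" "\<And>i. y i \<in> R"
  obtains B where "compact B" "connected B" "B \<subseteq> R" "\<And>i. y i \<in> B"
proof -
  have "\<exists>g. path g \<and> path_image g \<subseteq> R \<and> pathstart g = y None \<and> pathfinish g = y i" for i
    using assms unfolding path_connected_def by blast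
  then obtain g where g: "\<And>i. path (g i)" "\<And>i. path_image (g i) \<subseteq> R" "\<And>i. pathstart (g i) = y None" "\<And>i. pathfinish (g i) = y i"
    by metis
  show ?thesis
  proof
    show "compact (\<Union>i. path_image (g i))" using g by (intro compact_UN) auto
    have "y None \<in> \<Inter> (range (\<lambda>i. path_image (g i)))" using g(3) pathstart_in_path_image by (metis INT_I)
    then show "connected (\<Union>i. path_image (g i))" using g(1) by (intro connected_Union) (auto intro: connected_path_image)
    show "(\<Union>i. path_image (g i)) \<subseteq> R" using g by blast
    show "y i \<in> (\<Union>i. path_image (g i))" for i using g(4)[of i] pathfinish_in_path_image by (metis UN_I UNIV_I)
  qed
qed

text \<open>If the half \<open>U\<close> had a component \<open>C\<close> besides another one, lying in the region \<open>R\<close> of the complement of the closures of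
  \<open>C\<close> and its mirror image \<open>C'\<close>, then \<open>R\<close> would touch the frontier of \<open>C\<close> in a set without isolated points, since an
  isolated point would be a local cut point. Three such points, together with \<open>C\<close>, \<open>C'\<close> and \<open>R\<close>,
  yield the complete bipartite graph on three plus three vertices in the plane.\<close>
lemma half_connected:
  fixes Z U :: "complex set" and \<sigma> :: "complex \<Rightarrow> complex"
  assumes Z: "compact Z" "locally_connected_set Z" "connected Z"
    and nlcp: "\<And>p N. openin (top_of_set Z) N \<Longrightarrow> connected N \<Longrightarrow> p \<in> N \<Longrightarrow> connected (N - {p})"
    and \<sigma>: "continuous_on Z \<sigma>" "\<And>z. z \<in> Z \<Longrightarrow> \<sigma> z \<in> Z" "\<And>z. z \<in> Z \<Longrightarrow> \<sigma> (\<sigma> z) = z"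
    and U: "openin (top_of_set Z) U" "U \<inter> \<sigma> ` U = {}" "\<And>z. z \<in> Z \<Longrightarrow> z \<notin> U \<Longrightarrow> z \<notin> \<sigma> ` U \<Longrightarrow> \<sigma> z = z"
  shows "connected U"
proof (rule ccontr)
  assume "\<not> connected U"
  then obtain c d where cd: "c \<in> U" "d \<in> U" "\<not> connected_component U c d"
    by (auto simp: connected_iff_connected_component)
  have cZ: "closed Z" using Z(1) by (rule compact_imp_closed)
  have UZ: "U \<subseteq> Z" using U(1) by (rule openin_imp_subset)
  have opn_img: "openin (top_of_set Z) (\<sigma> ` V)" if V: "openin (top_of_set Z) V" for V
  proof -
    have "\<sigma> ` V = Z \<inter> \<sigma> -` V"
    proof
      show "\<sigma> ` V \<subseteq> Z \<inter> \<sigma> -` V" using openin_imp_subset[OF V] \<sigma>(2,3) by auto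
      show "Z \<inter> \<sigma> -` V \<subseteq> \<sigma> ` V"
      proof
        fix z assume "z \<in> Z \<inter> \<sigma> -` V"
        then have "\<sigma> z \<in> V" "z = \<sigma> (\<sigma> z)" using \<sigma>(3) by auto
        then show "z \<in> \<sigma> ` V" by blast
      qed
    qed
    moreover have "openin (top_of_set Z) (Z \<inter> \<sigma> -` V)"
      using continuous_openin_preimage[OF \<sigma>(1) _ V] \<sigma>(2) by auto
    ultimately show ?thesis by simp
  qed
  have invol: "\<sigma> ` \<sigma> ` V = V" if "V \<subseteq> Z" for V
    using that \<sigma>(3) by (force simp: image_image)
  define U' where "U' = \<sigma> ` U"
  have U': "openin (top_of_set Z) U'" "U' \<subseteq> Z" "U \<inter> U' = {}"
    using opn_img[OF U(1)] openin_imp_subset U(2) unfolding U'_def by blast+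
  have fixp: "\<sigma> z = z" if "z \<in> Z" "z \<notin> U" "z \<notin> U'" for z using U(3) that unfolding U'_def by blast
  define C where "C = connected_component_set U c"
  have C: "openin (top_of_set Z) C" "connected C" "C \<subseteq> U" "c \<in> C" "d \<notin> C"
    using component_openin[OF Z(2) U(1), of c] cd connected_component_subset[of U c] unfolding C_def by auto
  define C' where "C' = \<sigma> ` C"
  have CZ: "C \<subseteq> Z" using C(3) UZ by blast
  have C': "openin (top_of_set Z) C'" "C' \<subseteq> U'" "C' \<subseteq> Z" "\<sigma> ` C' = C"
    using opn_img[OF C(1)] C(3) CZ \<sigma>(2) invol[OF CZ] unfolding C'_def U'_def by auto
  \<comment> \<open>The frontier of \<open>C\<close> in \<open>Z\<close>. It misses both halves,
    hence is fixed pointwise by \<open>\<sigma>\<close>, so it is the frontier of the mirror image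
    \<open>C'\<close> as well.\<close>
  define FC where "FC = closure C - C"
  have clZ: "closure V \<subseteq> Z" if "V \<subseteq> Z" for V using that cZ by (simp add: closure_minimal)
  have open_closure: "V \<inter> closure W = {}" if V: "openin (top_of_set Z) V" and "V \<inter> W = {}" "W \<subseteq> Z" for V W
  proof -
    obtain G where G: "open G" "V = Z \<inter> G" using V unfolding openin_open by blast
    then have "G \<inter> W = {}" using that(2,3) by auto
    then have "G \<inter> closure W = {}" using G(1) open_Int_closure_eq_empty by blast
    then show ?thesis using G by blast
  qed
  have FC: "FC \<subseteq> Z" "FC \<inter> U = {}" "FC \<inter> U' = {}"
  proof -
    show "FC \<subseteq> Z" using clZ[OF CZ] by (auto simp: FC_def)
    show "FC \<inter> U' = {}" using open_closure[OF U'(1) _ CZ] C(3) U'(3) by (auto simp: FC_def)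
    show "FC \<inter> U = {}"
    proof (rule ccontr)
      assume "FC \<inter> U \<noteq> {}"
      then obtain z where z: "z \<in> FC" "z \<in> U" by blast
      let ?D = "connected_component_set U z"
      have "openin (top_of_set Z) ?D" by (rule component_openin[OF Z(2) U(1)])
      moreover have "z \<in> ?D" using z by simp
      ultimately have "?D \<inter> C \<noteq> {}" using open_closure[of ?D C] CZ z unfolding FC_def by blast
      then have "?D = C" unfolding C_def by (metis connected_component_disjoint connected_component_eq mem_Collect_eq)
      then show False using \<open>z \<in> ?D\<close> z by (auto simp: FC_def)
    qed
  qed
  have FCfix: "\<sigma> z = z" if "z \<in> FC" for z using FC fixp that by blast
  have \<sigma>cl: "\<sigma> ` closure V \<subseteq> closure (\<sigma> ` V)" if "V \<subseteq> Z" for V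
    by (rule image_closure_subset[OF continuous_on_subset[OF \<sigma>(1) clZ[OF that]]]) (auto simp: closure_subset)
  have clC': "closure C' = C' \<union> FC"
  proof
    show "C' \<union> FC \<subseteq> closure C'"
      using \<sigma>cl[OF CZ] FCfix closure_subset[of C'] unfolding FC_def C'_def by force
    show "closure C' \<subseteq> C' \<union> FC"
    proof
      fix z assume z: "z \<in> closure C'"
      then have zZ: "z \<in> Z" using clZ C'(3) by blast
      have "\<sigma> z \<in> closure C" using \<sigma>cl[OF C'(3)] z C'(4) by auto
      then consider "\<sigma> z \<in> C" | "\<sigma> z \<in> FC" by (auto simp: FC_def)
      then show "z \<in> C' \<union> FC"
      proof cases
        case 1 then show ?thesis using \<sigma>(3)[OF zZ] unfolding C'_def by (metis UnI1 image_eqI)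
      next
        case 2 then show ?thesis using FCfix[OF 2] \<sigma>(3)[OF zZ] by auto
      qed
    qed
  qed
  define K where "K = C \<union> C' \<union> FC"
  have KK: "K = closure C \<union> closure C'" using closure_subset[of C] unfolding K_def clC' FC_def by blast
  have K: "closed K" "K \<subseteq> Z" using KK clZ CZ C'(3) by auto
  have "d \<notin> K" using cd C(5) C'(2) U'(3) FC(2) unfolding K_def by blast
  \<comment> \<open>The component is taken in the plane, not in \<open>Z\<close>: \<open>R\<close>
    is open and path connected, although its trace on \<open>Z\<close> may fall apart.\<close>
  define R where "R = connected_component_set (- K) d"
  have R: "open R" "connected R" "d \<in> R" "R \<inter> K = {}"
    using K(1) \<open>d \<notin> K\<close> connected_component_subset[of "- K" d] unfolding R_def by (auto intro: open_connected_component)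
  define Y where "Y = Z \<inter> R"
  have Y: "openin (top_of_set Z) Y" "Y \<subseteq> Z" "d \<in> Y" using R UZ cd by (auto simp: Y_def openin_open_Int)
  have YC: "C \<inter> closure Y = {}" "C' \<inter> closure Y = {}"
    using open_closure[OF C(1) _ Y(2)] open_closure[OF C'(1) _ Y(2)] R(4) unfolding Y_def K_def by blast+
  define P where "P = closure Y - Y"
  have PFC: "P \<subseteq> FC"
  proof
    fix z assume z: "z \<in> P"
    have "z \<in> K"
    proof (rule ccontr)
      assume "z \<notin> K"
      let ?S = "connected_component_set (- K) z"
      have "open ?S" "z \<in> ?S" using K(1) \<open>z \<notin> K\<close> by (auto intro: open_connected_component)
      then have "?S \<inter> Y \<noteq> {}" using z open_Int_closure_eq_empty[of ?S Y] unfolding P_def by blast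
      then have "?S \<inter> R \<noteq> {}" by (auto simp: Y_def)
      then have "?S = R" unfolding R_def by (metis connected_component_disjoint connected_component_eq mem_Collect_eq)
      then have "z \<in> Y" using z clZ[OF Y(2)] \<open>z \<in> ?S\<close> unfolding P_def Y_def by blast
      then show False using z by (simp add: P_def)
    qed
    then show "z \<in> FC" using z YC unfolding K_def P_def by blast
  qed
  have "infinite P"
  proof
    assume fin: "finite P"
    \<comment> \<open>The trace \<open>Y\<close> is open in \<open>Z\<close>; without frontier
      points it would be clopen and, by connectedness of \<open>Z\<close>, would swallow
      \<open>C\<close>.\<close>
    have "P \<noteq> {}"
    proof
      assume "P = {}"
      then have "closure Y = Y" using closure_subset by (auto simp: P_def)
      then have "closedin (top_of_set Z) Y" using Y(2) by (metis closed_closure closed_subset)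
      then have "Y = Z" using Z(3) Y by (auto simp: connected_clopen)
      then show False using C(4) CZ R(4) by (auto simp: Y_def K_def)
    qed
    then obtain p where p: "p \<in> P" by blast
    have "open (- (P - {p}))" using fin by (intro open_Compl finite_imp_closed finite_Diff)
    then have "openin (top_of_set Z) (Z - (P - {p}))" unfolding Diff_eq[of Z] by (rule openin_open_Int)
    moreover have "p \<in> Z - (P - {p})" using p PFC FC by auto
    \<comment> \<open>A connected neighbourhood of \<open>p\<close> that contains no other point of
      \<open>P\<close>. Without \<open>p\<close> it splits into its part in \<open>R\<close> and its
      part off the closure of \<open>Y\<close>; the first meets \<open>Y\<close> and the second
      meets \<open>C\<close>, so \<open>p\<close> would be a local cut point.\<close>
    ultimately obtain N where N: "openin (top_of_set Z) N" "connected N" "p \<in> N" "N \<subseteq> Z - (P - {p})"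
      using Z(2) unfolding locally_connected_set_def by meson
    have "connected (N - {p})" by (rule nlcp[OF N(1-3)])
    moreover have "open R" "open (- closure Y)" using R by auto
    moreover have "N - {p} \<subseteq> R \<union> - closure Y" using N(4) unfolding P_def Y_def by blast
    moreover have "R \<inter> - closure Y \<inter> (N - {p}) = {}" using N(4) closure_subset[of Y] unfolding Y_def by blast
    moreover have "R \<inter> (N - {p}) \<noteq> {}"
    proof -
      have "N \<inter> Y \<noteq> {}" using open_closure[OF N(1) _ Y(2)] N(3) p unfolding P_def by blast
      then show ?thesis using p unfolding P_def Y_def by blast
    qed
    moreover have "- closure Y \<inter> (N - {p}) \<noteq> {}"
    proof -
      have "N \<inter> C \<noteq> {}" using open_closure[OF N(1) _ CZ] N(3) p PFC unfolding FC_def by blast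
      then show ?thesis using YC(1) p PFC FC_def by blast
    qed
    ultimately show False using connectedD by blast
  qed
  then obtain f :: "nat \<Rightarrow> complex" where f: "inj f" "range f \<subseteq> P" using infinite_countable_subset by blast
  define p where "p i = f (case i of None \<Rightarrow> 0 | Some True \<Rightarrow> 1 | Some False \<Rightarrow> 2)" for i
  have p: "p i \<in> P" for i using f(2) unfolding p_def by blast
  have pne: "p i \<noteq> p j" if "i \<noteq> j" for i j
    using that by (cases i; cases j) (auto simp: p_def inj_eq[OF f(1)] split: bool.splits)
  define PP where "PP = (\<lambda>(i, j). ({p i}, {p j})) ` {(i, j). i \<noteq> j}"
  have "finite PP" unfolding PP_def by simp
  moreover have "compact A \<and> compact B \<and> A \<inter> B = {}" if "(A, B) \<in> PP" for A B
    using that pne unfolding PP_def by auto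
  ultimately obtain r where r: "0 < r" "\<forall>(A, B)\<in>PP. \<forall>a\<in>A. \<forall>b\<in>B. r < dist a b"
    using disjoint_compacts_separated[of PP] by auto
  define G where "G i = ball (p i) (r / 2)" for i
  have Gd: "G i \<inter> G j = {}" if ne: "i \<noteq> j" for i j
  proof -
    have "({p i}, {p j}) \<in> PP" using ne unfolding PP_def by auto
    then have "r < dist (p i) (p j)" using r(2) by fastforce
    then show ?thesis unfolding G_def by (intro disjoint_ballI) simp
  qed
  have nbhd: "\<exists>N. openin (top_of_set Z) N \<and> path_connected N \<and> x \<in> N \<and> N \<subseteq> O' \<and> \<sigma> ` N \<subseteq> O'"
    if x: "x \<in> FC" "x \<in> O'" "open O'" for x O'
  proof -
    have "openin (top_of_set Z) (Z \<inter> O')" using that by (simp add: openin_open_Int)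
    then have "openin (top_of_set Z) (Z \<inter> \<sigma> -` (Z \<inter> O'))"
      using continuous_openin_preimage[OF \<sigma>(1), of Z "Z \<inter> O'"] \<sigma>(2) by auto
    then have "openin (top_of_set Z) ((Z \<inter> O') \<inter> (Z \<inter> \<sigma> -` (Z \<inter> O')))" using \<open>openin (top_of_set Z) (Z \<inter> O')\<close> by blast
    moreover have "x \<in> (Z \<inter> O') \<inter> (Z \<inter> \<sigma> -` (Z \<inter> O'))" using x FC(1) FCfix by auto
    ultimately obtain N where N: "openin (top_of_set Z) N" "connected N" "x \<in> N" "N \<subseteq> (Z \<inter> O') \<inter> (Z \<inter> \<sigma> -` (Z \<inter> O'))"
      using Z(2) unfolding locally_connected_set_def by meson
    then show ?thesis using peano_path_connected[OF Z(1,2) N(1,2)] by (intro exI[of _ N]) auto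
  qed
  \<comment> \<open>A path near \<open>p i\<close> from \<open>Y\<close> to \<open>C\<close> is
    stopped when it first meets \<open>K\<close>. Its end is again a frontier point in
    \<open>P\<close>, possibly different from \<open>p i\<close>, but reached by a path through
    \<open>R\<close> and still in the ball \<open>G i\<close>. These ends \<open>q i\<close> are the
    contact points used from here on.\<close>
  have "\<exists>h. path h \<and> path_image h \<subseteq> G i \<and> pathfinish h \<in> P \<and> pathstart h \<in> R \<and> (\<forall>t. 0 \<le> t \<longrightarrow> t < 1 \<longrightarrow> h t \<in> R)" for i
  proof -
    have pi: "p i \<in> FC" using p PFC by blast
    have "p i \<in> G i" using r by (simp add: G_def)
    then obtain N where N: "openin (top_of_set Z) N" "path_connected N" "p i \<in> N" "N \<subseteq> G i"
      using nbhd[OF pi, of "G i"] unfolding G_def by auto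
    have "N \<inter> Y \<noteq> {}" using open_closure[OF N(1) _ Y(2)] N(3) p[of i] unfolding P_def by blast
    then obtain y where y: "y \<in> N" "y \<in> Y" by blast
    have "N \<inter> C \<noteq> {}" using open_closure[OF N(1) _ CZ] N(3) pi unfolding FC_def by blast
    then obtain a where a: "a \<in> N" "a \<in> C" by blast
    obtain g where g: "path g" "path_image g \<subseteq> N" "pathstart g = y" "pathfinish g = a"
      using N(2) y a unfolding path_connected_def by blast
    have "y \<in> R" "y \<notin> K" using y R(4) by (auto simp: Y_def)
    then obtain h where h: "path h" "pathstart h = y" "path_image h \<subseteq> path_image g" "pathfinish h \<in> K"
      "\<And>t. 0 \<le> t \<Longrightarrow> t < 1 \<Longrightarrow> h t \<notin> K"
      using path_to_first_hit[OF g(1) K(1)] g a unfolding K_def by (metis UnI1)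
    have conn: "connected (h ` {0..<1})" using h(1) unfolding path_def
      by (intro connected_continuous_image) (auto intro: continuous_on_subset)
    have "h 0 = y" using h(2) by (simp add: pathstart_def)
    then have "y \<in> h ` {0..<1}" by force
    then have hR: "h ` {0..<1} \<subseteq> R" unfolding R_def using conn h(5)
      by (metis (no_types, lifting) ComplI R_def \<open>y \<in> R\<close> atLeastLessThan_iff connected_component_eq connected_component_maximal image_subsetI)
    have hZ: "path_image h \<subseteq> Z" using h(3) g(2) N(1) openin_imp_subset by blast
    have "h ` {0..<1} \<subseteq> Y" using hR hZ unfolding Y_def path_image_def by force
    moreover have "pathfinish h \<in> closure (h ` {0..<1})"
    proof -
      have "h ` closure {0..<1} \<subseteq> closure (h ` {0..<1})"
        using h(1) unfolding path_def by (intro image_closure_subset) (auto simp: closure_subset)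
      then show ?thesis by (auto simp: pathfinish_def)
    qed
    ultimately have "pathfinish h \<in> closure Y" using closure_mono by blast
    moreover have "pathfinish h \<notin> Y" using h(4) R(4) by (auto simp: Y_def)
    ultimately have "pathfinish h \<in> P" by (simp add: P_def)
    then show ?thesis using h hR g(2) N(4) \<open>y \<in> R\<close> by (intro exI[of _ h]) force
  qed
  then obtain h where h: "\<And>i. path (h i)" "\<And>i. path_image (h i) \<subseteq> G i" "\<And>i. pathfinish (h i) \<in> P" "\<And>i. pathstart (h i) \<in> R"
    "\<And>i t. 0 \<le> t \<Longrightarrow> t < 1 \<Longrightarrow> h i t \<in> R" by metis
  define q where "q i = pathfinish (h i)" for i
  have q: "q i \<in> FC" "q i \<in> G i" "q i \<in> Z" for i
    using h(2,3) PFC FC(1) pathfinish_in_path_image[of "h i"] unfolding q_def by blast+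
  have qnR: "q i \<notin> R" "q i \<notin> C" "q i \<notin> C'" for i 
    using q(1)[of i] R(4) FC C'(2) unfolding K_def FC_def by blast+
  have hRq: "path_image (h i) \<subseteq> insert (q i) R" for i
  proof
    fix z assume "z \<in> path_image (h i)"
    then obtain t where t: "0 \<le> t" "t \<le> 1" "z = h i t" by (auto simp: path_image_def)
    show "z \<in> insert (q i) R"
    proof (cases "t = 1")
      case True then show ?thesis using t by (simp add: q_def pathfinish_def)
    next
      case False then show ?thesis using t h(5)[of t i] by auto
    qed
  qed
  \<comment> \<open>The region \<open>R\<close> is shrunk to a continuum \<open>B\<close>, and each
    path into \<open>R\<close>, read from \<open>q i\<close>, is stopped on first reaching
    \<open>B\<close>.\<close>
  have "path_connected R" using R connected_open_path_connected by blast
  then obtain B where B: "compact B" "connected B" "B \<subseteq> R" "\<And>i. pathstart (h i) \<in> B"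
    using finite_set_in_connected_compact[of R "\<lambda>i. pathstart (h i)"] h(4) by metis
  have "\<exists>l. path l \<and> pathstart l = q i \<and> path_image l \<subseteq> path_image (h i) \<and> pathfinish l \<in> B \<and> (\<forall>t. 0 \<le> t \<longrightarrow> t < 1 \<longrightarrow> l t \<notin> B)" for i
  proof -
    have "pathstart (reversepath (h i)) \<notin> B" "pathfinish (reversepath (h i)) \<in> B" using B(3,4) qnR[of i] by (auto simp: q_def)
    then obtain l where "path l" "pathstart l = pathstart (reversepath (h i))" "path_image l \<subseteq> path_image (reversepath (h i))"
      "pathfinish l \<in> B" "\<And>t. 0 \<le> t \<Longrightarrow> t < 1 \<Longrightarrow> l t \<notin> B"
      using path_to_first_hit[of "reversepath (h i)" B] h(1) B(1) by (metis compact_imp_closed path_reversepath)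
    then show ?thesis by (intro exI[of _ l]) (auto simp: q_def)
  qed
  then obtain l where l: "\<And>i. path (l i)" "\<And>i. pathstart (l i) = q i" "\<And>i. path_image (l i) \<subseteq> path_image (h i)"
    "\<And>i. pathfinish (l i) \<in> B" "\<And>i t. 0 \<le> t \<Longrightarrow> t < 1 \<Longrightarrow> l i t \<notin> B" by metis
  \<comment> \<open>Folding along the fixed set pushes a path into \<open>Z - U'\<close> without
    changing its ends. A folded path from \<open>q i\<close> to \<open>C\<close> avoids
    \<open>C'\<close>, and its mirror image avoids \<open>A\<close> while leading from the same
    point \<open>q i\<close> to \<open>C'\<close>.\<close>
  define fold where "fold z = (if z \<in> U' then \<sigma> z else z)" for z
  have ccl: "closed (Z - V)" if V: "openin (top_of_set Z) V" for V
  proof -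
    obtain G where G: "open G" "V = Z \<inter> G" using V unfolding openin_open by blast
    then have "Z - V = Z \<inter> - G" by blast
    then show ?thesis using cZ G(1) by (simp add: closed_Int closed_Compl)
  qed
  have cfold: "continuous_on Z fold"
  proof -
    have "continuous_on ((Z - U) \<union> (Z - U')) (\<lambda>z. if z \<in> U' then \<sigma> z else z)"
    proof (rule continuous_on_cases)
      show "closed (Z - U)" "closed (Z - U')" using ccl U(1) U'(1) by auto
      show "continuous_on (Z - U) \<sigma>" using \<sigma>(1) by (rule continuous_on_subset) auto
      show "\<forall>x. x \<in> Z - U \<and> x \<notin> U' \<or> x \<in> Z - U' \<and> x \<in> U' \<longrightarrow> \<sigma> x = x" using fixp by blast
    qed auto
    moreover have "(Z - U) \<union> (Z - U') = Z" using U'(3) by blast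
    ultimately show ?thesis unfolding fold_def by simp
  qed
  have \<sigma>U: "\<sigma> z \<notin> U'" if "z \<in> U'" for z
  proof -
    obtain u where "u \<in> U" "z = \<sigma> u" using \<open>z \<in> U'\<close> by (auto simp: U'_def)
    then have "\<sigma> z = u" using \<sigma>(3) UZ by blast
    then show ?thesis using U'(3) \<open>u \<in> U\<close> by blast
  qed
  have "\<exists>b. path b \<and> pathstart b = q i \<and> path_image b \<subseteq> Z - U' \<and> path_image b \<subseteq> G i - B \<and> \<sigma> ` path_image b \<subseteq> G i - B \<and>
     pathfinish b \<in> C" for i
  proof -
    have "open (G i - B)" using B(1) unfolding G_def by (simp add: compact_imp_closed open_Diff)
    moreover have "q i \<in> G i - B" using q(2) qnR B(3) by blast
    ultimately obtain N where N: "openin (top_of_set Z) N" "path_connected N" "q i \<in> N" "N \<subseteq> G i - B" "\<sigma> ` N \<subseteq> G i - B"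
      using nbhd[OF q(1)] by metis
    have NZ: "N \<subseteq> Z" using N(1) openin_imp_subset by blast
    have "N \<inter> C \<noteq> {}" using open_closure[OF N(1) _ CZ] N(3) q(1) unfolding FC_def by blast
    then obtain a where a: "a \<in> N" "a \<in> C" by blast
    obtain g where g: "path g" "path_image g \<subseteq> N" "pathstart g = q i" "pathfinish g = a"
      using N(2,3) a unfolding path_connected_def by blast
    let ?b = "fold \<circ> g"
    have "path ?b" using g cfold NZ by (intro path_continuous_image) (auto intro: continuous_on_subset)
    moreover have "pathstart ?b = q i" using g q(1)[of i] FC by (auto simp: fold_def pathstart_compose)
    moreover have "pathfinish ?b \<in> C" using g a C(3) U'(3) by (auto simp: fold_def pathfinish_compose)
    moreover have fold1: "fold z \<in> Z - U'" and fold2: "fold z \<in> N \<union> \<sigma> ` N" and fold3: "\<sigma> (fold z) \<in> N \<union> \<sigma> ` N" if "z \<in> N" for z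
      using that \<sigma>U \<sigma>(2,3) NZ unfolding fold_def by auto
    moreover have "path_image ?b \<subseteq> Z - U'"
      using g(2) fold1 unfolding path_image_compose by blast
    moreover have "path_image ?b \<subseteq> N \<union> \<sigma> ` N" "\<sigma> ` path_image ?b \<subseteq> N \<union> \<sigma> ` N"
      using g(2) fold2 fold3 unfolding path_image_compose by blast+
    then have "path_image ?b \<subseteq> G i - B" "\<sigma> ` path_image ?b \<subseteq> G i - B" using N(4,5) by blast+
    ultimately show ?thesis by (intro exI[of _ ?b] conjI)
  qed
  then have "\<exists>b. \<forall>i. path (b i) \<and> pathstart (b i) = q i \<and> path_image (b i) \<subseteq> Z - U' \<and> path_image (b i) \<subseteq> G i - B \<and>
     \<sigma> ` path_image (b i) \<subseteq> G i - B \<and> pathfinish (b i) \<in> C" by (intro choice allI)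
  then obtain b where b0: "\<forall>i. path (b i) \<and> pathstart (b i) = q i \<and> path_image (b i) \<subseteq> Z - U' \<and> path_image (b i) \<subseteq> G i - B \<and>
     \<sigma> ` path_image (b i) \<subseteq> G i - B \<and> pathfinish (b i) \<in> C" by blast
  define a where "a i = pathfinish (b i)" for i
  have b: "path (b i)" "pathstart (b i) = q i" "path_image (b i) \<subseteq> Z - U'"
    "path_image (b i) \<subseteq> G i - B" "\<sigma> ` path_image (b i) \<subseteq> G i - B" "pathfinish (b i) = a i" "a i \<in> C" for i
    using b0 unfolding a_def by blast+
  have "path_connected C" by (rule peano_path_connected[OF Z(1,2) C(1,2)])
  then obtain A where A: "compact A" "connected A" "A \<subseteq> C" "\<And>i. a i \<in> A"
    using finite_set_in_connected_compact[of C a] b(7) by metis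
  have "\<exists>g. path g \<and> pathstart g = q i \<and> path_image g \<subseteq> path_image (b i) \<and> pathfinish g \<in> A \<and> (\<forall>t. 0 \<le> t \<longrightarrow> t < 1 \<longrightarrow> g t \<notin> A)" for i
  proof -
    have "pathstart (b i) \<notin> A" "pathfinish (b i) \<in> A" using A(3,4) b(2,6) qnR[of i] by auto
    then show ?thesis using path_to_first_hit[of "b i" A] b(1,2) A(1) by (metis compact_imp_closed)
  qed
  then obtain g where g: "\<And>i. path (g i)" "\<And>i. pathstart (g i) = q i" "\<And>i. path_image (g i) \<subseteq> path_image (b i)"
    "\<And>i. pathfinish (g i) \<in> A" "\<And>i t. 0 \<le> t \<Longrightarrow> t < 1 \<Longrightarrow> g i t \<notin> A" by metis
  define A' where "A' = \<sigma> ` A"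
  have gZ: "path_image (g i) \<subseteq> Z" for i using g(3) b(3) by blast
  have AZ: "A \<subseteq> Z" using A(3) CZ by blast
  have A': "compact A'" "connected A'" "A' \<subseteq> C'"
    using A \<sigma>(1) CZ unfolding A'_def C'_def 
    by (auto intro!: compact_continuous_image connected_continuous_image intro: continuous_on_subset)
  define g' where "g' i = \<sigma> \<circ> g i" for i
  have g'img: "path_image (g' i) = \<sigma> ` path_image (g i)" for i by (simp add: g'_def path_image_compose)
  have disj: "A \<inter> A' = {}" "A \<inter> B = {}" "A' \<inter> B = {}"
    using A(3) A'(3) B(3) C(3) C'(2) U'(3) R(4) unfolding K_def by blast+
  have gA': "path_image (g i) \<inter> A' = {}" for i using g(3) b(3) A'(3) C'(2) by blast
  have gB: "path_image (g i) \<inter> B = {}" for i using g(3) b(4) by blast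
  have gB': "path_image (g' i) \<inter> B = {}" for i using g(3)[of i] b(5)[of i] unfolding g'img by blast
  have gA: "path_image (g' i) \<inter> A = {}" for i
  proof -
    have "\<sigma> z \<notin> A" if "z \<in> path_image (g i)" for z
    proof
      assume "\<sigma> z \<in> A"
      then have "\<sigma> (\<sigma> z) \<in> A'" by (simp add: A'_def)
      then show False using \<sigma>(3) gZ gA' that by (metis disjoint_iff subsetD)
    qed
    then show ?thesis unfolding g'img by blast
  qed
  have lA: "path_image (l i) \<inter> A = {}" "path_image (l i) \<inter> A' = {}" for i
    using l(3)[of i] hRq[of i] A(3) A'(3) R(4) qnR[of i] unfolding K_def by blast+
  have once: "z = k 1" if "z \<in> path_image k" "z \<in> S" "\<And>t. 0 \<le> t \<Longrightarrow> t < 1 \<Longrightarrow> k t \<notin> S" for z S and k :: "real \<Rightarrow> complex"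
    using that by (force simp: path_image_def less_le)
  have g't: "g' i t \<notin> A'" if "0 \<le> t" "t < 1" for i t
  proof
    assume "g' i t \<in> A'"
    then obtain x where x: "x \<in> A" "\<sigma> (g i t) = \<sigma> x" by (auto simp: g'_def A'_def)
    have "g i t \<in> Z" using gZ[of i] that by (auto simp: path_image_def)
    then have "g i t = x" using x \<sigma>(3) AZ by (metis subsetD)
    then show False using g(5)[OF that] x(1) by blast
  qed
  let ?E = K33
  \<comment> \<open>The vertices with first component \<open>True\<close> are the contact points and
    own all legs; \<open>A\<close>, \<open>A'\<close> and \<open>B\<close> have none. Legs of
    different contact points lie in the disjoint balls \<open>G i\<close>.\<close>
  define H where "H x y \<longleftrightarrow> fst x \<and> \<not> fst y" for x y :: "bool \<times> bool option"
  define Yv where "Yv x = (if fst x then {q (snd x)} else case snd x of None \<Rightarrow> A | Some True \<Rightarrow> A' | Some False \<Rightarrow> B)" for x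
  define Q where "Q x y = (case snd y of None \<Rightarrow> g (snd x) | Some True \<Rightarrow> g' (snd x) | Some False \<Rightarrow> l (snd x))"
    for x y :: "bool \<times> bool option"
  define X where "X x = Yv x \<union> (\<Union>y\<in>{y. H x y}. path_image (Q x y))" for x
  have g'path: "path (g' i)" "pathstart (g' i) = q i" "pathfinish (g' i) \<in> A'" for i
    using g(1,2,4)[of i] gZ[of i] \<sigma>(1) FCfix[OF q(1)[of i]] unfolding g'_def A'_def
    by (auto simp: pathstart_compose pathfinish_compose intro!: path_continuous_image intro: continuous_on_subset)
  have sub: "path_image (g i) \<subseteq> G i" "path_image (g' i) \<subseteq> G i" "path_image (l i) \<subseteq> G i" for i
    using g(3)[of i] b(4)[of i] b(5)[of i] l(3)[of i] h(2)[of i] unfolding g'img by blast+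
  have Q: "path (Q x y)" "pathstart (Q x y) = q (snd x)" "path_image (Q x y) \<subseteq> G (snd x)" for x y
    using g(1,2) g'path l(1,2) sub unfolding Q_def by (simp_all split: option.split bool.split)
  have Qfin: "pathfinish (Q x y) \<in> Yv y" "0 \<le> t \<Longrightarrow> t < 1 \<Longrightarrow> Q x y t \<notin> Yv y" if "H x y" for x y t
    using that g(4,5) g'path(3) g't l(4,5) unfolding H_def Q_def Yv_def by (auto split: option.split bool.split)
  have Qother: "path_image (Q x y) \<inter> Yv z = {}" if "H x y" "H x z" "y \<noteq> z" for x y z
  proof -
    define i where "i = snd x"
    have "\<not> fst z" "snd y \<noteq> snd z" using that by (auto simp: H_def prod_eq_iff)
    then show ?thesis using gA'[of i] gB[of i] gB'[of i] gA[of i] lA[of i] i_def[symmetric]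
      unfolding Q_def Yv_def by (auto split: option.splits bool.splits)
  qed
  have qY: "q i \<notin> Yv y" if "\<not> fst y" for i y
    using that qnR[of i] A(3) A'(3) B(3) unfolding Yv_def by (auto split: option.splits bool.splits)
  have Xfalse: "X x = Yv x" if "\<not> fst x" for x using that by (auto simp: X_def H_def)
  have Xtrue: "X x \<subseteq> G (snd x)" if "fst x" for x
    using that Q(3)[of x] q(2)[of "snd x"] unfolding X_def Yv_def by auto
  have "plane_graph ?E"
  proof (rule plane_graph_of_contacts[where H = H and Y = Yv and X = X and q = Q])
    show "\<not> K33 u w" if "K33 u v" "K33 v w" for u v w using that by (auto simp: K33_def)
    show "K33 v u" if "K33 u v" for u v using that by (auto simp: K33_def)
    show "\<not> K33 u u" for u by (simp add: K33_def)
    show "compact (Yv v)" for v using A(1) A'(1) B(1) by (auto simp: Yv_def split: option.split bool.split)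
    show "connected (Yv v)" for v using A(2) A'(2) B(2) by (auto simp: Yv_def split: option.split bool.split)
    show "Yv v \<noteq> {}" for v using A(4) B(4) by (auto simp: Yv_def A'_def split: option.split bool.split)
    show "K33 u v \<longleftrightarrow> H u v \<or> H v u" "\<not> (H u v \<and> H v u)" for u v by (auto simp: K33_def H_def)
    show "path (Q x y)" for x y by (rule Q)
    show "pathstart (Q x y) \<in> Yv x" if "H x y" for x y using Q(2)[of x y] that by (auto simp: Yv_def H_def)
    show "X x = Yv x \<union> (\<Union>y\<in>{y. H x y}. path_image (Q x y))" for x by (rule X_def)
    show "pathfinish (Q x y) \<in> X y" if "H x y" for x y using Qfin(1)[OF that] by (simp add: X_def)
    show "pathfinish (Q x y) \<notin> Yv x" if "H x y" for x y
      using Qfin(1)[OF that] qY[of y "snd x"] that by (auto simp: Yv_def[of x] H_def)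
    show "Q x y t \<noteq> pathfinish (Q x y)" if "H x y" "0 \<le> t" "t < 1" for x y t
      using Qfin[OF that(1)] that(2,3) by metis
    show "pathfinish (Q x y) \<notin> path_image (Q x z)" if "H x y" "H x z" "z \<noteq> y" for x y z
      using Qfin(1)[OF that(1)] Qother[OF that(2,1,3)] by blast
    show "X x \<inter> X y = {}" if "x \<noteq> y" "\<not> K33 x y" for x y
    proof (cases "fst x")
      case True
      then have "fst y" "snd x \<noteq> snd y" using that by (auto simp: K33_def prod_eq_iff)
      then show ?thesis using Xtrue[of x] Xtrue[of y] Gd[of "snd x" "snd y"] True by blast
    next
      case False
      then have "\<not> fst y" "snd x \<noteq> snd y" using that by (auto simp: K33_def prod_eq_iff)
      then show ?thesis using Xfalse[of x] Xfalse[of y] False disj unfolding Yv_def by (auto split: option.splits bool.splits)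
    qed
    show "X x \<inter> X y \<subseteq> {pathfinish (Q x y)}" if h: "H x y" for x y
    proof -
      have xy: "fst x" "\<not> fst y" using h by (auto simp: H_def)
      have "path_image (Q x z) \<inter> Yv y \<subseteq> {pathfinish (Q x y)}" if "H x z" for z
      proof (cases "z = y")
        case True
        then show ?thesis using once[of _ "Q x y" "Yv y"] Qfin(2)[OF h] by (auto simp: pathfinish_def)
      next
        case False
        then show ?thesis using Qother[OF that h] by simp
      qed
      moreover have "Yv x \<inter> Yv y = {}" using xy qY[of y "snd x"] by (auto simp: Yv_def[of x])
      ultimately show ?thesis unfolding Xfalse[OF xy(2)] X_def[of x] by blast
    qed
  qed
  then show False using not_plane_graph_K33 by blast
qed

section \<open>Reading off the graph from a planar boundary\<close>

text \<open>Disjointness of the \<open>X i\<close> is what makes the induction work: the obstacles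
  \<open>K \<union> X i\<close> and \<open>K\<close> with the remaining sets intersect exactly in
  the connected set \<open>K\<close>.\<close>

lemma Janiszewski_family:
  fixes X :: "'i \<Rightarrow> complex set"
  assumes "finite J" "compact K" "connected K" "\<And>i. i \<in> J \<Longrightarrow> compact (X i)"
    and "\<And>i j. i \<in> J \<Longrightarrow> j \<in> J \<Longrightarrow> i \<noteq> j \<Longrightarrow> X i \<inter> X j = {}"
    and "connected_component (- K) a b" "\<And>i. i \<in> J \<Longrightarrow> connected_component (- (K \<union> X i)) a b"
  shows "connected_component (- (K \<union> (\<Union>i\<in>J. X i))) a b"
  using assms(1,4,5,7)
proof (induction J rule: finite_induct)
  case empty
  then show ?case using assms(6) by simp
next
  case (insert i J)
  have "connected_component (- ((K \<union> X i) \<union> (K \<union> (\<Union>i\<in>J. X i)))) a b"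
  proof (rule Janiszewski)
    show "compact (K \<union> X i)" using assms(2) insert by (intro compact_Un) auto
    have "compact (K \<union> (\<Union>i\<in>J. X i))" using assms(2) insert by (intro compact_Un compact_UN) auto
    then show "closed (K \<union> (\<Union>i\<in>J. X i))" by (rule compact_imp_closed)
    have "X i \<inter> X j = {}" if "j \<in> J" for j using insert(5)[of i j] insert(2) that by auto
    then have "(K \<union> X i) \<inter> (K \<union> (\<Union>i\<in>J. X i)) = K" by blast
    then show "connected ((K \<union> X i) \<inter> (K \<union> (\<Union>i\<in>J. X i)))" using assms(3) by simp
    show "connected_component (- (K \<union> X i)) a b" using insert by auto
    show "connected_component (- (K \<union> (\<Union>i\<in>J. X i))) a b" using insert by auto
  qed
  moreover have "(K \<union> X i) \<union> (K \<union> (\<Union>i\<in>J. X i)) = K \<union> (\<Union>i\<in>insert i J. X i)" by blast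
  ultimately show ?case by simp
qed

text \<open>The set \<open>S - U\<close> is a continuous image of \<open>S\<close>: apply
  \<open>\<sigma>\<close> on \<open>U\<close> and the identity elsewhere. The two pieces fit
  together on the closed sets where both are defined because these overlap only in fixed
  points.\<close>

lemma fold_connected:
  fixes Z :: "'a::topological_space set"
  assumes Z: "closed Z" and \<sigma>: "continuous_on Z \<sigma>" and S: "connected S" "S \<subseteq> Z" "\<sigma> ` S \<subseteq> S"
    and U: "openin (top_of_set Z) U" "openin (top_of_set Z) (\<sigma> ` U)" "U \<inter> \<sigma> ` U = {}"
    and fixp: "\<And>z. z \<in> Z \<Longrightarrow> z \<notin> U \<Longrightarrow> z \<notin> \<sigma> ` U \<Longrightarrow> \<sigma> z = z"
  shows "connected (S - U)"
proof -
  define f where "f z = (if z \<in> U then \<sigma> z else z)" for z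
  have ccl: "closed (Z - V)" if V: "openin (top_of_set Z) V" for V
  proof -
    obtain G where G: "open G" "V = Z \<inter> G" using V unfolding openin_open by blast
    then have "Z - V = Z \<inter> - G" by blast
    then show ?thesis using Z G(1) by (simp add: closed_Int closed_Compl)
  qed
  have "continuous_on ((Z - \<sigma> ` U) \<union> (Z - U)) f"
    unfolding f_def
  proof (rule continuous_on_cases)
    show "closed (Z - \<sigma> ` U)" "closed (Z - U)" using ccl U by auto
    show "continuous_on (Z - \<sigma> ` U) \<sigma>" using \<sigma> by (rule continuous_on_subset) auto
    show "\<forall>x. x \<in> Z - \<sigma> ` U \<and> x \<notin> U \<or> x \<in> Z - U \<and> x \<in> U \<longrightarrow> \<sigma> x = x" using fixp by blast
  qed auto
  moreover have "(Z - \<sigma> ` U) \<union> (Z - U) = Z" using U(3) by blast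
  ultimately have "continuous_on S f" using S(2) continuous_on_subset by fastforce
  then have "connected (f ` S)" using S(1) by (rule connected_continuous_image)
  moreover have "f ` S = S - U"
  proof
    show "f ` S \<subseteq> S - U" using S(3) U(3) by (auto simp: f_def)
    show "S - U \<subseteq> f ` S" by (force simp: f_def)
  qed
  ultimately show ?thesis by simp
qed

definition leg_union :: "('v \<Rightarrow> 'v \<Rightarrow> bool) \<Rightarrow> ('v \<Rightarrow> complex) \<Rightarrow> ('v \<Rightarrow> 'v \<Rightarrow> real \<Rightarrow> complex) \<Rightarrow> 'v \<Rightarrow> complex set" where
  "leg_union E p q x = insert (p x) (\<Union>y\<in>{y. E x y}. path_image (q x y))"

text \<open>Vertex \<open>x\<close> is represented by a star of paths from \<open>p x\<close> that stays off the complementary half; \<open>H x y\<close> means that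
  \<open>x\<close> was added after its neighbour \<open>y\<close>, and then the path from \<open>p x\<close> towards \<open>y\<close> stops where it first meets the star of \<open>y\<close>.\<close>
definition contact_system where
  "contact_system E Z U p S q H \<longleftrightarrow>
     (\<forall>x\<in>S. \<forall>y. E x y \<longrightarrow> path (q x y) \<and> pathstart (q x y) = p x) \<and>
     (\<forall>x\<in>S. leg_union E p q x \<inter> (Z - U x) = {}) \<and>
     (\<forall>x\<in>S. \<forall>y. y \<notin> S \<longrightarrow> E x y \<longrightarrow> pathfinish (q x y) \<in> U x \<inter> U y) \<and>
     (\<forall>x\<in>S. \<forall>y\<in>S. x \<noteq> y \<longrightarrow> \<not> E x y \<longrightarrow> leg_union E p q x \<inter> leg_union E p q y = {}) \<and>
     (\<forall>x\<in>S. \<forall>y\<in>S. E x y \<longrightarrow> H x y \<or> H y x) \<and>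
     (\<forall>x y. H x y \<longrightarrow> x \<in> S \<and> y \<in> S \<and> E x y \<and> \<not> H y x \<and>
        pathfinish (q x y) \<in> leg_union E p q y \<and> (\<forall>t. 0 \<le> t \<longrightarrow> t < 1 \<longrightarrow> q x y t \<notin> leg_union E p q y) \<and>
        (\<forall>z. E x z \<longrightarrow> z \<noteq> y \<longrightarrow> path_image (q x z) \<inter> leg_union E p q y = {}))"

text \<open>The predicate \<open>Q\<close> selects legs, so that the lemma covers full stars and
  also the partial stars left when the legs towards earlier vertices are treated separately.\<close>

lemma leg_union_connected:
  assumes "\<And>y. E x y \<Longrightarrow> path (q x y) \<and> pathstart (q x y) = p x"
  shows "compact (insert (p x) (\<Union>y\<in>{y. E x y \<and> Q y}. path_image (q x (y :: 'v::finite))))" (is "compact ?A") 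
    and "connected (insert (p x) (\<Union>y\<in>{y. E x y \<and> Q y}. path_image (q x (y :: 'v::finite))))"
proof -
  let ?F = "insert {p x} ((\<lambda>y. path_image (q x y)) ` {y. E x y \<and> Q y})"
  have eq: "?A = \<Union> ?F" by auto
  have *: "compact T \<and> connected T \<and> p x \<in> T" if T: "T \<in> ?F" for T
  proof (cases "T = {p x}")
    case False
    then obtain y where y: "E x y" "T = path_image (q x y)" using T by blast
    then show ?thesis using assms[OF y(1)] pathstart_in_path_image[of "q x y"] by (auto intro: compact_path_image connected_path_image)
  qed auto
  show "compact ?A" unfolding eq using * by (intro compact_Union) auto
  have "p x \<in> \<Inter> ?F" using * by blast
  then show "connected ?A" unfolding eq using * by (intro connected_Union) blast+
qed

text \<open>The obstacle \<open>K\<close> consists of \<open>Z - U v\<close> and the stars of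
  earlier non-neighbours. It is connected, since each such star has its centre in
  \<open>Z - U v\<close>. Off \<open>K\<close> the set \<open>U v\<close> is free to move in; off
  \<open>K\<close> and the star of one earlier neighbour \<open>u\<close>, the connected set
  \<open>U v - U u\<close> is. Janiszewski's theorem combines these, and the resulting path may
  leave \<open>Z\<close>.\<close>

lemma contact_system_insert:
  fixes E :: "'v::finite \<Rightarrow> 'v \<Rightarrow> bool" and U :: "'v \<Rightarrow> complex set"
  assumes sym: "\<And>u v. E u v \<Longrightarrow> E v u" and irr: "\<And>u. \<not> E u u" and tf: "\<And>u v w. E u v \<Longrightarrow> E v w \<Longrightarrow> \<not> E u w"
    and Z: "compact Z" and UZ: "\<And>v. U v \<subseteq> Z" and Uc: "\<And>v. connected (U v)"
    and Pcl: "\<And>v. compact (Z - U v)" and Pc: "\<And>v. connected (Z - U v)"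
    and UPc: "\<And>u v. E u v \<Longrightarrow> connected (U v - U u)"
    and UU: "\<And>u v. E u v \<Longrightarrow> U u \<inter> U v \<noteq> {}"
    and Ud: "\<And>u v. u \<noteq> v \<Longrightarrow> \<not> E u v \<Longrightarrow> U u \<inter> U v = {}"
    and p: "\<And>v. p v \<in> U v" "\<And>u v. E u v \<Longrightarrow> p v \<notin> U u"
    and ne: "\<And>v. Z - U v \<noteq> {}"
    and cs: "contact_system E Z U p S q H" and v: "v \<notin> S"
  shows "\<exists>q H. contact_system E Z U p (insert v S) q H"
proof -
  let ?X = "leg_union E p q"
  note c = cs[unfolded contact_system_def]
  note c1 = conjunct1[OF c] and c2 = conjunct2[OF c]
  note d1 = conjunct1[OF c2] and d2 = conjunct2[OF c2]
  note e1 = conjunct1[OF d2] and e2 = conjunct2[OF d2]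
  note f1 = conjunct1[OF e2] and f2 = conjunct2[OF e2]
  note g1 = conjunct1[OF f2] and g2 = conjunct2[OF f2]
  have q: "path (q x y)" "pathstart (q x y) = p x" if "x \<in> S" "E x y" for x y
    using c1 that by blast+
  have X1: "?X x \<inter> (Z - U x) = {}" if "x \<in> S" for x using d1 that by blast
  have X2: "pathfinish (q x y) \<in> U x \<inter> U y" if "x \<in> S" "y \<notin> S" "E x y" for x y
    using e1 that by blast
  have X3: "?X x \<inter> ?X y = {}" if "x \<in> S" "y \<in> S" "x \<noteq> y" "\<not> E x y" for x y
    using f1 that by blast
  have X4: "H x y \<or> H y x" if "x \<in> S" "y \<in> S" "E x y" for x y
    using g1 that by blast
  have X5: "x \<in> S" "y \<in> S" "E x y" "\<not> H y x" "pathfinish (q x y) \<in> ?X y" 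
    "\<And>t. 0 \<le> t \<Longrightarrow> t < 1 \<Longrightarrow> q x y t \<notin> ?X y" "\<And>z. E x z \<Longrightarrow> z \<noteq> y \<Longrightarrow> path_image (q x z) \<inter> ?X y = {}"
    if "H x y" for x y
    using g2[rule_format, OF that] by blast+
  have Xcc: "compact (?X x)" "connected (?X x)" if "x \<in> S" for x
    using leg_union_connected[of E x q p "\<lambda>_. True"] q[OF that] by (simp_all add: leg_union_def)
  have pX: "p x \<in> ?X x" for x by (simp add: leg_union_def)
  have pZ: "p x \<in> Z" for x using p(1) UZ by blast
  have XU: "?X w \<inter> Z \<subseteq> U w" if "w \<in> S" for w using X1[OF that] by blast
  define W where "W = {w \<in> S. \<not> E v w}"
  define N where "N = {u \<in> S. E v u}"
  have vw: "v \<noteq> w" if "w \<in> S" for w using v that by blast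
  define K where "K = (Z - U v) \<union> (\<Union>w\<in>W. ?X w)"
  have pK: "p w \<in> Z - U v" if "w \<in> W" for w
    using that p(1)[of w] Ud[of v w] vw pZ unfolding W_def by blast
  have K: "compact K" "connected K"
  proof -
    show "compact K" unfolding K_def using Pcl Xcc by (intro compact_Un compact_UN) (auto simp: W_def)
    have "connected ((Z - U v) \<union> ?X w)" if "w \<in> W" for w
      using Pc Xcc(2)[of w] pK[OF that] pX[of w] that by (intro connected_Un) (auto simp: W_def)
    moreover have "Z - U v \<noteq> {}" by (rule ne)
    ultimately have "connected (\<Union>(insert (Z - U v) ((\<lambda>w. (Z - U v) \<union> ?X w) ` W)))"
      using Pc by (intro connected_Union) auto
    moreover have "\<Union>(insert (Z - U v) ((\<lambda>w. (Z - U v) \<union> ?X w) ` W)) = K" by (auto simp: K_def)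
    ultimately show "connected K" by simp
  qed
  have UK: "U v \<inter> K = {}"
  proof -
    have "U v \<inter> ?X w = {}" if "w \<in> W" for w
      using XU[of w] Ud[of v w] vw that UZ[of v] unfolding W_def by blast
    then show ?thesis unfolding K_def by blast
  qed
  \<comment> \<open>Two neighbours of \<open>v\<close> are not adjacent, by triangle-freeness, so
    their stars are disjoint as \<open>Janiszewski_family\<close> demands.\<close>
  have Ndisj: "?X u \<inter> ?X u' = {}" if "u \<in> N" "u' \<in> N" "u \<noteq> u'" for u u'
    using that X3[of u u'] tf[of u v u'] sym unfolding N_def by blast
  have core: "\<exists>r. path r \<and> pathstart r = p v \<and> pathfinish r = b \<and> path_image r \<inter> (K \<union> (\<Union>u\<in>D. ?X u)) = {}"
    if D: "D \<subseteq> N" and b: "b \<in> U v" "\<And>u. u \<in> D \<Longrightarrow> b \<notin> U u" for D b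
  proof -
    have "connected_component (- (K \<union> (\<Union>u\<in>D. ?X u))) (p v) b"
    proof (rule Janiszewski_family)
      show "finite D" by simp
      show "compact (?X i)" if "i \<in> D" for i using Xcc(1) that D unfolding N_def by blast
      show "?X i \<inter> ?X j = {}" if "i \<in> D" "j \<in> D" "i \<noteq> j" for i j using Ndisj that D by blast
      show "connected_component (- K) (p v) b"
        unfolding connected_component_def using Uc[of v] UK p(1) b(1) by (intro exI[of _ "U v"]) auto
      show "connected_component (- (K \<union> ?X u)) (p v) b" if u: "u \<in> D" for u
      proof -
        have uS: "u \<in> S" "E v u" using u D by (auto simp: N_def)
        \<comment> \<open>The star of \<open>u\<close> may run outside \<open>Z\<close>, but within
          \<open>Z\<close> it stays in \<open>U u\<close>.\<close>
        have "U v - U u \<subseteq> - (K \<union> ?X u)" using UK XU[OF uS(1)] UZ by blast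
        moreover have "p v \<in> U v - U u" "b \<in> U v - U u" using p uS sym b u by auto
        ultimately show ?thesis unfolding connected_component_def using UPc[of u v] uS sym
          by (intro exI[of _ "U v - U u"]) auto
      qed
    qed (rule K)+
    moreover have "open (- (K \<union> (\<Union>u\<in>D. ?X u)))"
    proof -
      have "compact (K \<union> (\<Union>u\<in>D. ?X u))" using K(1) Xcc(1) D by (intro compact_Un compact_UN) (auto simp: N_def)
      then show ?thesis by (intro open_Compl compact_imp_closed)
    qed
    ultimately have "path_component (- (K \<union> (\<Union>u\<in>D. ?X u))) (p v) b"
      by (simp add: open_path_connected_component)
    then show ?thesis unfolding path_component_def by blast
  qed
  define good where "good y r \<longleftrightarrow> path r \<and> pathstart r = p v \<and> path_image r \<inter> K = {} \<and> (\<forall>u\<in>N. u \<noteq> y \<longrightarrow> path_image r \<inter> ?X u = {}) \<and>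
     (y \<notin> S \<longrightarrow> pathfinish r \<in> U v \<inter> U y) \<and> (y \<in> S \<longrightarrow> pathfinish r \<in> ?X y \<and> (\<forall>t. 0 \<le> t \<longrightarrow> t < 1 \<longrightarrow> r t \<notin> ?X y))" for y r
  have "\<exists>r. good y r" if y: "E v y" for y
  proof (cases "y \<in> S")
    case False
    \<comment> \<open>For a neighbour still to come the leg ends in the intersection of both halves,
      as a target for that vertex when it is added.\<close>
    obtain b where b: "b \<in> U v" "b \<in> U y" using UU[OF y] by blast
    have "b \<notin> U u" if "u \<in> N" for u
      using that False b Ud[of u y] tf[of u v y] y sym unfolding N_def by blast
    then obtain r where "path r" "pathstart r = p v" "pathfinish r = b" "path_image r \<inter> (K \<union> (\<Union>u\<in>N. ?X u)) = {}"
      using core[of N b] b by blast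
    then show ?thesis using b False unfolding good_def by (intro exI[of _ r]) blast
  next
    case True
    \<comment> \<open>The leg that \<open>y\<close> already sends towards \<open>v\<close> ends in
      both halves. It serves as the target, and the new leg is then cut where it first meets the
      star of \<open>y\<close>.\<close>
    define b where "b = pathfinish (q y v)"
    have b: "b \<in> U v" "b \<in> U y" "b \<in> ?X y"
      using X2[OF True v sym[OF y]] sym[OF y] pathfinish_in_path_image[of "q y v"] by (auto simp: b_def leg_union_def)
    have "b \<notin> U u" if "u \<in> N - {y}" for u
      using that b Ud[of u y] tf[of u v y] y sym unfolding N_def by blast
    then obtain r0 where r0: "path r0" "pathstart r0 = p v" "pathfinish r0 = b" 
      "path_image r0 \<inter> (K \<union> (\<Union>u\<in>N - {y}. ?X u)) = {}" using core[of "N - {y}" b] b by blast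
    have "p v \<notin> ?X y" using XU[OF True] pZ[of v] p(2)[of y v] sym[OF y] by blast
    then obtain r where "path r" "pathstart r = p v" "path_image r \<subseteq> path_image r0" "pathfinish r \<in> ?X y"
      "\<And>t. 0 \<le> t \<Longrightarrow> t < 1 \<Longrightarrow> r t \<notin> ?X y"
      using path_to_first_hit[OF r0(1), of "?X y"] r0 b(3) Xcc(1)[OF True] compact_imp_closed by metis
    then show ?thesis using r0(4) True unfolding good_def by (intro exI[of _ r]) blast
  qed
  then obtain r where "\<And>y. E v y \<Longrightarrow> good y (r y)" by metis
  then have r: "E v y \<Longrightarrow> path (r y)" "E v y \<Longrightarrow> pathstart (r y) = p v" "E v y \<Longrightarrow> path_image (r y) \<inter> K = {}"
    "E v y \<Longrightarrow> u \<in> N \<Longrightarrow> u \<noteq> y \<Longrightarrow> path_image (r y) \<inter> ?X u = {}"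
    "E v y \<Longrightarrow> y \<notin> S \<Longrightarrow> pathfinish (r y) \<in> U v \<inter> U y"
    "E v y \<Longrightarrow> y \<in> S \<Longrightarrow> pathfinish (r y) \<in> ?X y" 
    "E v y \<Longrightarrow> y \<in> S \<Longrightarrow> 0 \<le> t \<Longrightarrow> t < 1 \<Longrightarrow> r y t \<notin> ?X y" for y u t
    unfolding good_def by blast+
  define q' where "q' x y = (if x = v then r y else q x y)" for x y
  define H' where "H' x y \<longleftrightarrow> H x y \<or> x = v \<and> y \<in> N" for x y
  let ?X' = "leg_union E p q'"
  have XX: "?X' x = ?X x" if "x \<in> S" for x using vw[OF that] by (auto simp: leg_union_def q'_def)
  have Xv: "?X' v = insert (p v) (\<Union>y\<in>{y. E v y}. path_image (r y))" by (simp add: leg_union_def q'_def)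
  have XvK: "?X' v \<inter> K = {}" unfolding Xv using r(3) UK p(1)[of v] by blast
  have Xvw: "?X' v \<inter> ?X w = {}" if "w \<in> S" "\<not> E v w" for w
    using XvK that unfolding K_def W_def by blast
  have "contact_system E Z U p (insert v S) q' H'"
    unfolding contact_system_def
  proof (intro conjI ballI allI impI)
    fix x y assume "x \<in> insert v S" "E x y"
    then show "path (q' x y)" "pathstart (q' x y) = p x" using r(1,2) q by (auto simp: q'_def)
  next
    fix x assume "x \<in> insert v S"
    then consider "x = v" | "x \<in> S" by blast
    then show "?X' x \<inter> (Z - U x) = {}"
    proof cases
      case 1 then show ?thesis using XvK unfolding K_def by blast
    next
      case 2 then show ?thesis using X1 XX by simp
    qed
  next
    fix x y assume "x \<in> insert v S" "y \<notin> insert v S" "E x y"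
    then show "pathfinish (q' x y) \<in> U x \<inter> U y" using r(5) X2 by (auto simp: q'_def)
  next
    fix x y assume xy: "x \<in> insert v S" "y \<in> insert v S" "x \<noteq> y" "\<not> E x y"
    then consider "x = v" "y \<in> S" | "y = v" "x \<in> S" | "x \<in> S" "y \<in> S" by blast
    then show "?X' x \<inter> ?X' y = {}"
    proof cases
      case 1 then show ?thesis using Xvw[of y] XX xy by simp
    next
      case 2 then show ?thesis using Xvw[of x] XX xy sym by blast
    next
      case 3 then show ?thesis using X3 XX xy by simp
    qed
  next
    fix x y assume "x \<in> insert v S" "y \<in> insert v S" "E x y"
    then show "H' x y \<or> H' y x" using X4 irr sym unfolding H'_def N_def by blast
  next
    fix x y assume h: "H' x y"
    show "x \<in> insert v S" "y \<in> insert v S" "E x y" using h X5 unfolding H'_def N_def by blast+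
    show "\<not> H' y x" using h X5 v unfolding H'_def N_def by blast
    have yS: "y \<in> S" using h X5 unfolding H'_def N_def by blast
    show "pathfinish (q' x y) \<in> ?X' y" 
      using h X5(1,5) v r(6) unfolding XX[OF yS] by (auto simp: H'_def N_def q'_def)
    show "q' x y t \<notin> ?X' y" if "0 \<le> t" "t < 1" for t
      using h X5(1,6) v r(7) that unfolding XX[OF yS] by (auto simp: H'_def N_def q'_def)
    show "path_image (q' x z) \<inter> ?X' y = {}" if "E x z" "z \<noteq> y" for z
    proof (cases "x = v")
      case True
      then have "y \<in> N" using h X5(1) v unfolding H'_def by blast
      then show ?thesis using r(4)[of z y] that True unfolding XX[OF yS] by (auto simp: q'_def)
    next
      case False
      then have "H x y" using h by (auto simp: H'_def)
      then show ?thesis using X5(7)[of x y z] that False unfolding XX[OF yS] by (simp add: q'_def)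
    qed
  qed
  then show ?thesis by blast
qed

theorem plane_graph_of_planar_halves:
  fixes E :: "'v::finite \<Rightarrow> 'v \<Rightarrow> bool" and U :: "'v \<Rightarrow> complex set" and \<sigma> :: "'v \<Rightarrow> complex \<Rightarrow> complex"
  assumes sym: "\<And>u v. E u v \<Longrightarrow> E v u" and irr: "\<And>u. \<not> E u u" and tf: "\<And>u v w. E u v \<Longrightarrow> E v w \<Longrightarrow> \<not> E u w"
    and nb: "\<And>v. \<exists>u. E v u"
    and Z: "compact Z" "locally_connected_set Z" "connected Z" "Z \<noteq> {}"
    and nlcp: "\<And>p N. openin (top_of_set Z) N \<Longrightarrow> connected N \<Longrightarrow> p \<in> N \<Longrightarrow> connected (N - {p})"
    and \<sigma>: "\<And>v. continuous_on Z (\<sigma> v)" "\<And>v z. z \<in> Z \<Longrightarrow> \<sigma> v z \<in> Z" "\<And>v z. z \<in> Z \<Longrightarrow> \<sigma> v (\<sigma> v z) = z"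
    and U: "\<And>v. openin (top_of_set Z) (U v)" "\<And>v. openin (top_of_set Z) (\<sigma> v ` U v)" "\<And>v. U v \<inter> \<sigma> v ` U v = {}" 
      "\<And>v z. z \<in> Z \<Longrightarrow> z \<notin> U v \<Longrightarrow> z \<notin> \<sigma> v ` U v \<Longrightarrow> \<sigma> v z = z"
    and comm: "\<And>u v. E u v \<Longrightarrow> \<sigma> u ` U v \<subseteq> U v"
    and commute: "\<And>u v z. E u v \<Longrightarrow> z \<in> Z \<Longrightarrow> \<sigma> u (\<sigma> v z) = \<sigma> v (\<sigma> u z)"
    and fixd: "\<And>u v z. E u v \<Longrightarrow> z \<in> Z \<Longrightarrow> \<sigma> u z = z \<Longrightarrow> \<sigma> v z \<noteq> z"
    and Ud: "\<And>u v. u \<noteq> v \<Longrightarrow> \<not> E u v \<Longrightarrow> U u \<inter> U v = {}"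
  shows "plane_graph E"
proof -
  have UZ: "U v \<subseteq> Z" for v using U(1) by (rule openin_imp_subset)
  have cZ: "closed Z" using Z(1) by (rule compact_imp_closed)
  have Uc: "connected (U v)" for v
    by (rule half_connected[OF Z(1-3) nlcp \<sigma>(1)[of v] \<sigma>(2,3) U(1) U(3,4)])
  have Pc: "connected (Z - U v)" for v
    by (rule fold_connected[OF cZ \<sigma>(1)[of v] Z(3) _ _ U]) (use \<sigma>(2) in auto)
  have UPc: "connected (U v - U u)" if "E u v" for u v
    by (rule fold_connected[OF cZ \<sigma>(1)[of u] Uc[of v] UZ comm[OF that] U])
  have Pcl: "compact (Z - U v)" for v
  proof -
    obtain G where G: "open G" "U v = Z \<inter> G" using U(1)[of v] unfolding openin_open by blast
    then have "Z - U v = Z - G" by blast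
    then show ?thesis using G Z(1) by (simp add: compact_diff)
  qed
  have unflip: "\<sigma> v z \<in> U v" if zU: "z \<in> \<sigma> v ` U v" for v z
  proof -
    obtain y where "y \<in> U v" "z = \<sigma> v y" using zU by blast
    moreover from this have "y \<in> Z" using UZ by blast
    ultimately show ?thesis using \<sigma>(3) by simp
  qed
  have nfix: "\<sigma> v z \<noteq> z" if "z \<in> U v \<or> z \<in> \<sigma> v ` U v" for v z
  proof
    assume eq: "\<sigma> v z = z"
    have "z \<in> U v" using that unflip eq by metis
    moreover from this have "z \<in> \<sigma> v ` U v" using eq by (metis imageI)
    ultimately show False using U(3) by blast
  qed
  have \<sigma>U: "\<sigma> v ` U v \<subseteq> Z" for v using U(2) by (rule openin_imp_subset)
  \<comment> \<open>If \<open>U v\<close> were empty, \<open>\<sigma> v\<close> would be the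
    identity on \<open>Z\<close>. A neighbour \<open>u\<close> would then have no fixed point, and
    its two halves would disconnect \<open>Z\<close>.\<close>
  have Une: "U v \<noteq> {}" for v
  proof
    assume e: "U v = {}"
    obtain u where u: "E v u" using nb by blast
    have "\<sigma> u z \<noteq> z" if "z \<in> Z" for z using fixd[OF u that] U(4)[of z v] that e by blast
    then have Zeq: "Z \<subseteq> U u \<union> \<sigma> u ` U u" using U(4) by blast
    then have "U u = {} \<or> \<sigma> u ` U u = {}"
      using Z(3) U(1,2,3)[of u] unfolding connected_openin by blast
    then show False using Zeq Z(4) by auto
  qed
  have ne: "Z - U v \<noteq> {}" for v using Une[of v] U(3)[of v] UZ[of v] \<sigma>(2) by blast
  have swap: "\<sigma> u ` U v = U v" if "E u v" for u v
  proof
    show "U v \<subseteq> \<sigma> u ` U v"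
    proof
      fix z assume "z \<in> U v"
      moreover from this have "z \<in> Z" using UZ by blast
      ultimately have "\<sigma> u z \<in> U v" "z = \<sigma> u (\<sigma> u z)" using comm[OF that] \<sigma>(3)[of z u] by auto
      then show "z \<in> \<sigma> u ` U v" by blast
    qed
  qed (rule comm[OF that])
  \<comment> \<open>If the halves were disjoint, \<open>\<sigma> v\<close> would fix both halves of
    \<open>u\<close>. So the points moved by \<open>u\<close> and those moved by \<open>v\<close>
    would be disjoint open sets; they cover \<open>Z\<close>, as there are no common fixed
    points.\<close>
  have UU: "U u \<inter> U v \<noteq> {}" if uv: "E u v" for u v
  proof
    assume e: "U u \<inter> U v = {}"
    have fx: "\<sigma> v z = z" if z: "z \<in> U u" for z
    proof -
      have "z \<notin> \<sigma> v ` U v"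
      proof
        assume "z \<in> \<sigma> v ` U v"
        then have "\<sigma> v z \<in> U v" by (rule unflip)
        moreover have "\<sigma> v z \<in> U u" using comm[OF sym[OF uv]] z by blast
        ultimately show False using e by blast
      qed
      then show ?thesis using U(4) z e UZ by blast
    qed
    have fx': "\<sigma> v z = z" if z: "z \<in> \<sigma> u ` U u" for z
    proof -
      obtain x where x: "x \<in> U u" "z = \<sigma> u x" using z by blast
      then have "\<sigma> v z = \<sigma> u (\<sigma> v x)" using commute[OF uv, of x] UZ by (metis subsetD)
      then show ?thesis using fx[OF x(1)] x(2) by simp
    qed
    let ?A = "U u \<union> \<sigma> u ` U u" and ?B = "U v \<union> \<sigma> v ` U v"
    have "openin (top_of_set Z) ?A" "openin (top_of_set Z) ?B" using U(1,2) by blast+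
    moreover have "Z \<subseteq> ?A \<union> ?B"
    proof
      fix z assume z: "z \<in> Z"
      show "z \<in> ?A \<union> ?B" using U(4)[OF z, of u] U(4)[OF z, of v] fixd[OF uv z] by blast
    qed
    moreover have "?A \<inter> ?B = {}" using fx fx' nfix by blast
    ultimately have "?A = {} \<or> ?B = {}" using Z(3) unfolding connected_openin by blast
    then show False using Une by blast
  qed
  \<comment> \<open>A centre outside all neighbouring halves. These halves are pairwise disjoint and
    open, so if they covered the connected set \<open>U v\<close>, one of them, \<open>U u\<close>,
    would contain it. But \<open>\<sigma> u\<close> preserves \<open>U v\<close> and moves
    \<open>U u\<close> off itself.\<close>
  have "\<exists>p. p \<in> U v \<and> (\<forall>u. E u v \<longrightarrow> p \<notin> U u)" for v
  proof (rule ccontr)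
    assume neg: "\<not> ?thesis"
    have "\<exists>G. open G \<and> U u = Z \<inter> G" for u using U(1)[of u] unfolding openin_open by blast
    then obtain G where G: "\<And>u. open (G u)" "\<And>u. U u = Z \<inter> G u" by metis
    obtain z where z: "z \<in> U v" using Une by blast
    then obtain u where u: "E u v" "z \<in> U u" using neg by blast
    let ?B = "\<Union>w\<in>{w. E w v \<and> w \<noteq> u}. G w"
    have "G u \<inter> ?B \<inter> U v = {}"
    proof -
      have "U u \<inter> U w = {}" if "E w v" "w \<noteq> u" for w using that Ud[of u w] tf[of u v w] u(1) sym by blast
      then show ?thesis using G(2) UZ by blast
    qed
    moreover have "U v \<subseteq> G u \<union> ?B" using neg G(2) UZ by blast
    moreover have "G u \<inter> U v \<noteq> {}" using z u G(2) by blast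
    ultimately have "?B \<inter> U v = {}" using connectedD[OF Uc[of v], of "G u" ?B] G(1) by blast
    then have "U v \<subseteq> G u" using \<open>U v \<subseteq> G u \<union> ?B\<close> by blast
    then have "U v \<subseteq> U u" using UZ[of v] unfolding G(2)[of u] by blast
    then show False using swap[OF u(1)] U(3)[of u] Une[of v] by blast
  qed
  then obtain p where p: "\<And>v. p v \<in> U v" "\<And>u v. E u v \<Longrightarrow> p v \<notin> U u" by metis
  have ex: "\<exists>q H. contact_system E Z U p S q H" if "finite S" for S
    using that
  proof (induction S rule: finite_induct)
    case empty
    have "contact_system E Z U p {} (\<lambda>_ _ _. 0) (\<lambda>_ _. False)" by (simp add: contact_system_def)
    then show ?case by blast
  next
    case (insert v S)
    then obtain q H where "contact_system E Z U p S q H" by blast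
    from contact_system_insert[OF sym irr tf Z(1) UZ Uc Pcl Pc UPc UU Ud p ne this insert(2)] show ?case .
  qed
  obtain q H where c: "contact_system E Z U p UNIV q H" using ex[of UNIV] by auto
  let ?X = "leg_union E p q"
  note c' = c[unfolded contact_system_def]
  note c1 = conjunct1[OF c'] and c2 = conjunct2[OF c']
  note d1 = conjunct1[OF c2] and d2 = conjunct2[OF c2]
  note e2 = conjunct2[OF d2]
  note f1 = conjunct1[OF e2] and f2 = conjunct2[OF e2]
  note g1 = conjunct1[OF f2] and g2 = conjunct2[OF f2]
  have q: "path (q x y) \<and> pathstart (q x y) = p x" if "E x y" for x y using c1 that by blast
  have X5: "E x y" "\<not> H y x" "pathfinish (q x y) \<in> ?X y" 
    "\<And>t. 0 \<le> t \<Longrightarrow> t < 1 \<Longrightarrow> q x y t \<notin> ?X y" "\<And>z. E x z \<Longrightarrow> z \<noteq> y \<Longrightarrow> path_image (q x z) \<inter> ?X y = {}"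
    if "H x y" for x y
    using g2[rule_format, OF that] by blast+
  have pX: "p x \<notin> ?X y" if "E x y" for x y
    using d1 p(2)[OF sym[OF that]] p(1)[of x] UZ by blast
  \<comment> \<open>The centre with the legs towards vertices added later. The legs towards earlier
    vertices are the attached paths, which end on the stars of those vertices.\<close>
  define Y where "Y x = insert (p x) (\<Union>y\<in>{y. E x y \<and> \<not> H x y}. path_image (q x y))" for x
  have YX: "?X x = Y x \<union> (\<Union>y\<in>{y. H x y}. path_image (q x y))" for x
    using X5(1) unfolding Y_def leg_union_def by blast
  have Yn: "Y x \<inter> ?X y = {}" if "H x y" for x y
    using pX[OF X5(1)[OF that]] X5(5)[OF that] that unfolding Y_def by blast
  show ?thesis
  proof (rule plane_graph_of_contacts[where H = H and Y = Y and X = ?X and q = q])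
    show "compact (Y v)" for v unfolding Y_def by (rule leg_union_connected(1), rule q)
    show "connected (Y v)" for v unfolding Y_def by (rule leg_union_connected(2), rule q)
    show "Y v \<noteq> {}" for v by (simp add: Y_def)
    show "E u v \<longleftrightarrow> H u v \<or> H v u" for u v using g1 X5(1) sym by blast
    show "\<not> (H u v \<and> H v u)" for u v using X5(2) by blast
    show "path (q x y)" if "H x y" for x y using q X5(1)[OF that] by blast
    show "pathstart (q x y) \<in> Y x" if "H x y" for x y using q X5(1)[OF that] by (simp add: Y_def)
    show "?X x = Y x \<union> (\<Union>y\<in>{y. H x y}. path_image (q x y))" for x by (rule YX)
    show "pathfinish (q x y) \<in> ?X y" if "H x y" for x y using X5(3)[OF that] .
    show "pathfinish (q x y) \<notin> Y x" if "H x y" for x y using X5(3)[OF that] Yn[OF that] by blast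
    show "q x y t \<noteq> pathfinish (q x y)" if "H x y" "0 \<le> t" "t < 1" for x y t
      using X5(3,4)[OF that(1)] that(2,3) by metis
    show "pathfinish (q x y) \<notin> path_image (q x z)" if "H x y" "H x z" "z \<noteq> y" for x y z
      using X5(3,5)[OF that(1)] X5(1)[OF that(2)] that(3) by blast
    show "?X x \<inter> ?X y = {}" if "x \<noteq> y" "\<not> E x y" for x y using f1 that by blast
    show "?X x \<inter> ?X y \<subseteq> {pathfinish (q x y)}" if h: "H x y" for x y
    proof -
      have "path_image (q x z) \<inter> ?X y \<subseteq> {pathfinish (q x y)}" if "H x z" for z
      proof (cases "z = y")
        case True
        show ?thesis
        proof
          fix w assume "w \<in> path_image (q x z) \<inter> ?X y"
          then obtain t where t: "w = q x y t" "0 \<le> t" "t \<le> 1" "q x y t \<in> ?X y" using True by (auto simp: path_image_def)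
          then have "t = 1" using X5(4)[OF h, of t] by linarith
          then show "w \<in> {pathfinish (q x y)}" using t by (simp add: pathfinish_def)
        qed
      next
        case False
        then show ?thesis using X5(5)[OF h] X5(1)[OF that] by simp
      qed
      then show ?thesis using Yn[OF h] unfolding YX[of x] by blast
    qed
  qed (fact sym irr tf)+
qed

lemma planar_compact_embeds_in_plane:
  fixes S :: "'a::topological_space set" and f :: "'a \<Rightarrow> real^3"
  assumes "compact S" and f: "continuous_on S f" "inj_on f S" "f ` S \<subset> sphere 0 1"
  shows "\<exists>Z h k. homeomorphism S (Z :: complex set) h k"
proof -
  obtain n where n: "n \<in> sphere 0 1" "n \<notin> f ` S" using f(3) by blast
  have "sphere 0 1 - {n} homeomorphic (UNIV :: complex set)"
    by (rule homeomorphic_punctured_sphere_affine) (use n in auto)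
  then obtain s t where "homeomorphism (sphere 0 1 - {n}) (UNIV :: complex set) s t" by (auto simp: homeomorphic_def)
  then have s: "continuous_on (sphere 0 1 - {n}) s" "inj_on s (sphere 0 1 - {n})"
    by (auto simp: homeomorphism_def intro: inj_on_inverseI)
  have sub: "f ` S \<subseteq> sphere 0 1 - {n}" using f(3) n by blast
  have "continuous_on S (s \<circ> f)" using f(1) s(1) sub by (meson continuous_on_compose continuous_on_subset)
  moreover have "inj_on (s \<circ> f) S" using f(2) s(2) sub by (meson comp_inj_on inj_on_subset)
  ultimately show ?thesis using homeomorphism_compact[OF assms(1), of "s \<circ> f"] by blast
qed

text \<open>This reduces the sphere to the plane. If the image were the whole sphere, the fixed set
  \<open>F\<close> of \<open>\<sigma> v\<close> would be the intersection of two connected closed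
  sets covering the sphere, hence connected by unicoherence. But a neighbour \<open>u\<close> maps
  \<open>F\<close> to itself without fixed points, and the two halves of \<open>u\<close>, which it
  exchanges, would separate \<open>F\<close>.\<close>

theorem plane_graph_of_spherical_halves:
  fixes E :: "'v::finite \<Rightarrow> 'v \<Rightarrow> bool" and S :: "'a::topological_space set" and U :: "'v \<Rightarrow> 'a set" and \<sigma> :: "'v \<Rightarrow> 'a \<Rightarrow> 'a"
    and f :: "'a \<Rightarrow> real^3"
  assumes sym: "\<And>u v. E u v \<Longrightarrow> E v u" and irr: "\<And>u. \<not> E u u" and tf: "\<And>u v w. E u v \<Longrightarrow> E v w \<Longrightarrow> \<not> E u w"
    and nb: "\<And>v. \<exists>u. E v u"
    and S: "compact S" "locally_connected_set S" "connected S" "S \<noteq> {}"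
    and f: "continuous_on S f" "inj_on f S" "f ` S \<subseteq> sphere 0 1"
    and nlcp: "\<And>p N. openin (top_of_set S) N \<Longrightarrow> connected N \<Longrightarrow> p \<in> N \<Longrightarrow> connected (N - {p})"
    and \<sigma>: "\<And>v. continuous_on S (\<sigma> v)" "\<And>v z. z \<in> S \<Longrightarrow> \<sigma> v z \<in> S" "\<And>v z. z \<in> S \<Longrightarrow> \<sigma> v (\<sigma> v z) = z"
    and U: "\<And>v. openin (top_of_set S) (U v)" "\<And>v. openin (top_of_set S) (\<sigma> v ` U v)" "\<And>v. U v \<inter> \<sigma> v ` U v = {}" 
      "\<And>v z. z \<in> S \<Longrightarrow> z \<notin> U v \<Longrightarrow> z \<notin> \<sigma> v ` U v \<Longrightarrow> \<sigma> v z = z"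
    and comm: "\<And>u v. E u v \<Longrightarrow> \<sigma> u ` U v \<subseteq> U v"
    and commute: "\<And>u v z. E u v \<Longrightarrow> z \<in> S \<Longrightarrow> \<sigma> u (\<sigma> v z) = \<sigma> v (\<sigma> u z)"
    and fixd: "\<And>u v z. E u v \<Longrightarrow> z \<in> S \<Longrightarrow> \<sigma> u z = z \<Longrightarrow> \<sigma> v z \<noteq> z"
    and Ud: "\<And>u v. u \<noteq> v \<Longrightarrow> \<not> E u v \<Longrightarrow> U u \<inter> U v = {}"
  shows "plane_graph E"
proof -
  have US: "U v \<subseteq> S" for v using U(1) by (rule openin_imp_subset)
  have \<sigma>US: "\<sigma> v ` U v \<subseteq> S" for v using U(2) by (rule openin_imp_subset)
  have inv: "\<sigma> w ` \<sigma> w ` U w = U w" for w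
  proof -
    have "(\<lambda>x. \<sigma> w (\<sigma> w x)) ` U w = (\<lambda>x. x) ` U w" by (rule image_cong) (use \<sigma>(3) US in auto)
    then show ?thesis by (simp add: image_image)
  qed
  obtain g where g: "homeomorphism S (f ` S) f g" using homeomorphism_compact[OF S(1) f(1) refl f(2)] by blast
  have "f ` S \<noteq> sphere 0 1"
  proof
    assume sph: "f ` S = sphere 0 1"
    fix v :: 'v
    obtain u where u: "E v u" using nb by blast
    have hT: "homeomorphism (sphere 0 1) S g f" using g sph by (simp add: homeomorphism_symD)
    define F where "F = S - U v - \<sigma> v ` U v"
    have Ffix: "\<sigma> v z = z" if "z \<in> F" for z using that U(4) by (auto simp: F_def)
    text \<open>The two closed halves are images of the sphere under the folding maps.\<close>
    let ?\<tau> = "f \<circ> \<sigma> v \<circ> g"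
    have ct: "continuous_on (sphere 0 1) ?\<tau>"
      using hT \<sigma>(1,2) f(1) unfolding homeomorphism_def
      by (intro continuous_on_compose) (auto intro: continuous_on_subset)
    have opn: "openin (top_of_set (sphere 0 1)) (f ` V)" if "openin (top_of_set S) V" for V
      using homeomorphism_imp_open_map[OF g that] sph by simp
    have gf: "g (f z) = z" if "z \<in> S" for z using g that by (simp add: homeomorphism_def)
    have half: "connected (sphere 0 1 - f ` V)"
      if V: "V \<subseteq> S" "openin (top_of_set S) V" "openin (top_of_set S) (\<sigma> v ` V)" "V \<inter> \<sigma> v ` V = {}"
        "\<And>z. z \<in> S \<Longrightarrow> z \<notin> V \<Longrightarrow> z \<notin> \<sigma> v ` V \<Longrightarrow> \<sigma> v z = z" for V
    proof -
      have img: "?\<tau> ` f ` V = f ` \<sigma> v ` V" using V(1) gf by (force simp: image_comp)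
      have "\<sigma> v ` V \<subseteq> S" using V(1) \<sigma>(2) by blast
      show ?thesis
      proof (rule fold_connected[OF _ ct])
        show "closed (sphere (0::real^3) 1)" "connected (sphere (0::real^3) 1)" by (auto intro: connected_sphere)
        show "?\<tau> ` sphere 0 1 \<subseteq> sphere 0 1" using hT \<sigma>(2) sph unfolding homeomorphism_def by auto
        show "openin (top_of_set (sphere 0 1)) (f ` V)" by (rule opn[OF V(2)])
        show "openin (top_of_set (sphere 0 1)) (?\<tau> ` f ` V)" unfolding img by (rule opn[OF V(3)])
        show "f ` V \<inter> ?\<tau> ` f ` V = {}" unfolding img
          using V(1,4) \<open>\<sigma> v ` V \<subseteq> S\<close> f(2) by (metis image_empty inj_on_image_Int)
        fix z assume z: "z \<in> sphere 0 1" "z \<notin> f ` V" "z \<notin> ?\<tau> ` f ` V"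
        then obtain y where y: "y \<in> S" "z = f y" using sph by blast
        then have "y \<notin> V" "y \<notin> \<sigma> v ` V" using z unfolding img by blast+
        then show "?\<tau> z = z" using V(5) y gf by simp
      qed auto
    qed
    have "connected (sphere 0 1 - f ` U v)" by (rule half[OF US U(1,2,3,4)])
    moreover have "connected (sphere 0 1 - f ` \<sigma> v ` U v)"
    proof (rule half[OF \<sigma>US U(2)], unfold inv)
      show "openin (top_of_set S) (U v)" by (rule U)
      show "\<sigma> v ` U v \<inter> U v = {}" using U(3)[of v] by blast
    qed (rule U(4))
    moreover have "sphere 0 1 = (sphere 0 1 - f ` U v) \<union> (sphere 0 1 - f ` \<sigma> v ` U v)"
    proof -
      have "f ` U v \<inter> f ` \<sigma> v ` U v = {}" using U(3)[of v] US \<sigma>US f(2) by (metis image_empty inj_on_image_Int)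
      then show ?thesis by blast
    qed
    moreover have "closedin (top_of_set (sphere 0 1)) (sphere 0 1 - f ` U v)" 
      "closedin (top_of_set (sphere 0 1)) (sphere 0 1 - f ` \<sigma> v ` U v)"
      using opn[OF U(1)] opn[OF U(2)] by (auto intro: closedin_diff)
    moreover have "unicoherent (sphere (0::real^3) 1)" by (intro Borsukian_imp_unicoherent Borsukian_sphere) simp
    ultimately have "connected ((sphere 0 1 - f ` U v) \<inter> (sphere 0 1 - f ` \<sigma> v ` U v))"
      using unicoherentD by blast
    moreover have "(sphere 0 1 - f ` U v) \<inter> (sphere 0 1 - f ` \<sigma> v ` U v) = f ` F"
    proof -
      have "f ` (S - (U v \<union> \<sigma> v ` U v)) = f ` S - f ` (U v \<union> \<sigma> v ` U v)"
        using US \<sigma>US by (intro inj_on_image_set_diff[OF f(2)]) auto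
      moreover have "F = S - (U v \<union> \<sigma> v ` U v)" by (auto simp: F_def)
      ultimately show ?thesis unfolding sph image_Un by blast
    qed
    moreover have "g ` f ` F = F" using gf by (force simp: F_def image_image)
    moreover have "continuous_on (f ` F) g" using g unfolding homeomorphism_def F_def by (auto intro: continuous_on_subset)
    ultimately have Fc: "connected F" by (metis connected_continuous_image)
    have "F \<noteq> {}"
    proof
      assume "F = {}"
      then have e: "S \<subseteq> U v \<union> \<sigma> v ` U v" by (auto simp: F_def)
      then have "U v = {} \<or> \<sigma> v ` U v = {}"
        using S(3) U(1,2,3)[of v] unfolding connected_openin by blast
      then show False using e S(4) by auto
    qed
    then obtain z where z: "z \<in> F" by blast
    have "F \<subseteq> U u \<union> \<sigma> u ` U u"
    proof
      fix z assume z: "z \<in> F"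
      then have "z \<in> S" "\<sigma> u z \<noteq> z" using fixd[OF u, of z] Ffix[OF z] by (auto simp: F_def)
      then show "z \<in> U u \<union> \<sigma> u ` U u" using U(4) by blast
    qed
    moreover obtain G G' where G: "open G" "open G'" "U u = S \<inter> G" "\<sigma> u ` U u = S \<inter> G'"
      using U(1,2)[of u] unfolding openin_open by blast
    moreover have "F \<subseteq> S" by (auto simp: F_def)
    ultimately have "G \<inter> F = {} \<or> G' \<inter> F = {}"
      using connectedD[OF Fc G(1,2)] U(3)[of u] by blast
    moreover have "\<sigma> u z \<in> F"
    proof -
      have zS: "z \<in> S" using z by (auto simp: F_def)
      have fx: "\<sigma> v (\<sigma> u z) = \<sigma> u z" using commute[OF u zS] Ffix[OF z] by simp
      have "\<sigma> u z \<notin> U v" "\<sigma> u z \<notin> \<sigma> v ` U v"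
      proof -
        show n: "\<sigma> u z \<notin> U v" using fx U(3)[of v] by (metis disjoint_iff imageI)
        show "\<sigma> u z \<notin> \<sigma> v ` U v"
        proof
          assume "\<sigma> u z \<in> \<sigma> v ` U v"
          then have "\<sigma> v (\<sigma> u z) \<in> U v" using inv by (metis imageI)
          then show False using fx n by simp
        qed
      qed
      then show ?thesis using \<sigma>(2)[OF zS] by (simp add: F_def)
    qed
    moreover have "z \<in> U u \<and> \<sigma> u z \<in> \<sigma> u ` U u \<or> z \<in> \<sigma> u ` U u \<and> \<sigma> u z \<in> U u"
    proof -
      have "z \<in> U u \<union> \<sigma> u ` U u" using z \<open>F \<subseteq> U u \<union> \<sigma> u ` U u\<close> by blast
      moreover have "\<sigma> u z \<in> U u" if "z \<in> \<sigma> u ` U u" using that inv[of u] by (metis imageI)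
      ultimately show ?thesis by blast
    qed
    ultimately show False using z G(3,4) by blast
  qed
  then have "f ` S \<subset> sphere 0 1" using f(3) by blast
  then obtain Z :: "complex set" and h k where hk: "homeomorphism S Z h k"
    using planar_compact_embeds_in_plane[OF S(1) f(1,2)] by blast
  note hk' = hk[unfolded homeomorphism_def]
  have h: "continuous_on S h" "h ` S = Z" and k: "continuous_on Z k" "k ` Z = S" 
    and kh: "\<And>x. x \<in> S \<Longrightarrow> k (h x) = x" and hk2: "\<And>y. y \<in> Z \<Longrightarrow> h (k y) = y"
    using hk' by auto
  have kS: "k z \<in> S" if "z \<in> Z" for z using k(2) that by blast
  have hZ: "h x \<in> Z" if "x \<in> S" for x using h(2) that by blast
  have hopen: "openin (top_of_set Z) (h ` V)" if "openin (top_of_set S) V" for V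
    using homeomorphism_imp_open_map[OF hk that] .
  have kopen: "openin (top_of_set S) (k ` V)" if "openin (top_of_set Z) V" for V
    using homeomorphism_imp_open_map[OF homeomorphism_symD[OF hk] that] .
  have hkimg: "h ` k ` V = V" if "V \<subseteq> Z" for V using that hk2 by (force simp: image_image)
  have sub_h: "V \<subseteq> S \<Longrightarrow> continuous_on V h" for V using h(1) continuous_on_subset by blast
  have sub_k: "V \<subseteq> Z \<Longrightarrow> continuous_on V k" for V using k(1) continuous_on_subset by blast
  have hinj: "inj_on h S" using kh by (rule inj_on_inverseI)
  define \<sigma>' where "\<sigma>' v = h \<circ> \<sigma> v \<circ> k" for v
  define U' where "U' v = h ` U v" for v
  have \<sigma>'h: "\<sigma>' v (h x) = h (\<sigma> v x)" if "x \<in> S" for v x using kh[OF that] by (simp add: \<sigma>'_def)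
  have img: "\<sigma>' v ` U' w = h ` \<sigma> v ` U w" for v w
    unfolding U'_def image_image by (rule image_cong) (use \<sigma>'h US in auto)
  show ?thesis
  proof (rule plane_graph_of_planar_halves[where Z = Z and U = U' and \<sigma> = \<sigma>'])
    show "compact Z" using S(1) h by (metis compact_continuous_image)
    show "connected Z" using S(3) h by (metis connected_continuous_image)
    show "Z \<noteq> {}" using S(4) h by blast
    show "locally_connected_set Z"
      unfolding locally_connected_set_def
    proof (intro allI impI)
      fix W x assume W: "openin (top_of_set Z) W" "x \<in> W"
      have WZ: "W \<subseteq> Z" using W(1) by (rule openin_imp_subset)
      obtain N where N: "openin (top_of_set S) N" "connected N" "k x \<in> N" "N \<subseteq> k ` W"
        using S(2) kopen[OF W(1)] W(2) unfolding locally_connected_set_def by (meson imageI)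
      have "x \<in> h ` N" using N(3) hk2[of x] W(2) WZ by (metis imageI subsetD)
      moreover have "connected (h ` N)" using N(2) sub_h openin_imp_subset[OF N(1)] by (metis connected_continuous_image)
      moreover have "h ` N \<subseteq> W" using N(4) hkimg[OF WZ] by blast
      ultimately show "\<exists>N. openin (top_of_set Z) N \<and> connected N \<and> x \<in> N \<and> N \<subseteq> W"
        using hopen[OF N(1)] by blast
    qed
    show "connected (N - {p})" if N: "openin (top_of_set Z) N" "connected N" "p \<in> N" for p N
    proof -
      have NZ: "N \<subseteq> Z" using N(1) by (rule openin_imp_subset)
      have "connected (k ` N)" using N(2) sub_k[OF NZ] by (metis connected_continuous_image)
      then have "connected (k ` N - {k p})" using nlcp[OF kopen[OF N(1)]] N(3) by blast
      moreover have "k ` N \<subseteq> S" using NZ k(2) by blast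
      ultimately have "connected (h ` (k ` N - {k p}))" using sub_h by (metis connected_continuous_image Diff_subset subset_trans)
      moreover have "h ` (k ` N - {k p}) = N - {p}"
      proof -
        have "h ` (k ` N - {k p}) = h ` k ` N - h ` {k p}"
          using \<open>k ` N \<subseteq> S\<close> N(3) by (intro inj_on_image_set_diff[OF hinj]) auto
        then show ?thesis using hkimg[OF NZ] hk2[of p] NZ N(3) by auto
      qed
      ultimately show ?thesis by simp
    qed
    show "continuous_on Z (\<sigma>' v)" for v
      unfolding \<sigma>'_def using k h \<sigma>(1,2) by (intro continuous_on_compose) (auto intro: continuous_on_subset)
    show "\<sigma>' v z \<in> Z" if "z \<in> Z" for v z using kS[OF that] \<sigma>(2) hZ by (simp add: \<sigma>'_def)
    show "\<sigma>' v (\<sigma>' v z) = z" if "z \<in> Z" for v z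
      using kS[OF that] \<sigma>(2,3) kh hk2[OF that] by (simp add: \<sigma>'_def)
    show "openin (top_of_set Z) (U' v)" "openin (top_of_set Z) (\<sigma>' v ` U' v)" for v
      unfolding img unfolding U'_def by (rule hopen, rule U)+
    show "U' v \<inter> \<sigma>' v ` U' v = {}" for v
      unfolding img unfolding U'_def using U(3)[of v] US \<sigma>US hinj by (metis image_empty inj_on_image_Int)
    show "\<sigma>' v z = z" if "z \<in> Z" "z \<notin> U' v" "z \<notin> \<sigma>' v ` U' v" for v z
    proof -
      have "k z \<notin> U v" "k z \<notin> \<sigma> v ` U v" using that hk2[of z] unfolding img unfolding U'_def by (metis imageI)+
      then show ?thesis using U(4) kS[OF that(1)] hk2[OF that(1)] by (simp add: \<sigma>'_def)
    qed
    show "\<sigma>' u ` U' v \<subseteq> U' v" if "E u v" for u v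
      unfolding img unfolding U'_def using comm[OF that] by blast
    show "\<sigma>' u (\<sigma>' v z) = \<sigma>' v (\<sigma>' u z)" if "E u v" "z \<in> Z" for u v z
      using commute[OF that(1) kS[OF that(2)]] kS[OF that(2)] \<sigma>(2) kh by (simp add: \<sigma>'_def)
    show "\<sigma>' v z \<noteq> z" if "E u v" "z \<in> Z" "\<sigma>' u z = z" for u v z
    proof
      assume "\<sigma>' v z = z"
      then have "k (h (\<sigma> v (k z))) = k z" "k (h (\<sigma> u (k z))) = k z" using that(3) by (simp_all add: \<sigma>'_def)
      then have "\<sigma> v (k z) = k z" "\<sigma> u (k z) = k z" using kh \<sigma>(2) kS[OF that(2)] by auto
      then show False using fixd[OF that(1) kS[OF that(2)]] by blast
    qed
    show "U' u \<inter> U' v = {}" if "u \<noteq> v" "\<not> E u v" for u v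
      unfolding U'_def using Ud[OF that] US hinj by (metis image_empty inj_on_image_Int)
  qed (fact sym irr tf nb)+
qed

section \<open>The visual boundary of a proper CAT(0) space\<close>

text \<open>The point \<open>b\<close> is put on the real axis; the first coordinate
  \<open>u\<close> of \<open>c\<close> comes from the law of cosines, and the triangle inequalities
  give \<open>\<bar>u\<bar> \<le> d2\<close>, so that the second coordinate exists.\<close>

lemma comparison_triangle:
  fixes d1 d2 d3 :: real
  assumes "0 \<le> d1" "0 \<le> d2" "0 \<le> d3" "d1 \<le> d2 + d3" "d2 \<le> d1 + d3" "d3 \<le> d1 + d2"
  obtains b c :: complex where "cmod b = d1" "cmod c = d2" "dist b c = d3"
proof (cases "d1 = 0")
  case True
  then have "d2 = d3" using assms by simp
  then show ?thesis using that[of 0 "of_real d2"] True assms by (simp add: dist_norm)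
next
  case False
  define u where "u = (d1\<^sup>2 + d2\<^sup>2 - d3\<^sup>2) / (2 * d1)"
  have "(d1 - d2)\<^sup>2 \<le> d3\<^sup>2" using assms by (intro abs_le_square_iff[THEN iffD1]) auto
  moreover have "d3\<^sup>2 \<le> (d1 + d2)\<^sup>2" using assms by (intro power_mono) auto
  ultimately have "\<bar>d1\<^sup>2 + d2\<^sup>2 - d3\<^sup>2\<bar> \<le> d2 * (2 * d1)" by (simp add: power2_eq_square algebra_simps abs_le_iff)
  then have "\<bar>u\<bar> \<le> d2" using False assms(1) by (simp add: u_def abs_divide divide_le_eq)
  then have u: "u\<^sup>2 \<le> d2\<^sup>2" using assms(2) by (simp add: abs_le_square_iff[symmetric])
  define w where "w = sqrt (d2\<^sup>2 - u\<^sup>2)"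
  have w: "w\<^sup>2 = d2\<^sup>2 - u\<^sup>2" using u by (simp add: w_def)
  have ud: "2 * (u * d1) = d1\<^sup>2 + d2\<^sup>2 - d3\<^sup>2" using False by (simp add: u_def)
  show ?thesis
  proof (rule that[of "of_real d1" "Complex u w"])
    show "cmod (of_real d1) = d1" using assms by simp
    show "cmod (Complex u w) = d2" using w assms(2) by (simp add: cmod_def)
    have "(d1 - u)\<^sup>2 + w\<^sup>2 = d3\<^sup>2" using w ud by (simp add: power2_eq_square algebra_simps)
    then have "cmod (Complex (d1 - u) (- w)) = d3" using assms(3) by (simp add: cmod_def)
    moreover have "of_real d1 - Complex u w = Complex (d1 - u) (- w)" by (simp add: complex_eq_iff)
    ultimately show "dist (of_real d1) (Complex u w) = d3" by (simp add: dist_norm)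
  qed
qed

locale proper_cat0 =
  fixes x0 :: "'x::metric_space"
  assumes proper: "proper_space TYPE('x)" and cat0: "CAT0 TYPE('x)"
begin

section \<open>Convexity of the metric\<close>

lemma geodesic_exists: "\<exists>c. geodesic_seg c (x :: 'x) y"
  using cat0 unfolding CAT0_def by blast

lemma geodesics_converge:
  assumes c1: "geodesic_seg c1 (x :: 'x) y" and c2: "geodesic_seg c2 x z" and l: "0 \<le> l" "l \<le> 1"
  shows "dist (c1 (l * dist x y)) (c2 (l * dist x z)) \<le> l * dist y z"
proof -
  obtain b c :: complex where bc: "cmod b = dist x y" "cmod c = dist x z" "dist b c = dist y z"
    by (rule comparison_triangle[of "dist x y" "dist x z" "dist y z"])
      (auto simp: dist_triangle dist_triangle2 dist_triangle3 dist_commute)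
  have "l * dist x y \<in> {0..dist x y}" "l * dist x z \<in> {0..dist x z}"
    using l by (auto simp: mult_left_le_one_le)
  moreover have "dist 0 b = dist x y" "dist 0 c = dist x z" using bc by simp_all
  ultimately have "dist (c1 (l * dist x y)) (c2 (l * dist x z)) \<le> 
     dist (0 + of_real (l * dist x y / dist x y) * (b - 0)) (0 + of_real (l * dist x z / dist x z) * (c - 0))"
    using cat0[unfolded CAT0_def, THEN conjunct2, rule_format, OF c1 c2 _ _ bc(3)] by blast
  \<comment> \<open>For a degenerate side the quotient is 0 instead of \<open>l\<close>, which is
    harmless because the corresponding comparison vector is 0 too.\<close>
  also have "\<dots> = dist (of_real l * b) (of_real l * c)"
    using bc by (cases "x = y"; cases "x = z") auto
  also have "\<dots> = l * dist b c" using l by (simp add: dist_norm norm_mult flip: right_diff_distrib)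
  finally show ?thesis using bc by simp
qed

text \<open>Comparison at equal arc length instead of equal proportion. The shift in time costs, by
  the triangle inequality, as much as the estimate itself: hence the factor 2.\<close>

lemma geodesics_converge_same_time:
  assumes c1: "geodesic_seg c1 (x :: 'x) y" and c2: "geodesic_seg c2 x z" and s: "0 \<le> s" "s \<le> dist x y" "s \<le> dist x z" "0 < dist x z"
  shows "dist (c1 s) (c2 s) \<le> 2 * (s / dist x z) * dist y z"
proof -
  define l where "l = s / dist x z"
  have l: "0 \<le> l" "l \<le> 1" "l * dist x z = s" using s by (simp_all add: l_def)
  have "dist (c1 s) (c1 (l * dist x y)) = \<bar>s - l * dist x y\<bar>"
    using c1 s l unfolding geodesic_seg_def by (auto simp: mult_left_le_one_le)
  also have "\<dots> = l * \<bar>dist x z - dist x y\<bar>" using l by (simp add: abs_mult flip: l(3) right_diff_distrib)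
  also have "\<dots> \<le> l * dist y z" 
    using l(1) by (intro mult_left_mono) (auto simp: abs_le_iff algebra_simps dist_triangle dist_triangle2 dist_triangle3 dist_commute)
  finally have "dist (c1 s) (c1 (l * dist x y)) \<le> l * dist y z" .
  moreover have "dist (c1 (l * dist x y)) (c2 s) \<le> l * dist y z" using geodesics_converge[OF c1 c2 l(1,2)] l(3) by simp
  ultimately have "dist (c1 s) (c2 s) \<le> l * dist y z + l * dist y z"
    using dist_triangle[of "c1 s" "c2 s" "c1 (l * dist x y)"] by linarith
  then show ?thesis unfolding l_def by simp
qed

lemma geodesic_reverse: "geodesic_seg c (x :: 'x) y \<Longrightarrow> geodesic_seg (\<lambda>t. c (dist x y - t)) y x"
  unfolding geodesic_seg_def by (auto simp: dist_commute)

lemma geodesic_isometry: "geodesic_seg c (x :: 'x) y \<Longrightarrow> isometry f \<Longrightarrow> geodesic_seg (f \<circ> c) (f x) (f (y :: 'x))"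
  unfolding geodesic_seg_def isometry_def by auto

text \<open>The diagonal \<open>e\<close> from \<open>x\<close> to \<open>y'\<close> splits the
  quadrilateral into two triangles sharing corners with both geodesics. The two estimates add up to
  a convex combination of the distances between the ends.\<close>

lemma geodesics_quasiconvex:
  assumes c1: "geodesic_seg c1 (x :: 'x) y" and c2: "geodesic_seg c2 x' y'" and d: "dist x y = t" "dist x' y' = t" and s: "0 \<le> s" "s \<le> t"
  shows "dist (c1 s) (c2 s) \<le> max (dist x x') (dist y y')"
proof (cases "t = 0")
  case True
  then show ?thesis using s c1 c2 d unfolding geodesic_seg_def by auto
next
  case False
  then have t: "0 < t" using s by linarith
  define l where "l = s / t"
  have l: "0 \<le> l" "l \<le> 1" "l * t = s" "(1 - l) * t = t - s" using s t by (auto simp: l_def field_simps)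
  obtain e where e: "geodesic_seg e x y'" using geodesic_exists by blast
  have 1: "dist (c1 s) (e (l * dist x y')) \<le> l * dist y y'"
    using geodesics_converge[OF c1 e l(1,2)] d l(3) by simp
  have "dist (c2 (t - (1 - l) * t)) (e (dist x y' - (1 - l) * dist y' x)) \<le> (1 - l) * dist x' x"
    using geodesics_converge[OF geodesic_reverse[OF c2] geodesic_reverse[OF e], of "1 - l"] l(1,2) d 
    by (simp add: dist_commute)
  moreover have "t - (1 - l) * t = s" "dist x y' - (1 - l) * dist y' x = l * dist x y'" using l by (auto simp: algebra_simps dist_commute)
  ultimately have 2: "dist (c2 s) (e (l * dist x y')) \<le> (1 - l) * dist x x'" by (simp add: dist_commute)
  have "dist (c1 s) (c2 s) \<le> l * dist y y' + (1 - l) * dist x x'" 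
    using 1 2 dist_triangle2[of "c1 s" "c2 s" "e (l * dist x y')"] by simp
  also have "\<dots> \<le> l * max (dist x x') (dist y y') + (1 - l) * max (dist x x') (dist y y')"
    using l by (intro add_mono mult_left_mono) auto
  finally show ?thesis by (simp add: algebra_simps)
qed

section \<open>Rays from the base point and the cone topology\<close>

abbreviation "rays \<equiv> geodesic_rays_from x0"

lemma ray_dist: "c \<in> rays \<Longrightarrow> 0 \<le> s \<Longrightarrow> 0 \<le> t \<Longrightarrow> dist (c s) (c t) = \<bar>s - t\<bar>"
  and ray_0: "c \<in> rays \<Longrightarrow> c 0 = x0" and ray_neg: "c \<in> rays \<Longrightarrow> t < 0 \<Longrightarrow> c t = x0"
  by (auto simp: geodesic_rays_from_def)

lemma ray_dist0: "c \<in> rays \<Longrightarrow> 0 \<le> t \<Longrightarrow> dist x0 (c t) = t"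
  using ray_dist[of c 0 t] ray_0[of c] by simp

lemma ray_geodesic: "c \<in> rays \<Longrightarrow> 0 \<le> t \<Longrightarrow> geodesic_seg c x0 (c t)"
  unfolding geodesic_seg_def by (auto simp: ray_dist0 ray_0 ray_dist)

lemma rays_converge:
  assumes "c \<in> rays" "c' \<in> rays" "0 \<le> s" "s \<le> t" "0 < t"
  shows "dist (c s) (c' s) \<le> s / t * dist (c t) (c' t)"
  using geodesics_converge[OF ray_geodesic[OF assms(1), of t] ray_geodesic[OF assms(2), of t], of "s / t"] assms
  by (simp add: ray_dist0)

text \<open>The distance at time s is at most s/t times the distance at time t, thus at most
  \<open>s * B / t\<close>, which tends to 0.\<close>

lemma rays_eqI:
  assumes c: "c \<in> rays" "c' \<in> rays" and B: "\<And>t. 0 \<le> t \<Longrightarrow> dist (c t) (c' t) \<le> B"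
  shows "c = c'"
proof
  fix s show "c s = c' s"
  proof (cases "s < 0")
    case True then show ?thesis using c ray_neg by metis
  next
    case False
    have "dist (c s) (c' s) \<le> e" if e: "0 < e" for e
    proof -
      have "0 \<le> B" using B[of 0] order_trans[OF zero_le_dist] by blast
      define t where "t = max (s + 1) (s * B / e)"
      have t: "s \<le> t" "0 < t" "s * B / e \<le> t" using False by (auto simp: t_def)
      have "dist (c s) (c' s) \<le> s / t * dist (c t) (c' t)" using rays_converge c False t by auto
      also have "\<dots> \<le> s / t * B" using B[of t] t False by (intro mult_left_mono) auto
      also have "\<dots> \<le> e" using t e by (simp add: field_simps)
      finally show ?thesis .
    qed
    then have "dist (c s) (c' s) \<le> 0" by (rule field_le_epsilon[of _ 0, simplified])
    then show ?thesis by simp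
  qed
qed

lemma continuous_on_eval: "continuous_on A (\<lambda>f :: real \<Rightarrow> 'x. f t)"
  by (rule continuous_on_subset[OF continuous_on_product_coordinates]) simp

text \<open>The cone topology is the topology of pointwise convergence inherited from the product of
  copies of X. Basic open sets restrict finitely many times, and at times up to 0 all rays agree, so
  only positive times impose a condition.\<close>

lemma visual_boundary_eq: "visual_boundary x0 = top_of_set rays"
proof (rule topology_eq[THEN iffD2], intro allI)
  let ?B = "{{c' \<in> rays. dist (c' r) (c r) < \<epsilon>} | c r \<epsilon>. c \<in> rays \<and> r > 0 \<and> \<epsilon> > 0}"
  fix W
  show "openin (visual_boundary x0) W \<longleftrightarrow> openin (top_of_set rays) W"
  proof
    assume "openin (visual_boundary x0) W"
    then have g: "generate_topology_on ?B W" unfolding visual_boundary_def openin_topology_generated_by_iff .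
    show "openin (top_of_set rays) W"
    proof (rule generate_topology_on_coarsest[OF _ _ g])
      show "istopology (openin (top_of_set rays))" by simp
      fix s assume "s \<in> ?B"
      then obtain c r e where s: "s = {c' \<in> rays. dist (c' r) (c r) < e}" by blast
      have "open {c' :: real \<Rightarrow> 'x. dist (c' r) (c r) < e}"
        by (intro open_Collect_less continuous_intros continuous_on_eval)
      then have "openin (top_of_set rays) (rays \<inter> {c'. dist (c' r) (c r) < e})" by (rule openin_open_Int)
      moreover have "s = rays \<inter> {c'. dist (c' r) (c r) < e}" unfolding s by blast
      ultimately show "openin (top_of_set rays) s" by simp
    qed
  next
    assume "openin (top_of_set rays) W"
    then obtain G where G: "open G" "W = rays \<inter> G" unfolding openin_open by blast
    show "openin (visual_boundary x0) W"
    proof (subst openin_subopen, intro ballI)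
      fix c assume c: "c \<in> W"
      have "openin (product_topology (\<lambda>_. euclidean) UNIV) G" using G(1) by (simp add: open_fun_def)
      then obtain X where X: "c \<in> PiE UNIV X" "\<And>i. open (X i)" "finite {i. X i \<noteq> UNIV}" "PiE UNIV X \<subseteq> G"
        using product_topology_open_contains_basis[of "\<lambda>_. euclidean" UNIV G c] c G(2) by auto
      define F where "F = {i. X i \<noteq> UNIV} \<inter> {0<..}"
      have "\<exists>e>0. ball (c i) e \<subseteq> X i" for i using X(1,2) by (meson PiE_mem UNIV_I openE)
      then obtain e where e: "\<And>i. 0 < e i" "\<And>i. ball (c i) (e i) \<subseteq> X i" by metis
      have cR: "c \<in> rays" using c G(2) by blast
      \<comment> \<open>The extra set keeps the intersection inside \<open>rays\<close>, and the
        family non-empty, when \<open>F\<close> is empty.\<close>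
      define N where "N = \<Inter> (insert {c' \<in> rays. dist (c' 1) (c 1) < 1} ((\<lambda>i. {c' \<in> rays. dist (c' i) (c i) < e i}) ` F))"
      have "openin (visual_boundary x0) {c' \<in> rays. dist (c' i) (c i) < d}" if "0 < i" "0 < d" for i d
        unfolding visual_boundary_def by (rule topology_generated_by_Basis) (use that cR in blast)
      then have "openin (visual_boundary x0) N" unfolding N_def
        using X(3) e(1) by (intro openin_Inter) (auto simp: F_def)
      moreover have "c \<in> N" using cR e(1) by (auto simp: N_def)
      moreover have "N \<subseteq> W"
      proof
        fix c' assume c': "c' \<in> N"
        then have R: "c' \<in> rays" by (auto simp: N_def)
        have "c' i \<in> X i" for i
        proof (cases "i \<in> F")
          case True
          then have "dist (c' i) (c i) < e i" using c' by (auto simp: N_def)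
          then show ?thesis using e(2)[of i] by (auto simp: dist_commute)
        next
          case False
          show ?thesis
          proof (cases "X i = UNIV")
            case False
            then have "i \<le> 0" using \<open>i \<notin> F\<close> by (auto simp: F_def)
            then have "c' i = c i" using R cR ray_0 ray_neg by (cases "i = 0") (metis less_eq_real_def)+
            then show ?thesis using X(1) by (auto simp: PiE_iff)
          qed simp
        qed
        then have "c' \<in> G" using X(4) by (auto simp: PiE_iff)
        then show "c' \<in> W" using R G(2) by blast
      qed
      ultimately show "\<exists>T. openin (visual_boundary x0) T \<and> c \<in> T \<and> T \<subseteq> W" by blast
    qed
  qed
qed

text \<open>A product of balls, compact by Tychonoff's theorem and properness. It contains all rays
  and all geodesics \<open>geo x\<close>, and supplies their limits.\<close>

definition box :: "(real \<Rightarrow> 'x) set" where "box = PiE UNIV (\<lambda>t. cball x0 \<bar>t\<bar>)"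

lemma compact_box: "compact box"
proof -
  have "compactin (product_topology (\<lambda>_::real. euclidean) UNIV) box"
    unfolding box_def compactin_PiE using proper by (auto simp: proper_space_def)
  then show ?thesis by (simp add: euclidean_product_topology)
qed

lemma rays_box: "rays \<subseteq> box"
proof
  fix c assume c: "c \<in> rays"
  have "dist x0 (c t) \<le> \<bar>t\<bar>" for t
    using ray_dist0[OF c, of t] ray_neg[OF c, of t] by (cases "0 \<le> t") auto
  then show "c \<in> box" by (auto simp: box_def PiE_iff)
qed

lemma closed_rays: "closed rays"
proof -
  have "rays = {c. c 0 = x0} \<inter> (\<Inter>t\<in>{..<0}. {c. c t = x0}) \<inter> (\<Inter>s\<in>{0..}. \<Inter>t\<in>{0..}. {c. dist (c s) (c t) = \<bar>s - t\<bar>})"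
    by (auto simp: geodesic_rays_from_def)
  also have "closed \<dots>"
    by (intro closed_Int closed_INT ballI closed_Collect_eq continuous_intros continuous_on_eval)
  finally show ?thesis .
qed

lemma compact_rays: "compact rays"
  using compact_Int_closed[OF compact_box closed_rays] rays_box by (simp add: Int_absorb1)

text \<open>A geodesic prolonged by constants on both sides, so that it is a total function lying in
  \<open>box\<close>.\<close>

definition geo :: "'x \<Rightarrow> real \<Rightarrow> 'x" where
  "geo x t = (if t < 0 then x0 else if t \<le> dist x0 x then (SOME c. geodesic_seg c x0 x) t else x)"

lemma geo_geodesic: "geodesic_seg (geo x) x0 x"
proof -
  define c where "c = (SOME c. geodesic_seg c x0 x)"
  have "geodesic_seg c x0 x" unfolding c_def using geodesic_exists by (rule someI_ex)
  moreover have "geo x t = (if t < 0 then x0 else if t \<le> dist x0 x then c t else x)" for t by (simp add: geo_def c_def)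
  ultimately show ?thesis unfolding geodesic_seg_def by auto
qed

lemma geo_dist: "0 \<le> s \<Longrightarrow> 0 \<le> t \<Longrightarrow> s \<le> dist x0 x \<Longrightarrow> t \<le> dist x0 x \<Longrightarrow> dist (geo x s) (geo x t) = \<bar>s - t\<bar>"
  using geo_geodesic[of x] by (auto simp: geodesic_seg_def)

lemma geo_0: "geo x 0 = x0" using geo_geodesic[of x] by (simp add: geodesic_seg_def)

lemma geo_box: "geo x \<in> box"
proof -
  have "dist x0 (geo x t) \<le> \<bar>t\<bar>" for t
  proof -
    consider "t < 0" | "0 \<le> t" "t \<le> dist x0 x" | "dist x0 x < t" "0 \<le> t" by linarith
    then show ?thesis
    proof cases
      case 2 then show ?thesis using geo_dist[of 0 t x] geo_0[of x] by simp
    qed (auto simp: geo_def)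
  qed
  then show ?thesis by (auto simp: box_def PiE_iff)
qed

text \<open>The limit is a cluster point in the product topology, so closeness is obtained for
  arbitrarily late indices rather than along a subsequence. Two times are controlled at once in
  \<open>cl\<close>, since being a ray is a condition on pairs of times.\<close>

lemma ray_cluster:
  assumes x: "\<And>n. real n \<le> dist x0 (x n)"
  obtains c where "c \<in> rays" "\<And>t e N. 0 < e \<Longrightarrow> \<exists>n\<ge>N. dist (geo (x n) t) (c t) < e"
proof -
  let ?F = "filtermap (\<lambda>n. geo (x n)) sequentially"
  have "?F \<noteq> bot" by (simp add: filtermap_bot_iff)
  moreover have "eventually (\<lambda>f. f \<in> box) ?F" by (simp add: eventually_filtermap geo_box)
  ultimately obtain c where c: "c \<in> box" "inf (nhds c) ?F \<noteq> bot" using compact_box unfolding compact_filter by blast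
  have cl: "\<exists>n\<ge>N. dist (geo (x n) s) (c s) < e \<and> dist (geo (x n) t) (c t) < e" if e: "0 < e" for s t e N
  proof (rule ccontr)
    assume neg: "\<not> ?thesis"
    let ?O = "{f. dist (f s) (c s) < e} \<inter> {f. dist (f t) (c t) < e}"
    have "open ?O" by (intro open_Int open_Collect_less continuous_intros continuous_on_eval)
    then have "eventually (\<lambda>f. f \<in> ?O) (nhds c)" using e by (intro eventually_nhds_in_open) auto
    moreover have "eventually (\<lambda>f. f \<notin> ?O) ?F" unfolding eventually_filtermap eventually_sequentially using neg by auto
    ultimately have "eventually (\<lambda>f. False) (inf (nhds c) ?F)" unfolding eventually_inf by blast
    then show False using c(2) trivial_limit_def by blast
  qed
  have "c \<in> rays"
    unfolding geodesic_rays_from_def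
  proof (intro CollectI conjI allI impI)
    have z: "c t = x0" if t: "t \<le> 0" for t
    proof -
      have "dist x0 (c t) < e" if "0 < e" for e using cl[OF that, of 0 t t] t geo_0 by (cases "t = 0") (auto simp: geo_def)
      then have "dist x0 (c t) \<le> 0" by (metis dense_ge less_imp_le)
      then show ?thesis by simp
    qed
    show "c 0 = x0" by (rule z) simp
    show "c t = x0" if "t < 0" for t using z that by simp
    fix s t :: real assume st: "0 \<le> s" "0 \<le> t"
    have "\<bar>dist (c s) (c t) - \<bar>s - t\<bar>\<bar> \<le> e" if e: "0 < e" for e
    proof -
      obtain N :: nat where N: "max s t \<le> real N" using real_arch_simple by blast
      obtain n where n: "n \<ge> N" "dist (geo (x n) s) (c s) < e/2" "dist (geo (x n) t) (c t) < e/2"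
        using cl[of "e/2" N s t] e by auto
      have "s \<le> dist x0 (x n)" "t \<le> dist x0 (x n)" using N n(1) x[of n] by linarith+
      then have "dist (geo (x n) s) (geo (x n) t) = \<bar>s - t\<bar>" using geo_dist st by blast
      then show ?thesis using n(2,3) dist_triangle[of "c s" "c t" "geo (x n) s"] dist_triangle[of "geo (x n) s" "c t" "geo (x n) t"]
          dist_triangle[of "geo (x n) s" "geo (x n) t" "c s"] dist_triangle[of "c s" "geo (x n) t" "c t"]
        unfolding abs_le_iff by (simp add: dist_commute)
    qed
    then have "\<bar>dist (c s) (c t) - \<bar>s - t\<bar>\<bar> \<le> 0" by (metis dense_ge)
    then show "dist (c s) (c t) = \<bar>s - t\<bar>" by simp
  qed
  then show ?thesis using that cl by blast
qed

text \<open>The geodesics from \<open>x0\<close> and from \<open>f x0\<close> to a far point of the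
  image ray share that end, so at equal proportions they are at most \<open>?K\<close> apart.
  Passing to equal times costs another \<open>?K\<close>, and the bound survives in the
  limit.\<close>

lemma asymptotic_ray_exists:
  assumes f: "isometry f" and c: "c \<in> rays"
  shows "\<exists>e\<in>rays. \<forall>t\<ge>0. dist (e t) (f (c t)) \<le> 2 * dist (f x0) x0"
proof -
  let ?K = "dist (f x0) x0"
  \<comment> \<open>The shift by \<open>?K\<close> compensates the displacement of the base point
    and yields \<open>real n \<le> dist x0 (x n)\<close>.\<close>
  define x where "x n = f (c (real n + ?K))" for n
  have fd: "dist (f a) (f b) = dist a b" for a b using f by (simp add: isometry_def)
  have dx: "dist (f x0) (x n) = real n + ?K" for n unfolding x_def fd using ray_dist0[OF c] by simp
  have x: "real n \<le> dist x0 (x n)" for n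
    using dx[of n] dist_triangle[of "f x0" "x n" x0] by simp
  obtain e where e: "e \<in> rays" "\<And>t d N. 0 < d \<Longrightarrow> \<exists>n\<ge>N. dist (geo (x n) t) (e t) < d" using ray_cluster[OF x] by blast
  have "dist (e t) (f (c t)) \<le> 2 * ?K" if t: "0 \<le> t" for t
  proof (rule field_le_epsilon)
    fix d :: real assume d: "0 < d"
    obtain N :: nat where N: "t + 1 \<le> real N" using real_arch_simple by blast
    obtain n where n: "n \<ge> N" "dist (geo (x n) t) (e t) < d" using e(2)[OF d] by blast
    have tn: "t + 1 \<le> real n" using N n(1) by linarith
    define s where "s = real n + ?K"
    define D where "D = dist x0 (x n)"
    have s: "0 < s" "t \<le> s" "0 \<le> s" "t \<le> D" "0 \<le> D" using tn t x[of n] zero_le_dist[of "f x0" x0] unfolding s_def D_def by linarith+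
    define m where "m = t / s"
    have m: "0 \<le> m" "m \<le> 1" "m * s = t" using s t by (auto simp: m_def)
    have g2: "geodesic_seg (f \<circ> c) (f x0) (x n)" unfolding x_def
      by (rule geodesic_isometry[OF ray_geodesic[OF c] f]) (use s s_def in auto)
    have ds: "dist (f x0) (x n) = s" using dx by (simp add: s_def)
    have "dist (geo (x n) (D - (1 - m) * D)) ((f \<circ> c) (s - (1 - m) * s)) \<le> (1 - m) * dist x0 (f x0)"
      using geodesics_converge[OF geodesic_reverse[OF geo_geodesic[of "x n"]] geodesic_reverse[OF g2], of "1 - m"] m ds 
      by (simp add: D_def dist_commute)
    moreover have "D - (1 - m) * D = m * D" "s - (1 - m) * s = t" using m(3) by (auto simp: algebra_simps)
    ultimately have 1: "dist (geo (x n) (m * D)) (f (c t)) \<le> (1 - m) * ?K" by (simp add: dist_commute)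
    have "(1 - m) * ?K \<le> ?K" using m by (intro mult_left_le_one_le) auto
    moreover have "dist (geo (x n) t) (geo (x n) (m * D)) \<le> ?K"
    proof -
      have "dist (geo (x n) t) (geo (x n) (m * D)) = \<bar>t - m * D\<bar>"
        using geo_dist[of t "m * D" "x n"] t s m by (auto simp: D_def mult_left_le_one_le)
      also have "\<dots> = m * \<bar>s - D\<bar>" using m by (simp add: abs_mult flip: m(3) right_diff_distrib)
      also have "\<dots> \<le> 1 * \<bar>s - D\<bar>" using m by (intro mult_right_mono) auto
      also have "\<dots> \<le> ?K" using ds dist_triangle[of "f x0" "x n" x0] dist_triangle[of x0 "x n" "f x0"] 
        by (auto simp: D_def abs_le_iff dist_commute)
      finally show ?thesis .
    qed
    ultimately have "dist (geo (x n) t) (f (c t)) \<le> 2 * ?K" 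
      using 1 dist_triangle[of "geo (x n) t" "f (c t)" "geo (x n) (m * D)"] by linarith
    then show "dist (e t) (f (c t)) \<le> 2 * ?K + d"
      using n(2) dist_triangle[of "e t" "f (c t)" "geo (x n) t"] by (simp add: dist_commute)
  qed
  then show ?thesis using e(1) by blast
qed

text \<open>The extension of an isometry to the boundary: the ray from \<open>x0\<close> asymptotic
  to the image ray. By \<open>rays_eqI\<close> the choice is unique, and any uniform bound
  identifies it.\<close>

definition bdry :: "('x \<Rightarrow> 'x) \<Rightarrow> (real \<Rightarrow> 'x) \<Rightarrow> (real \<Rightarrow> 'x)" where
  "bdry f c = (SOME e. e \<in> rays \<and> (\<forall>t\<ge>0. dist (e t) (f (c t)) \<le> 2 * dist (f x0) x0))"

lemma bdry:
  assumes "isometry f" "c \<in> rays"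
  shows "bdry f c \<in> rays" "0 \<le> t \<Longrightarrow> dist (bdry f c t) (f (c t)) \<le> 2 * dist (f x0) x0"
  using someI_ex[of "\<lambda>e. e \<in> rays \<and> (\<forall>t\<ge>0. dist (e t) (f (c t)) \<le> 2 * dist (f x0) x0)"] asymptotic_ray_exists[OF assms]
  unfolding bdry_def by blast+

lemma bdry_eqI:
  assumes "isometry f" "c \<in> rays" "e \<in> rays" "\<And>t. 0 \<le> t \<Longrightarrow> dist (e t) (f (c t)) \<le> B"
  shows "bdry f c = e"
proof (rule rays_eqI[OF bdry(1)[OF assms(1,2)] assms(3)])
  fix t :: real assume t: "0 \<le> t"
  show "dist (bdry f c t) (e t) \<le> 2 * dist (f x0) x0 + B"
    using bdry(2)[OF assms(1,2) t] assms(4)[OF t] dist_triangle2[of "bdry f c t" "e t" "f (c t)"] by linarith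
qed

lemma bdry_comp:
  assumes "isometry f" "isometry h" "c \<in> rays"
  shows "bdry f (bdry h c) = bdry (f \<circ> h) c"
proof (rule sym, rule bdry_eqI)
  show "isometry (f \<circ> h)" using assms(1,2) unfolding isometry_def by (auto intro: bij_comp)
  show "bdry f (bdry h c) \<in> rays" using bdry(1) assms by blast
  fix t :: real assume t: "0 \<le> t"
  have "dist (f (bdry h c t)) (f (h (c t))) \<le> 2 * dist (h x0) x0"
    using bdry(2)[OF assms(2,3) t] assms(1) by (simp add: isometry_def)
  then show "dist (bdry f (bdry h c) t) ((f \<circ> h) (c t)) \<le> 2 * dist (f x0) x0 + 2 * dist (h x0) x0"
    using bdry(2)[OF assms(1) bdry(1)[OF assms(2,3)] t] dist_triangle[of "bdry f (bdry h c) t" "f (h (c t))" "f (bdry h c t)"]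
    by simp
qed (rule assms(3))

lemma bdry_id: "c \<in> rays \<Longrightarrow> bdry id c = c"
  by (rule bdry_eqI[where B = 0]) (auto simp: isometry_def)

lemma continuous_on_bdry:
  assumes f: "isometry f" shows "continuous_on rays (bdry f)"
proof (rule continuous_on_coordinatewise_then_product)
  let ?K = "dist (f x0) x0"
  fix s :: real
  show "continuous_on rays (\<lambda>c. bdry f c s)"
    unfolding continuous_on_def
  proof (intro ballI tendstoI)
    fix c and d :: real assume c: "c \<in> rays" and d: "0 < d"
    show "eventually (\<lambda>c'. dist (bdry f c' s) (bdry f c s) < d) (at c within rays)"
    proof (cases "s < 0")
      case True
      then have "dist (bdry f c' s) (bdry f c s) < d" if "c' \<in> rays" for c'
        using ray_neg[OF bdry(1)[OF f c]] ray_neg[OF bdry(1)[OF f that]] d by simp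
      then show ?thesis by (auto simp: eventually_at_topological intro: exI[of _ UNIV])
    next
      case False
      \<comment> \<open>If two rays are less than 1 apart at time \<open>t\<close>, their images
        under \<open>bdry f\<close> are at most \<open>4 * ?K + 1\<close> apart there,
        \<open>2 * ?K\<close> for each. The time \<open>t\<close> is chosen so late that contraction
        to time \<open>s\<close> leaves less than \<open>d\<close>.\<close>
      define B where "B = 4 * ?K + 1"
      define t where "t = max (s + 1) (s * B / d + 1)"
      have B: "0 < B" by (simp add: B_def add_nonneg_pos)
      have t: "s \<le> t" "0 < t" "s * B / d < t" using False by (auto simp: t_def)
      have "open {c' :: real \<Rightarrow> 'x. dist (c' t) (c t) < 1}" by (intro open_Collect_less continuous_intros continuous_on_eval)
      moreover have "dist (bdry f c' s) (bdry f c s) < d" if c': "c' \<in> rays" "dist (c' t) (c t) < 1" for c'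
      proof -
        have "dist (f (c' t)) (f (c t)) < 1" using c'(2) f by (simp add: isometry_def)
        moreover have "dist (bdry f c' t) (f (c' t)) \<le> 2 * ?K" "dist (bdry f c t) (f (c t)) \<le> 2 * ?K"
          using bdry(2)[OF f] c c' t by auto
        ultimately have "dist (bdry f c' t) (bdry f c t) \<le> B"
          using dist_triangle[of "bdry f c' t" "bdry f c t" "f (c' t)"] dist_triangle[of "f (c' t)" "bdry f c t" "f (c t)"]
          by (simp add: B_def dist_commute)
        then have "s / t * dist (bdry f c' t) (bdry f c t) \<le> s / t * B" using t False by (intro mult_left_mono) auto
        moreover have "dist (bdry f c' s) (bdry f c s) \<le> s / t * dist (bdry f c' t) (bdry f c t)"
          using rays_converge[OF bdry(1)[OF f c'(1)] bdry(1)[OF f c]] False t by auto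
        moreover have "s / t * B < d" using t d by (simp add: field_simps)
        ultimately show ?thesis by linarith
      qed
      ultimately show ?thesis
        by (auto simp: eventually_at_topological intro!: exI[of _ "{c'. dist (c' t) (c t) < 1}"])
    qed
  qed
qed

end

section \<open>Geometric actions of right-angled Coxeter groups\<close>

lemma word_act_Nil [simp]: "word_act g [] = id"
  and word_act_Cons: "word_act g (v # w) = g v \<circ> word_act g w"
  by (simp_all add: word_act_def)

lemma word_act_append: "word_act g (u @ w) = word_act g u \<circ> word_act g w"
  by (induction u) (simp_all add: word_act_Cons comp_assoc)

locale racg_action = racg E + proper_cat0 x0
  for E :: "'v::finite \<Rightarrow> 'v \<Rightarrow> bool" and x0 :: "'x::metric_space" +
  fixes g :: "'v \<Rightarrow> 'x \<Rightarrow> 'x"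
  assumes tf: "triangle_free E" and act: "geometric_racg_action E g"
begin

abbreviation "W \<equiv> word_act g"

lemma g_isometry: "isometry (g v)" and g_invol: "g v \<circ> g v = id" and g_commute: "E u v \<Longrightarrow> g u \<circ> g v = g v \<circ> g u"
  using act unfolding geometric_racg_action_def by blast+

lemma g_dist: "dist (g v x) (g v y) = dist x y"
  using g_isometry by (simp add: isometry_def)

lemma g_g: "g v (g v x) = x" using g_invol[of v] by (metis comp_apply id_apply)

lemma W_dist: "dist (W w x) (W w y) = dist x y"
  by (induction w) (simp_all add: word_act_Cons g_dist)

lemma g_commute_apply: "E u v \<Longrightarrow> g u (g v x) = g v (g u x)"
  using g_commute[of u v] by (metis comp_apply)

lemma W_step: "racg_step E w w' \<Longrightarrow> W w = W w'"
proof (induction rule: racg_step.induct)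
  case (cancel xs s ys)
  then show ?case by (simp add: word_act_append word_act_Cons fun_eq_iff g_g)
next
  case (commute s t xs ys)
  then show ?case by (simp add: word_act_append word_act_Cons fun_eq_iff g_commute_apply[of s t])
qed

lemma W_cong: "racg_equiv E w w' \<Longrightarrow> W w = W w'"
  unfolding racg_equiv_def by (induction rule: rtranclp_induct) (auto dest: W_step)

lemma W_rev: "W w (W (rev w) x) = x" "W (rev w) (W w x) = x"
  using W_cong[OF racg_equiv_inv_right[of w]] W_cong[OF racg_equiv_inv_left[of w]]
  by (simp_all add: word_act_append) (metis comp_apply id_apply)+

definition step_bound :: real where "step_bound = Max (range (\<lambda>v. dist (g v x0) x0))"

lemma step_bound: "dist (g v x0) x0 \<le> step_bound" by (simp add: step_bound_def)

lemma step_bound_nonneg: "0 \<le> step_bound" using step_bound order_trans zero_le_dist by blast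

lemma W_length: "dist (W w x0) x0 \<le> real (length w) * step_bound"
proof (induction w)
  case (Cons v w)
  have "dist (W (v # w) x0) x0 \<le> dist (g v (W w x0)) (g v x0) + dist (g v x0) x0"
    by (simp add: word_act_Cons dist_triangle)
  then show ?case using Cons step_bound[of v] by (simp add: g_dist algebra_simps)
qed simp

lemma finite_classes: "finite {racg_elem E w | w. dist (W w x0) x0 \<le> r}"
proof -
  have "compact (cball x0 r)" using proper by (simp add: proper_space_def)
  then have "finite {racg_elem E w | w. W w ` cball x0 r \<inter> cball x0 r \<noteq> {}}"
    using act unfolding geometric_racg_action_def by blast
  moreover have "{racg_elem E w | w. dist (W w x0) x0 \<le> r} \<subseteq> {racg_elem E w | w. W w ` cball x0 r \<inter> cball x0 r \<noteq> {}}"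
  proof clarify
    fix w assume d: "dist (W w x0) x0 \<le> r"
    then have "0 \<le> r" using order_trans zero_le_dist by blast
    then have "W w x0 \<in> W w ` cball x0 r \<inter> cball x0 r" using d by (auto simp: dist_commute)
    then show "\<exists>w'. racg_elem E w = racg_elem E w' \<and> W w' ` cball x0 r \<inter> cball x0 r \<noteq> {}" by blast
  qed
  ultimately show ?thesis by (rule rev_finite_subset)
qed

text \<open>Proper discontinuity leaves finitely many group elements that move \<open>x0\<close> by
  at most \<open>r\<close>. One word is chosen for each, and the longest gives
  \<open>L\<close>.\<close>

lemma short_representatives: "\<exists>L. \<forall>w. dist (W w x0) x0 \<le> r \<longrightarrow> (\<exists>w'. racg_equiv E w w' \<and> length w' \<le> L)"
proof -
  let ?C = "{racg_elem E w | w. dist (W w x0) x0 \<le> r}"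
  define rep :: "'v list set \<Rightarrow> 'v list" where "rep A = (SOME w'. w' \<in> A)" for A
  define L where "L = Max (insert 0 ((\<lambda>A. length (rep A)) ` ?C))"
  show ?thesis
  proof (intro exI[of _ L] allI impI)
    fix w assume d: "dist (W w x0) x0 \<le> r"
    have "w \<in> racg_elem E w" by (simp add: racg_elem_def)
    then have "rep (racg_elem E w) \<in> racg_elem E w" unfolding rep_def by (rule someI)
    moreover have "length (rep (racg_elem E w)) \<le> L"
      unfolding L_def using finite_classes[of r] d by (intro Max_ge) auto
    ultimately show "\<exists>w'. racg_equiv E w w' \<and> length w' \<le> L" unfolding racg_elem_def by blast
  qed
qed

lemma cobounded: "\<exists>D. \<forall>x. \<exists>w. dist (W w x0) x \<le> D"
proof -
  have "\<exists>K. compact K \<and> (\<Union>w. W w ` K) = UNIV"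
    using act unfolding geometric_racg_action_def by (elim conjE)
  then obtain K where K: "compact K" "(\<Union>w. W w ` K) = UNIV" by blast
  have "bounded K" using K(1) by (rule compact_imp_bounded)
  then obtain D where D: "\<forall>k\<in>K. dist x0 k \<le> D" unfolding bounded_any_center[of K x0] by blast
  show ?thesis
  proof (intro exI[of _ D] allI)
    fix x
    have "x \<in> (\<Union>w. W w ` K)" using K(2) by simp
    then obtain w k where "k \<in> K" "x = W w k" by blast
    then show "\<exists>w. dist (W w x0) x \<le> D" using D W_dist by metis
  qed
qed

definition cod :: real where "cod = (SOME D. \<forall>x. \<exists>w. dist (W w x0) x \<le> D)"
definition near :: "'x \<Rightarrow> 'v list" where "near x = (SOME w. dist (W w x0) x \<le> cod)"

lemma near: "dist (W (near x) x0) x \<le> cod"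
proof -
  have "\<forall>x. \<exists>w. dist (W w x0) x \<le> cod" unfolding cod_def using cobounded by (rule someI_ex)
  then have "\<exists>w. dist (W w x0) x \<le> cod" by blast
  then show ?thesis unfolding near_def by (rule someI_ex)
qed

lemma cod_nonneg: "0 \<le> cod" using near order_trans zero_le_dist by blast

text \<open>The two elements differ by a word of at most \<open>L\<close> letters. Where the side of
  \<open>v\<close> first changes along it, \<open>hs_snoc\<close> says that \<open>v\<close> acts
  like right multiplication by a generator, so it moves that orbit point by at most
  \<open>step_bound\<close>. Returning to \<open>w\<close> costs \<open>real L * step_bound\<close>
  twice.\<close>

lemma wall_crossing: "\<exists>M. \<forall>v w w'. dist (W w x0) (W w' x0) \<le> r \<and> hs v w \<noteq> hs v w' \<longrightarrow> dist (W (v # w) x0) (W w x0) \<le> M"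
proof -
  obtain L where L: "\<And>w. dist (W w x0) x0 \<le> r \<Longrightarrow> \<exists>w'. racg_equiv E w w' \<and> length w' \<le> L"
    using short_representatives by blast
  let ?m = step_bound
  show ?thesis
  proof (intro exI[of _ "2 * (real L * ?m) + ?m"] allI impI, elim conjE)
    fix v w w' assume d: "dist (W w x0) (W w' x0) \<le> r" and ne: "hs v w \<noteq> hs v w'"
    have "dist (W (rev w @ w') x0) x0 = dist (W (rev w) (W w' x0)) (W (rev w) (W w x0))"
      by (simp add: word_act_append W_rev)
    also have "\<dots> \<le> r" unfolding W_dist using d by (simp add: dist_commute)
    finally obtain u where u: "racg_equiv E (rev w @ w') u" "length u \<le> L" using L by blast
    have "racg_equiv E (w @ u) (w @ rev w @ w')" using racg_equiv_append racg_equiv_sym u(1) racg_equiv_refl by blast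
    also have "racg_equiv E (w @ rev w @ w') ([] @ w')"
      using racg_equiv_append[OF racg_equiv_inv_right[of w] racg_equiv_refl[of w']] by simp
    finally have "hs v (w @ u) \<noteq> hs v w" using ne hs_cong by simp
    then have "\<exists>u1 s u2. u = u1 @ s # u2 \<and> hs v (w @ u1) = hs v w \<and> hs v (w @ u1 @ [s]) \<noteq> hs v w"
    proof (induction u rule: rev_induct)
      case (snoc s u)
      show ?case
      proof (cases "hs v (w @ u) = hs v w")
        case True then show ?thesis using snoc by (intro exI[of _ u] exI[of _ s] exI[of _ "[]"]) simp
      next
        case False
        then obtain u1 t u2 where "u = u1 @ t # u2" "hs v (w @ u1) = hs v w" "hs v (w @ u1 @ [t]) \<noteq> hs v w" using snoc by blast
        then show ?thesis by (intro exI[of _ u1] exI[of _ t] exI[of _ "u2 @ [s]"]) simp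
      qed
    qed simp
    then obtain u1 s u2 where u1: "u = u1 @ s # u2" "hs v ((w @ u1) @ [s]) \<noteq> hs v (w @ u1)" by auto
    let ?p = "w @ u1"
    have "W (v # ?p) = W (?p @ [s])" by (rule W_cong[OF hs_snoc[OF u1(2)]])
    then have "W (v # ?p) x0 = W ?p (g s x0)" by (simp only: word_act_append) (simp add: word_act_Cons)
    then have "dist (W (v # ?p) x0) (W ?p x0) = dist (W ?p (g s x0)) (W ?p x0)" by simp
    also have "\<dots> \<le> ?m" unfolding W_dist by (rule step_bound)
    finally have 1: "dist (W (v # ?p) x0) (W ?p x0) \<le> ?m" .
    have "dist (W ?p x0) (W w x0) = dist (W u1 x0) x0" by (simp add: word_act_append W_dist)
    also have "\<dots> \<le> real (length u1) * ?m" by (rule W_length)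
    also have "\<dots> \<le> real L * ?m" using u(2) u1(1) step_bound_nonneg by (intro mult_right_mono) auto
    finally have 2: "dist (W ?p x0) (W w x0) \<le> real L * ?m" .
    then have 3: "dist (W (v # w) x0) (W (v # ?p) x0) \<le> real L * ?m" by (simp add: word_act_Cons g_dist dist_commute)
    show "dist (W (v # w) x0) (W w x0) \<le> 2 * (real L * ?m) + ?m"
      using 1 2 3 dist_triangle[of "W (v # w) x0" "W w x0" "W (v # ?p) x0"] dist_triangle[of "W (v # ?p) x0" "W w x0" "W ?p x0"] by linarith
  qed
qed

text \<open>This makes sides of points of X meaningful: wherever nearby orbit points disagree about
  the side of \<open>v\<close>, the displacement by \<open>v\<close> is bounded.\<close>

lemma side_ambiguity: "\<exists>M. \<forall>v x w w'. dist (W w x0) x \<le> r \<and> dist (W w' x0) x \<le> r \<and> hs v w \<noteq> hs v w' \<longrightarrow> dist (g v x) x \<le> M"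
proof -
  obtain M where M: "\<And>v w w'. dist (W w x0) (W w' x0) \<le> 2 * r \<Longrightarrow> hs v w \<noteq> hs v w' \<Longrightarrow> dist (W (v # w) x0) (W w x0) \<le> M"
    using wall_crossing[of "2 * r"] by blast
  show ?thesis
  proof (intro exI[of _ "M + 2 * r"] allI impI, elim conjE)
    fix v x w w' assume d: "dist (W w x0) x \<le> r" "dist (W w' x0) x \<le> r" and ne: "hs v w \<noteq> hs v w'"
    have "dist (W w x0) (W w' x0) \<le> 2 * r" using d dist_triangle2[of "W w x0" "W w' x0" x] by linarith
    then have "dist (g v (W w x0)) (W w x0) \<le> M" using M ne by (simp add: word_act_Cons)
    moreover have "dist (g v x) (g v (W w x0)) \<le> r" using d by (simp add: g_dist dist_commute)
    ultimately show "dist (g v x) x \<le> M + 2 * r"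
      using d dist_triangle[of "g v x" x "W w x0"] dist_triangle[of "g v x" "W w x0" "g v (W w x0)"] by linarith
  qed
qed

definition side_bound :: "real \<Rightarrow> real" where 
  "side_bound r = (SOME M. \<forall>v x w w'. dist (W w x0) x \<le> r \<and> dist (W w' x0) x \<le> r \<and> hs v w \<noteq> hs v w' \<longrightarrow> dist (g v x) x \<le> M)"

lemma side_bound: "dist (W w x0) x \<le> r \<Longrightarrow> dist (W w' x0) x \<le> r \<Longrightarrow> hs v w \<noteq> hs v w' \<Longrightarrow> dist (g v x) x \<le> side_bound r"
  using someI_ex[OF side_ambiguity[of r]] unfolding side_bound_def by blast

section \<open>Reflections on the boundary and their halves\<close>

abbreviation "rfl v \<equiv> bdry (g v)"

lemmas rfl_ray = bdry(1)[OF g_isometry] and rfl_near = bdry(2)[OF g_isometry]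

lemma rfl_rfl: assumes "c \<in> rays" shows "rfl v (rfl v c) = c"
  using bdry_comp[OF g_isometry g_isometry assms, of v v] bdry_id[OF assms] by (simp add: g_invol)

lemma rfl_commute: assumes "E u v" "c \<in> rays" shows "rfl u (rfl v c) = rfl v (rfl u c)"
  using bdry_comp[OF g_isometry g_isometry assms(2)] g_commute[OF assms(1)] by simp

definition disp :: "'v \<Rightarrow> (real \<Rightarrow> 'x) \<Rightarrow> real \<Rightarrow> real" where "disp v c t = dist (g v (c t)) (c t)"

lemma disp_0: "c \<in> rays \<Longrightarrow> disp v c 0 = dist (g v x0) x0" by (simp add: disp_def ray_0)

lemma disp_quasiconvex:
  assumes "c \<in> rays" "0 \<le> s" "s \<le> t" shows "disp v c s \<le> max (disp v c 0) (disp v c t)"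
proof -
  have "geodesic_seg (g v \<circ> c) (g v x0) (g v (c t))" 
    using ray_geodesic[OF assms(1), of t] assms geodesic_isometry g_isometry by auto
  from geodesics_quasiconvex[OF this ray_geodesic[OF assms(1), of t]] show ?thesis
    using assms ray_dist0[OF assms(1), of t] by (simp add: disp_def g_dist ray_0)
qed

lemma rfl_fixed_bound: "c \<in> rays \<Longrightarrow> rfl v c = c \<Longrightarrow> 0 \<le> t \<Longrightarrow> disp v c t \<le> 2 * dist (g v x0) x0"
  using rfl_near[of c t v] by (simp add: disp_def dist_commute)

text \<open>Bounded displacement would make the ray asymptotic to its mirror image. Once the
  displacement exceeds both \<open>M\<close> and its initial value, quasiconvexity keeps it above
  \<open>M\<close>.\<close>

lemma disp_unbounded:
  assumes c: "c \<in> rays" "rfl v c \<noteq> c" obtains T where "0 \<le> T" "\<And>t. T \<le> t \<Longrightarrow> M < disp v c t"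
proof -
  have "\<exists>T\<ge>0. max M (disp v c 0) < disp v c T"
  proof (rule ccontr)
    assume "\<not> ?thesis"
    then have "rfl v c = c"
      by (intro bdry_eqI[OF g_isometry c(1) c(1), of v "max M (disp v c 0)"]) (auto simp: disp_def dist_commute not_less)
    then show False using c by blast
  qed
  then obtain T where T: "0 \<le> T" "max M (disp v c 0) < disp v c T" by blast
  have "M < disp v c t" if "T \<le> t" for t using disp_quasiconvex[OF c(1) T(1) that, of v] T(2) by linarith
  then show ?thesis using that T(1) by blast
qed

text \<open>The parameter \<open>True\<close> stands for the half of the half-space away from the
  identity, \<open>False\<close> for the other. Fixed rays are excluded explicitly, because the
  sides chosen along them may be accidental.\<close>

definition hs_boundary :: "bool \<Rightarrow> 'v \<Rightarrow> (real \<Rightarrow> 'x) set" where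
  "hs_boundary b v = {c \<in> rays. rfl v c \<noteq> c \<and> (\<exists>T. \<forall>t\<ge>T. hs v (near (c t)) = b)}"

lemma near_switch:
  assumes "dist x y \<le> 1" "hs v (near x) \<noteq> hs v (near y)" shows "dist (g v x) x \<le> side_bound (cod + 1)"
proof (rule side_bound[OF _ _ assms(2)])
  show "dist (W (near x) x0) x \<le> cod + 1" using near[of x] by linarith
  show "dist (W (near y) x0) x \<le> cod + 1" using near[of y] assms(1) dist_triangle2[of "W (near y) x0" x y] by linarith
qed

text \<open>Move along the ray by steps of length at most 1: a change of side within a step would
  force a displacement of at most \<open>side_bound (cod + 1)\<close>.\<close>

lemma side_constant:
  assumes c: "c \<in> rays" and T: "0 \<le> T" "\<And>t. T \<le> t \<Longrightarrow> side_bound (cod + 1) < disp v c t" and t: "T \<le> t"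
  shows "hs v (near (c t)) = hs v (near (c T))"
proof -
  have "\<forall>t. T \<le> t \<longrightarrow> t \<le> T + real n \<longrightarrow> hs v (near (c t)) = hs v (near (c T))" for n
  proof (induction n)
    case 0 then show ?case by (metis add_0_right of_nat_0 order_antisym)
  next
    case (Suc n)
    show ?case
    proof (intro allI impI)
      fix t assume t: "T \<le> t" "t \<le> T + real (Suc n)"
      define s where "s = max T (t - 1)"
      have s: "T \<le> s" "s \<le> T + real n" "s \<le> t" "t - s \<le> 1" using t by (auto simp: s_def)
      have "dist (c s) (c t) \<le> 1" using ray_dist[OF c, of s t] s T(1) t by simp
      then have "hs v (near (c s)) = hs v (near (c t))"
        using near_switch[of "c s" "c t" v] T(2)[OF s(1)] by (auto simp: disp_def)
      then show "hs v (near (c t)) = hs v (near (c T))" using Suc s by blast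
    qed
  qed
  moreover obtain n where "t \<le> T + real n" using real_arch_simple[of "t - T"] by (auto simp: algebra_simps)
  ultimately show ?thesis using t by blast
qed

lemma hs_boundary_cases:
  assumes "c \<in> rays" "rfl v c \<noteq> c" shows "c \<in> hs_boundary True v \<or> c \<in> hs_boundary False v"
proof -
  obtain T where T: "0 \<le> T" "\<And>t. T \<le> t \<Longrightarrow> side_bound (cod + 1) < disp v c t" using disp_unbounded assms by blast
  have "\<forall>t\<ge>T. hs v (near (c t)) = hs v (near (c T))" using side_constant[OF assms(1) T] by blast
  then show ?thesis using assms unfolding hs_boundary_def by (cases "hs v (near (c T))") auto
qed

lemma hs_boundary_disjoint: "hs_boundary True v \<inter> hs_boundary False v = {}"
proof (rule ccontr)
  assume "\<not> ?thesis"
  then obtain c :: "real \<Rightarrow> 'x" and T T' where T: "\<forall>t\<ge>T. hs v (near (c t)) = True" "\<forall>t\<ge>T'. hs v (near (c t)) = False"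
    unfolding hs_boundary_def by blast
  show False using T(1)[rule_format, of "max T T'"] T(2)[rule_format, of "max T T'"] by simp
qed

lemma openin_hs_boundary: "openin (top_of_set rays) (hs_boundary b v)"
proof (subst openin_subopen, intro ballI)
  fix c assume cb: "c \<in> hs_boundary b v"
  then obtain T1 where c: "c \<in> rays" "rfl v c \<noteq> c" and T1: "\<And>t. T1 \<le> t \<Longrightarrow> hs v (near (c t)) = b"
    unfolding hs_boundary_def by blast
  let ?K = "dist (g v x0) x0"
  \<comment> \<open>The bound covers a change of side as well as the displacement
    \<open>2 * ?K\<close> of fixed rays, and it dominates the displacement at time 0. A perturbation
    by less than 1 lowers the displacement by less than 2, whence the margin in
    \<open>A + 2\<close>.\<close>
  define A where "A = max (side_bound (cod + 1)) (2 * ?K)"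
  obtain T0 where T0: "0 \<le> T0" "\<And>t. T0 \<le> t \<Longrightarrow> A + 2 < disp v c t" using disp_unbounded[OF c] by blast
  define T where "T = max T0 T1"
  have T: "0 \<le> T" "A + 2 < disp v c T" "hs v (near (c T)) = b" using T0 T1 by (auto simp: T_def)
  have "hs_boundary b v \<supseteq> rays \<inter> {c'. dist (c' T) (c T) < 1}"
  proof
    fix c' assume c': "c' \<in> rays \<inter> {c'. dist (c' T) (c T) < 1}"
    then have c'r: "c' \<in> rays" and d: "dist (c' T) (c T) < 1" by auto
    have "disp v c T \<le> dist (g v (c T)) (g v (c' T)) + disp v c' T + dist (c' T) (c T)"
      using dist_triangle[of "g v (c T)" "c T" "g v (c' T)"] dist_triangle[of "g v (c' T)" "c T" "c' T"] by (simp add: disp_def)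
    then have AT: "A < disp v c' T" using T(2) d by (simp add: g_dist dist_commute)
    have At: "A < disp v c' t" if "T \<le> t" for t
    proof -
      have "disp v c' T \<le> max ?K (disp v c' t)" using disp_quasiconvex[OF c'r T(1) that, of v] disp_0[OF c'r] by simp
      moreover have "?K \<le> A" using zero_le_dist[of "g v x0" x0] unfolding A_def by linarith
      ultimately show ?thesis using AT by linarith
    qed
    have "rfl v c' \<noteq> c'"
    proof
      assume "rfl v c' = c'"
      then have "disp v c' T \<le> 2 * ?K" using rfl_fixed_bound c'r T(1) by blast
      then show False using AT by (simp add: A_def)
    qed
    moreover have "hs v (near (c' t)) = b" if t: "T \<le> t" for t
    proof -
      have "hs v (near (c' t)) = hs v (near (c' T))" using side_constant[OF c'r T(1) _ t] At by (fastforce simp: A_def)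
      moreover have "hs v (near (c' T)) = hs v (near (c T))"
        using near_switch[of "c' T" "c T" v] d AT by (fastforce simp: A_def disp_def)
      ultimately show ?thesis using T(3) by simp
    qed
    ultimately show "c' \<in> hs_boundary b v" using c'r unfolding hs_boundary_def by blast
  qed
  moreover have "openin (top_of_set rays) (rays \<inter> {c'. dist (c' T) (c T) < 1})"
    by (intro openin_open_Int open_Collect_less continuous_intros continuous_on_eval)
  moreover have "c \<in> rays \<inter> {c'. dist (c' T) (c T) < 1}" using c by simp
  ultimately show "\<exists>T. openin (top_of_set rays) T \<and> c \<in> T \<and> T \<subseteq> hs_boundary b v" by blast
qed

text \<open>One argument for two uses: \<open>u = v\<close>, which exchanges the sides, and
  \<open>u\<close> adjacent to \<open>v\<close>, which preserves them. The image ray is within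
  \<open>2 * dist (g u x0) x0\<close> of the translated ray, so the translated orbit point decides
  its side except where the displacement is bounded.\<close>

lemma hs_boundary_image:
  assumes c: "c \<in> hs_boundary b v" and nf: "rfl v (rfl u c) \<noteq> rfl u c"
    and comm: "\<And>x. dist (g v (g u x)) (g u x) = dist (g v x) x" and b': "\<And>w. hs v w = b \<Longrightarrow> hs v (u # w) = b'"
  shows "rfl u c \<in> hs_boundary b' v"
proof -
  obtain T1 where cr: "c \<in> rays" "rfl v c \<noteq> c" and T1: "\<And>t. T1 \<le> t \<Longrightarrow> hs v (near (c t)) = b"
    using c unfolding hs_boundary_def by blast
  let ?r = "cod + 2 * dist (g u x0) x0"
  obtain T0 where T0: "0 \<le> T0" "\<And>t. T0 \<le> t \<Longrightarrow> side_bound ?r < disp v c t" using disp_unbounded[OF cr] by blast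
  have "hs v (near (rfl u c t)) = b'" if t: "max T0 T1 \<le> t" for t
  proof (rule ccontr)
    assume n: "hs v (near (rfl u c t)) \<noteq> b'"
    have "hs v (u # near (c t)) = b'" using b' T1 t by simp
    then have ne: "hs v (near (rfl u c t)) \<noteq> hs v (u # near (c t))" using n by simp
    have "dist (W (near (rfl u c t)) x0) (g u (c t)) \<le> ?r"
      using near[of "rfl u c t"] rfl_near[OF cr(1), of t u] t T0(1) 
        dist_triangle[of "W (near (rfl u c t)) x0" "g u (c t)" "rfl u c t"] by linarith
    moreover have "dist (W (u # near (c t)) x0) (g u (c t)) \<le> cod" using near[of "c t"] by (simp add: word_act_Cons g_dist)
    then have "dist (W (u # near (c t)) x0) (g u (c t)) \<le> ?r" using zero_le_dist[of "g u x0" x0] by linarith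
    ultimately have "dist (g v (g u (c t))) (g u (c t)) \<le> side_bound ?r" using side_bound ne by blast
    then show False using T0(2)[of t] t comm by (simp add: disp_def)
  qed
  then show ?thesis using nf rfl_ray[OF cr(1)] unfolding hs_boundary_def by blast
qed

lemma hs_boundary_rays: "hs_boundary b v \<subseteq> rays" unfolding hs_boundary_def by blast

lemma rfl_hs_boundary_subset: "rfl v ` hs_boundary b v \<subseteq> hs_boundary (\<not> b) v"
proof clarify
  fix c assume c: "c \<in> hs_boundary b v"
  show "rfl v c \<in> hs_boundary (\<not> b) v"
  proof (rule hs_boundary_image[OF c])
    show "rfl v (rfl v c) \<noteq> rfl v c" using c rfl_rfl unfolding hs_boundary_def by auto
  qed (auto simp: g_g dist_commute hs_Cons_self)
qed

lemma rfl_hs_boundary: "rfl v ` hs_boundary b v = hs_boundary (\<not> b) v"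
proof
  show "hs_boundary (\<not> b) v \<subseteq> rfl v ` hs_boundary b v"
  proof
    fix c assume c: "c \<in> hs_boundary (\<not> b) v"
    then have "rfl v c \<in> hs_boundary b v" using rfl_hs_boundary_subset[of v "\<not> b"] by auto
    moreover have "c = rfl v (rfl v c)" using rfl_rfl c hs_boundary_rays by (metis subsetD)
    ultimately show "c \<in> rfl v ` hs_boundary b v" by blast
  qed
qed (rule rfl_hs_boundary_subset)

lemma rfl_adjacent_hs_boundary: assumes "E u v" shows "rfl u ` hs_boundary b v \<subseteq> hs_boundary b v"
proof clarify
  fix c assume c: "c \<in> hs_boundary b v"
  then have cr: "c \<in> rays" "rfl v c \<noteq> c" by (auto simp: hs_boundary_def)
  show "rfl u c \<in> hs_boundary b v"
  proof (rule hs_boundary_image[OF c])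
    show "rfl v (rfl u c) \<noteq> rfl u c"
    proof
      assume "rfl v (rfl u c) = rfl u c"
      then have "rfl u (rfl u (rfl v c)) = rfl u (rfl u c)" using rfl_commute[OF assms cr(1)] by simp
      then show False using rfl_rfl cr rfl_ray[OF cr(1)] by simp
    qed
    show "dist (g v (g u x)) (g u x) = dist (g v x) x" for x
      using g_commute[OF assms] g_dist by (metis comp_apply)
    show "hs v (u # w) = b" if "hs v w = b" for w using hs_Cons_adj[OF assms] that by simp
  qed
qed

lemma hs_boundary_nonadjacent:
  assumes "u \<noteq> v" "\<not> E u v" shows "hs_boundary True u \<inter> hs_boundary True v = {}"
proof (rule ccontr)
  assume "\<not> ?thesis"
  then obtain c :: "real \<Rightarrow> 'x" and T T' where T: "\<forall>t\<ge>T. hs u (near (c t)) = True" "\<forall>t\<ge>T'. hs v (near (c t)) = True"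
    unfolding hs_boundary_def by blast
  have "hs u (near (c (max T T')))" "hs v (near (c (max T T')))"
    using T(1)[rule_format, of "max T T'"] T(2)[rule_format, of "max T T'"] by simp_all
  then show False using hs_hs_adj assms by blast
qed

text \<open>Elements along a ray fixed by two commuting reflections would yield infinitely many elements commuting with both.\<close>
lemma no_common_fixed_ray:
  assumes e: "E u v" and c: "c \<in> rays" and fu: "rfl u c = c" shows "rfl v c \<noteq> c"
proof
  assume fv: "rfl v c = c"
  define w where "w n = near (c (real n))" for n :: nat
  define r where "r = 2 * cod + 2 * dist (g u x0) x0 + 2 * dist (g v x0) x0"
  have cl: "dist (W (rev (w n) @ s # w n) x0) x0 \<le> r" if s: "s = u \<or> s = v" for s n
  proof -
    have "dist (W (rev (w n) @ s # w n) x0) x0 = dist (W (rev (w n)) (g s (W (w n) x0))) (W (rev (w n)) (W (w n) x0))"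
      by (simp add: word_act_append word_act_Cons W_rev)
    also have "\<dots> = dist (g s (W (w n) x0)) (W (w n) x0)" by (rule W_dist)
    also have "\<dots> \<le> dist (g s (W (w n) x0)) (g s (c n)) + dist (g s (c n)) (c n) + dist (c n) (W (w n) x0)"
      using dist_triangle[of "g s (W (w n) x0)" "W (w n) x0" "g s (c n)"] dist_triangle[of "g s (c n)" "W (w n) x0" "c n"] by linarith
    also have "\<dots> \<le> cod + disp s c n + cod" using near[of "c n"] by (simp add: g_dist w_def disp_def dist_commute)
    also have "\<dots> \<le> r" using rfl_fixed_bound[OF c, of s n] s fu fv zero_le_dist[of "g u x0" x0] zero_le_dist[of "g v x0" x0]
      unfolding r_def by (auto simp del: zero_le_dist)
    finally show ?thesis .
  qed
  \<comment> \<open>The conjugates of both generators by \<open>w n\<close> move \<open>x0\<close>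
    by at most \<open>r\<close>, so only finitely many pairs occur. If the pairs for n and
    \<open>n0\<close> agree, \<open>w n @ rev w0\<close> commutes with both generators and has
    length at most 2, which bounds n.\<close>
  define F where "F n = (racg_elem E (rev (w n) @ u # w n), racg_elem E (rev (w n) @ v # w n))" for n
  let ?C = "{racg_elem E w | w. dist (W w x0) x0 \<le> r}"
  have "range F \<subseteq> ?C \<times> ?C" using cl unfolding F_def by blast
  then have "finite (range F)" using finite_classes finite_subset by blast
  then obtain n0 where inf: "infinite {n. F n = F n0}" using pigeonhole_infinite[of "UNIV :: nat set" F] by auto
  define w0 where "w0 = w n0"
  have bound: "real n \<le> cod + dist (W w0 x0) x0 + 2 * step_bound" if n: "F n = F n0" for n
  proof -
    define h where "h = w n @ rev w0"
    have comm: "racg_equiv E (h @ [s]) (s # h)" if s: "s = u \<or> s = v" for s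
    proof -
      have "racg_elem E (rev (w n) @ s # w n) = racg_elem E (rev w0 @ s # w0)" using n s by (auto simp: F_def w0_def)
      moreover have "rev w0 @ s # w0 \<in> racg_elem E (rev w0 @ s # w0)" by (simp add: racg_elem_def)
      ultimately have eq: "racg_equiv E (rev (w n) @ s # w n) (rev w0 @ s # w0)" unfolding racg_elem_def by blast
      have "racg_equiv E ([] @ s # h) ((w n @ rev (w n)) @ s # h)"
        by (rule racg_equiv_append[OF racg_equiv_sym[OF racg_equiv_inv_right] racg_equiv_refl])
      also have "(w n @ rev (w n)) @ s # h = w n @ (rev (w n) @ s # w n) @ rev w0" by (simp add: h_def)
      also have "racg_equiv E \<dots> (w n @ (rev w0 @ s # w0) @ rev w0)" by (rule racg_equiv_ctx[OF eq])
      also have "\<dots> = (h @ [s]) @ (w0 @ rev w0)" by (simp add: h_def)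
      also have "racg_equiv E \<dots> ((h @ [s]) @ [])" by (rule racg_equiv_append[OF racg_equiv_refl racg_equiv_inv_right])
      finally have "racg_equiv E (s # h) (h @ [s])" by simp
      then show ?thesis by (rule racg_equiv_sym)
    qed
    have "length (reduce E h) \<le> 2" using centralizer_edge[OF tf e comm comm] by blast
    then have "dist (W h x0) x0 \<le> 2 * step_bound"
    proof -
      have "dist (W (reduce E h) x0) x0 \<le> real (length (reduce E h)) * step_bound" by (rule W_length)
      also have "\<dots> \<le> 2 * step_bound" using \<open>length (reduce E h) \<le> 2\<close> step_bound_nonneg by (intro mult_right_mono) auto
      finally show ?thesis using W_cong[OF racg_equiv_reduce_self[of h]] by simp
    qed
    moreover have "dist (W (w n) x0) (W h x0) = dist (W w0 x0) x0"
    proof -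
      have "W (w n) x0 = W h (W w0 x0)" by (simp add: h_def word_act_append W_rev)
      then show ?thesis by (simp add: W_dist)
    qed
    moreover have "dist x0 (c n) \<le> dist x0 (W h x0) + dist (W h x0) (W (w n) x0) + dist (W (w n) x0) (c n)"
      using dist_triangle[of x0 "c n" "W h x0"] dist_triangle[of "W h x0" "c n" "W (w n) x0"] by linarith
    ultimately show ?thesis using near[of "c n"] ray_dist0[OF c, of n] by (simp add: w_def dist_commute)
  qed
  have "{n. F n = F n0} \<subseteq> {..nat \<lceil>cod + dist (W w0 x0) x0 + 2 * step_bound\<rceil>}"
  proof
    fix n assume "n \<in> {n. F n = F n0}"
    then have "real n \<le> real (nat \<lceil>cod + dist (W w0 x0) x0 + 2 * step_bound\<rceil>)"
      using order_trans[OF bound real_nat_ceiling_ge] by simp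
    then show "n \<in> {..nat \<lceil>cod + dist (W w0 x0) x0 + 2 * step_bound\<rceil>}" by simp
  qed
  then show False using inf finite_subset by blast
qed

end

context racg_action begin

section \<open>Connectedness of the boundary\<close>

lemma wlen_le_length: "wlen w \<le> length w"
proof (induction w)
  case (Cons s w)
  then show ?case using wlen_Cons(1)[of s w] wlen_Cons(2)[of s w] by (cases "hs s w") auto
qed (simp add: wlen_def)

text \<open>The inverse \<open>rev w\<close> appears because \<open>one_ended\<close> multiplies on
  the left. After inversion this becomes multiplication on the right, which moves the orbit point of
  \<open>x0\<close> by at most \<open>step_bound\<close>.\<close>

lemma W_wlen: "dist (W (rev w) x0) x0 \<le> real (wlen w) * step_bound"
proof -
  have "racg_equiv E (rev w) (rev (reduce E w))" by (rule racg_equiv_rev[OF racg_equiv_reduce_self])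
  then have "W (rev w) x0 = W (rev (reduce E w)) x0" using W_cong by metis
  then show ?thesis using W_length[of "rev (reduce E w)"] by (simp add: wlen_def)
qed

lemma far_if_long: "\<exists>n. \<forall>w. n \<le> wlen w \<longrightarrow> r \<le> dist (W (rev w) x0) x0"
proof -
  obtain L where L: "\<And>w. dist (W w x0) x0 \<le> r \<Longrightarrow> \<exists>w'. racg_equiv E w w' \<and> length w' \<le> L"
    using short_representatives by blast
  have "r \<le> dist (W (rev w) x0) x0" if w: "L + 1 \<le> wlen w" for w
  proof (rule ccontr)
    assume "\<not> ?thesis"
    then obtain w' where w': "racg_equiv E (rev w) w'" "length w' \<le> L" using L[of "rev w"] by auto
    have "racg_equiv E w (rev w')" using racg_equiv_rev[OF w'(1)] by simp
    then have "wlen w = wlen (rev w')" by (rule wlen_cong)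
    also have "\<dots> \<le> L" using wlen_le_length[of "rev w'"] w'(2) by simp
    finally show False using w by simp
  qed
  then show ?thesis by blast
qed

lemma rays_nonempty:
  assumes "a \<noteq> b" "\<not> E a b" shows "rays \<noteq> {}"
proof -
  have "\<exists>x. real n \<le> dist x0 x" for n
  proof -
    obtain k where k: "\<And>w. k \<le> wlen w \<Longrightarrow> real n \<le> dist (W (rev w) x0) x0" using far_if_long by blast
    obtain w where "wlen w = k" using wlen_unbounded[OF assms] by blast
    then show ?thesis using k[of w] by (auto simp: dist_commute)
  qed
  then obtain x where "\<And>n. real n \<le> dist x0 (x n)" by metis
  then obtain c where "c \<in> rays" by (rule ray_cluster)
  then show ?thesis by blast
qed

text \<open>A separation of the boundary would induce, far from the identity, a locally constant non-constant function
  on the Cayley graph.\<close>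
lemma connected_rays:
  assumes ins: "inseparable E" and ab: "a \<noteq> b" "\<not> E a b"
  shows "connected rays"
proof (rule ccontr)
  assume "\<not> connected rays"
  then obtain P Q where PQ: "closed P" "closed Q" "P \<noteq> {}" "Q \<noteq> {}" "P \<union> Q = rays" "P \<inter> Q = {}"
    unfolding connected_closed_set[OF closed_rays] by blast
  \<comment> \<open>Large enough for both comparisons at radius \<open>R\<close>: neighbouring orbit
    points need \<open>2 * step_bound + 1\<close>, and a ray with an orbit point near it needs
    \<open>2 * cod\<close> and a little more.\<close>
  define C where "C = 2 * step_bound + 2 * cod + 2"
  \<comment> \<open>Otherwise the pairs of rays in \<open>P\<close> and \<open>Q\<close> that are at
    most \<open>C\<close> apart at time n would form nested non-empty compact sets. A common member
    would be a pair of rays at bounded distance, hence equal.\<close>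
  have "\<exists>n::nat. 0 < n \<and> (\<forall>c\<in>P. \<forall>c'\<in>Q. C < dist (c (real n)) (c' (real n)))"
  proof (rule ccontr)
    assume neg: "\<not> ?thesis"
    define T where "T n = {z :: (real \<Rightarrow> 'x) \<times> (real \<Rightarrow> 'x). dist (fst z (real n)) (snd z (real n)) \<le> C}" for n :: nat
    have clT: "closed (T n)" for n
    proof -
      have "continuous_on UNIV (\<lambda>z :: (real \<Rightarrow> 'x) \<times> (real \<Rightarrow> 'x). fst z (real n))"
        by (rule continuous_on_product_then_coordinatewise[OF continuous_on_fst[OF continuous_on_id]])
      moreover have "continuous_on UNIV (\<lambda>z :: (real \<Rightarrow> 'x) \<times> (real \<Rightarrow> 'x). snd z (real n))"
        by (rule continuous_on_product_then_coordinatewise[OF continuous_on_snd[OF continuous_on_id]])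
      ultimately show ?thesis unfolding T_def by (intro closed_Collect_le continuous_intros) auto
    qed
    have "compact (P \<times> Q)"
    proof -
      have "compact (rays \<inter> P)" "compact (rays \<inter> Q)" using compact_Int_closed[OF compact_rays] PQ by auto
      moreover have "rays \<inter> P = P" "rays \<inter> Q = Q" using PQ(5) by auto
      ultimately show ?thesis by (simp add: compact_Times)
    qed
    moreover have "(P \<times> Q) \<inter> \<Inter> F \<noteq> {}" if F: "finite F" "F \<subseteq> range T" for F
    proof -
      obtain N where N: "finite N" "F = T ` N" using finite_subset_image[OF F] by blast
      define n where "n = Max (insert 1 N)"
      have n: "0 < n" "\<And>k. k \<in> N \<Longrightarrow> k \<le> n" using N(1) by (auto simp: n_def Max_gr_iff intro: Max_ge)
      have "\<exists>c\<in>P. \<exists>c'\<in>Q. dist (c (real n)) (c' (real n)) \<le> C" 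
      proof (rule ccontr)
        assume "\<not> ?thesis"
        then have "\<forall>c\<in>P. \<forall>c'\<in>Q. C < dist (c (real n)) (c' (real n))" by (simp add: not_le)
        then have "\<exists>n::nat. 0 < n \<and> (\<forall>c\<in>P. \<forall>c'\<in>Q. C < dist (c (real n)) (c' (real n)))"
          using n(1) by (intro exI[of _ n] conjI)
        then show False using neg by contradiction
      qed
      then obtain c c' :: "real \<Rightarrow> 'x" where c: "c \<in> P" "c' \<in> Q" "dist (c n) (c' n) \<le> C" by blast
      have "(c, c') \<in> T k" if "k \<in> N" for k
      proof -
        have cr: "c \<in> rays" "c' \<in> rays" using c PQ(5) by auto
        have "dist (c k) (c' k) \<le> real k / real n * dist (c n) (c' n)"
          using rays_converge[OF cr, of k n] n(1) n(2)[OF that] by simp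
        also have "\<dots> \<le> 1 * dist (c n) (c' n)" using n(1) n(2)[OF that] by (intro mult_right_mono) auto
        finally show ?thesis using c(3) by (simp add: T_def)
      qed
      then show ?thesis using c N by blast
    qed
    ultimately have "(P \<times> Q) \<inter> \<Inter> (range T) \<noteq> {}" using clT compact_imp_fip[of "P \<times> Q" "range T"] by blast
    then obtain z where "z \<in> P \<times> Q" "\<And>n. z \<in> T n" by blast
    then have "fst z \<in> P" "snd z \<in> Q" "\<And>n::nat. dist (fst z n) (snd z n) \<le> C" by (auto simp: T_def)
    then obtain c c' :: "real \<Rightarrow> 'x" where c: "c \<in> P" "c' \<in> Q" "\<And>n::nat. dist (c n) (c' n) \<le> C" by blast
    have cr: "c \<in> rays" "c' \<in> rays" using c PQ(5) by auto
    have "dist (c t) (c' t) \<le> C" if t: "0 \<le> t" for t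
    proof -
      obtain n :: nat where n: "t + 1 \<le> real n" using real_arch_simple by blast
      have "dist (c t) (c' t) \<le> t / real n * dist (c n) (c' n)" using rays_converge[OF cr t, of "real n"] n t by simp
      also have "\<dots> \<le> 1 * dist (c n) (c' n)" using n t by (intro mult_right_mono) auto
      finally show ?thesis using c(3)[of n] by simp
    qed
    then have "c = c'" by (rule rays_eqI[OF cr])
    then show False using c PQ(6) by blast
  qed
  then obtain R :: nat where R0: "0 < R \<and> (\<forall>c\<in>P. \<forall>c'\<in>Q. C < dist (c (real R)) (c' (real R)))" by (rule exE)
  have R: "0 < R" "\<And>c c' :: real \<Rightarrow> 'x. c \<in> P \<Longrightarrow> c' \<in> Q \<Longrightarrow> C < dist (c R) (c' R)"
    using R0 by simp_all
  \<comment> \<open>At radius \<open>R\<close>, geodesics to far points look like rays; a sequence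
    of counterexamples would have a cluster ray.\<close>
  have "\<exists>k::nat. \<forall>x. real k \<le> dist x0 x \<longrightarrow> (\<exists>c\<in>rays. dist (geo x R) (c R) < 1/2)"
  proof (rule ccontr)
    assume "\<not> ?thesis"
    then have "\<forall>k::nat. \<exists>x. real k \<le> dist x0 x \<and> (\<forall>c\<in>rays. \<not> dist (geo x R) (c R) < 1/2)" by blast
    then obtain x where x: "\<And>k::nat. real k \<le> dist x0 (x k)" "\<And>k c. c \<in> rays \<Longrightarrow> \<not> dist (geo (x k) R) (c R) < 1/2" by metis
    obtain c where "c \<in> rays" "\<And>t e N. 0 < e \<Longrightarrow> \<exists>n\<ge>N. dist (geo (x n) t) (c t) < e" using ray_cluster[OF x(1)] by blast
    then show False using x(2) by (metis half_gt_zero zero_less_one)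
  qed
  then obtain k0 :: nat where k0: "\<And>x. real k0 \<le> dist x0 x \<Longrightarrow> \<exists>c\<in>rays. dist (geo x R) (c R) < 1/2" by blast
  define k where "k = real k0 + real R"
  have geo_close: "dist (geo x R) (geo y R) \<le> 2 * dist x y" if "k \<le> dist x0 x" "k \<le> dist x0 y" for x y
  proof -
    have y: "real R \<le> dist x0 y" "real R \<le> dist x0 x" "0 < dist x0 y" using that R(1) by (auto simp: k_def)
    have "dist (geo x R) (geo y R) \<le> 2 * (real R / dist x0 y) * dist x y"
      using geodesics_converge_same_time[OF geo_geodesic geo_geodesic, of "real R" x y] y by simp
    also have "\<dots> \<le> 2 * 1 * dist x y" using y by (intro mult_right_mono mult_left_mono) auto
    finally show ?thesis by simp
  qed
  \<comment> \<open>The locally constant function: which part of the boundary the geodesic to the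
    orbit point heads for, as seen at radius \<open>R\<close>.\<close>
  define \<kappa> where "\<kappa> w \<longleftrightarrow> (\<exists>c\<in>P. dist (geo (W (rev w) x0) R) (c R) < 1/2)" for w
  have \<kappa>_step: "\<kappa> w'" if w: "\<kappa> w" "k \<le> dist (W (rev w) x0) x0" "k \<le> dist (W (rev w') x0) x0" 
    and d: "dist (W (rev w) x0) (W (rev w') x0) \<le> step_bound" for w w'
  proof -
    obtain c where c: "c \<in> P" "dist (geo (W (rev w) x0) R) (c R) < 1/2" using w(1) by (auto simp: \<kappa>_def)
    have "real k0 \<le> dist x0 (W (rev w') x0)" using w(3) by (simp add: k_def dist_commute)
    then obtain c' where c': "c' \<in> rays" "dist (geo (W (rev w') x0) R) (c' R) < 1/2" using k0 by blast
    have "dist (geo (W (rev w) x0) R) (geo (W (rev w') x0) R) \<le> 2 * step_bound"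
      using geo_close[of "W (rev w) x0" "W (rev w') x0"] w d by (simp add: dist_commute)
    then have "dist (c R) (c' R) < 2 * step_bound + 1"
      using c(2) c'(2) dist_triangle[of "c R" "c' R" "geo (W (rev w) x0) R"] 
        dist_triangle[of "geo (W (rev w) x0) R" "c' R" "geo (W (rev w') x0) R"] by (simp add: dist_commute)
    then have "c' \<notin> Q" using R(2)[OF c(1), of c'] cod_nonneg by (auto simp: C_def)
    then show ?thesis using c' PQ(5) unfolding \<kappa>_def by blast
  qed
  obtain n where n: "\<And>w. n \<le> wlen w \<Longrightarrow> k \<le> dist (W (rev w) x0) x0" using far_if_long by blast
  have const: "\<kappa> w = \<kappa> w'" if "n \<le> wlen w" "n \<le> wlen w'" for w w'
  proof (rule one_ended[OF tf ins ab _ _ that])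
    show "\<kappa> w = \<kappa> w'" if "racg_equiv E w w'" for w w'
      using W_cong[OF racg_equiv_rev[OF that]] by (simp add: \<kappa>_def)
    show "\<kappa> w = \<kappa> (s # w)" if "n \<le> wlen w" "n \<le> wlen (s # w)" for w s
    proof -
      have "dist (W (rev w) x0) (W (rev (s # w)) x0) = dist (W (rev w) x0) (W (rev w) (g s x0))"
        by (simp add: word_act_append word_act_Cons)
      also have "\<dots> \<le> step_bound" unfolding W_dist using step_bound by (simp add: dist_commute)
      finally have d: "dist (W (rev w) x0) (W (rev (s # w)) x0) \<le> step_bound" .
      show ?thesis
      proof
        assume "\<kappa> w"
        then show "\<kappa> (s # w)" using \<kappa>_step n[OF that(1)] n[OF that(2)] d by blast
      next
        assume "\<kappa> (s # w)"
        then show "\<kappa> w" using \<kappa>_step[of "s # w" w] n[OF that(1)] n[OF that(2)] d by (simp add: dist_commute)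
      qed
    qed
  qed
  \<comment> \<open>Every ray is followed by orbit points on which the function detects the part
    containing the ray. As both parts are non-empty, the function takes both values far out.\<close>
  have along: "\<exists>w. n \<le> wlen w \<and> (\<kappa> w \<longleftrightarrow> c \<in> P)" if c: "c \<in> rays" for c
  proof -
    define t where "t = k + cod + real n * step_bound + 1"
    have t: "k \<le> t - cod" "real n * step_bound < t - cod" "k \<le> t" "real R \<le> t" "0 \<le> t"
      using step_bound_nonneg cod_nonneg by (auto simp: t_def k_def intro!: add_nonneg_nonneg)
    define w where "w = rev (near (c t))"
    have nw: "dist (W (rev w) x0) (c t) \<le> cod" using near by (simp add: w_def)
    have ct: "dist x0 (c t) = t" using ray_dist0[OF c t(5)] .
    have dw: "t - cod \<le> dist x0 (W (rev w) x0)"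
      using nw ct dist_triangle[of x0 "c t" "W (rev w) x0"] by linarith
    have "n \<le> wlen w"
    proof (rule ccontr)
      assume "\<not> ?thesis"
      then have "real (wlen w) * step_bound \<le> real n * step_bound" using step_bound_nonneg by (intro mult_right_mono) auto
      then show False using W_wlen[of w] dw t(2) by (simp add: dist_commute)
    qed
    moreover have "\<kappa> w \<longleftrightarrow> c \<in> P"
    proof -
      have kw: "k \<le> dist x0 (W (rev w) x0)" using dw t(1) by linarith
      have "dist (geo (W (rev w) x0) R) (c R) \<le> 2 * (real R / dist x0 (c t)) * dist (W (rev w) x0) (c t)"
        using geodesics_converge_same_time[OF geo_geodesic ray_geodesic[OF c t(5)], of "real R" "W (rev w) x0"] kw t ct R(1)
        by (simp add: k_def)
      also have "\<dots> \<le> 2 * 1 * cod" using t ct R(1) nw by (intro mult_mono) (auto simp: divide_le_eq)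
      finally have gc: "dist (geo (W (rev w) x0) R) (c R) \<le> 2 * cod" by simp
      have "real k0 \<le> dist x0 (W (rev w) x0)" using kw by (simp add: k_def)
      then obtain c' where c': "c' \<in> rays" "dist (geo (W (rev w) x0) R) (c' R) < 1/2" using k0 by blast
      have close: "dist (c R) (d R) < C" if "dist (geo (W (rev w) x0) R) (d R) < 1/2" for d :: "real \<Rightarrow> 'x"
        using that gc dist_triangle[of "c R" "d R" "geo (W (rev w) x0) R"] step_bound_nonneg 
        by (simp add: dist_commute C_def)
      show ?thesis
      proof
        assume "\<kappa> w"
        then obtain d where d: "d \<in> P" "dist (geo (W (rev w) x0) R) (d R) < 1/2" by (auto simp: \<kappa>_def)
        then have "dist (d R) (c R) < C" using close[of d] by (simp add: dist_commute)
        then have "c \<notin> Q" using R(2)[OF d(1), of c] by auto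
        then show "c \<in> P" using c PQ(5) by blast
      next
        assume "c \<in> P"
        then have "c' \<notin> Q" using R(2)[of c c'] close[of c', OF c'(2)] by auto
        then show "\<kappa> w" using c' PQ(5) unfolding \<kappa>_def by blast
      qed
    qed
    ultimately show ?thesis by blast
  qed
  obtain c c' where cc: "c \<in> P" "c' \<in> Q" using PQ by blast
  then have "c \<in> rays" "c' \<in> rays" "c' \<notin> P" using PQ by auto
  then show False using along[of c] along[of c'] const cc(1) by blast
qed

lemma plane_graph_of_planar_boundary:
  assumes ins: "inseparable E" and nb: "\<And>v. \<exists>u. E v u" and ab: "a \<noteq> b" "\<not> E a b"
    and lc: "locally_connected_space (visual_boundary x0)"
    and nlcp: "\<not> (\<exists>p \<in> topspace (visual_boundary x0). local_cut_point (visual_boundary x0) p)"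
    and planar: "planar_space (visual_boundary x0)"
  shows "plane_graph E"
proof -
  obtain f :: "(real \<Rightarrow> 'x) \<Rightarrow> real^3" where f: "f ` rays \<subseteq> sphere 0 1" "embedding_map (top_of_set rays) euclidean f"
    using planar unfolding planar_space_def visual_boundary_eq by auto
  have hm: "homeomorphic_map (top_of_set rays) (subtopology euclidean (f ` rays)) f"
    using f(2) unfolding embedding_map_def by simp
  have cf: "continuous_on rays f" 
    using homeomorphic_imp_continuous_map[OF hm] by (simp add: continuous_map_in_subtopology)
  have inj: "inj_on f rays" using homeomorphic_imp_injective_map[OF hm] by simp
  have cin: "connectedin (top_of_set rays) N \<longleftrightarrow> N \<subseteq> rays \<and> connected N" for N
    by (auto simp: connectedin_subtopology)
  have sub: "N \<subseteq> rays" if "openin (top_of_set rays) N" for N using that by (rule openin_imp_subset)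
  show ?thesis
  proof (rule plane_graph_of_spherical_halves[where S = rays and U = "hs_boundary True" and \<sigma> = "\<lambda>v. rfl v" and f = f])
    show "E v u" if "E u v" for u v using E_sym that .
    show "\<not> E u w" if "E u v" "E v w" for u v w using tf that unfolding triangle_free_def by blast
    show "locally_connected_set rays"
      unfolding locally_connected_set_def
    proof (intro allI impI)
      fix N x assume "openin (top_of_set rays) N" "x \<in> N"
      then obtain M where "openin (top_of_set rays) M" "connectedin (top_of_set rays) M" "x \<in> M" "M \<subseteq> N"
        using lc unfolding visual_boundary_eq locally_connected_space by blast
      then show "\<exists>M. openin (top_of_set rays) M \<and> connected M \<and> x \<in> M \<and> M \<subseteq> N" using cin by blast
    qed
    show "connected (N - {p})" if "openin (top_of_set rays) N" "connected N" "p \<in> N" for p N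
    proof -
      have "\<not> local_cut_point (top_of_set rays) p" using nlcp sub[OF that(1)] that(3) unfolding visual_boundary_eq by auto
      then have "connectedin (top_of_set rays) (N - {p})"
        using that sub[OF that(1)] cin unfolding local_cut_point_def by blast
      then show ?thesis using cin by blast
    qed
    show "connected rays" by (rule connected_rays[OF ins ab])
    show "rays \<noteq> {}" by (rule rays_nonempty[OF ab])
    show "continuous_on rays (rfl v)" for v by (rule continuous_on_bdry[OF g_isometry])
    show "rfl v z \<in> rays" if "z \<in> rays" for v z using rfl_ray that .
    show "rfl v (rfl v z) = z" if "z \<in> rays" for v z using rfl_rfl that .
    show "openin (top_of_set rays) (hs_boundary True v)" for v by (rule openin_hs_boundary)
    show "openin (top_of_set rays) (rfl v ` hs_boundary True v)" for v
      unfolding rfl_hs_boundary by (rule openin_hs_boundary)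
    show "hs_boundary True v \<inter> rfl v ` hs_boundary True v = {}" for v
      unfolding rfl_hs_boundary using hs_boundary_disjoint by simp
    show "rfl v z = z" if "z \<in> rays" "z \<notin> hs_boundary True v" "z \<notin> rfl v ` hs_boundary True v" for v z
      using hs_boundary_cases[OF that(1)] that unfolding rfl_hs_boundary by auto
    show "rfl u ` hs_boundary True v \<subseteq> hs_boundary True v" if "E u v" for u v by (rule rfl_adjacent_hs_boundary[OF that])
    show "rfl u (rfl v z) = rfl v (rfl u z)" if "E u v" "z \<in> rays" for u v z using rfl_commute that .
    show "rfl v z \<noteq> z" if "E u v" "z \<in> rays" "rfl u z = z" for u v z using no_common_fixed_ray that .
    show "hs_boundary True u \<inter> hs_boundary True v = {}" if "u \<noteq> v" "\<not> E u v" for u v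
      using hs_boundary_nonadjacent that .
  qed (use E_irrefl nb compact_rays cf inj f(1) in auto)
qed

end

text \<open>It disposes of graphs with at most two vertices. With three vertices, connectedness
  provides every vertex with a neighbour, and triangle-freeness provides a non-adjacent
  pair.\<close>

lemma plane_graph_two_vertices:
  fixes E :: "'v::finite \<Rightarrow> 'v \<Rightarrow> bool" and a b :: 'v
  assumes "simplicial_graph E" and two: "\<And>v. v = a \<or> v = b"
  shows "plane_graph E"
proof -
  define p where "p v = (if v = a then 0 else 1 :: complex)" for v :: 'v
  have p: "p u \<noteq> p v" if "u \<noteq> v" for u v using two[of u] two[of v] that by (auto simp: p_def)
  show ?thesis
  proof (rule plane_graph_of_continua[where T = "\<lambda>v. {p v}" and e = "\<lambda>u v. linepath (p u) (p v)"])
    show "E v u" if "E u v" for u v using assms(1) that by (simp add: simplicial_graph_def)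
    show irr: "\<not> E u u" for u using assms(1) by (simp add: simplicial_graph_def)
    show "path_image (linepath (p u) (p v)) \<inter> {p w} = {}" if "E u v" "w \<noteq> u" "w \<noteq> v" for u v w
      using that irr two[of u] two[of v] two[of w] by metis
    show "path_image (linepath (p u) (p v)) \<inter> path_image (linepath (p u') (p v')) = {}"
      if "E u v" "E u' v'" "{u, v} \<noteq> {u', v'}" for u v u' v'
    proof -
      have "{u, v} = {a, b}" "{u', v'} = {a, b}" using that irr two[of u] two[of v] two[of u'] two[of v'] by fast+
      then show ?thesis using that(3) by simp
    qed
  qed (use p in \<open>auto simp: closed_segment_commute\<close>)
qed

theorem mainTheorem2:
  fixes E :: "'v::finite \<Rightarrow> 'v \<Rightarrow> bool"
    and g :: "'v \<Rightarrow> 'x::metric_space \<Rightarrow> 'x"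
    and x0 :: 'x
  assumes "simplicial_graph E"
    and "triangle_free E"
    and "inseparable E"
    and "proper_space TYPE('x)"
    and "CAT0 TYPE('x)"
    and "geometric_racg_action E g"
    and "\<not> planar_graph E"
    and "locally_connected_space (visual_boundary x0)"
    and "\<not> (\<exists>p \<in> topspace (visual_boundary x0). local_cut_point (visual_boundary x0) p)"
  shows "\<not> planar_space (visual_boundary x0)"
proof
  assume planar: "planar_space (visual_boundary x0)"
  have np: "\<not> plane_graph E" using assms(7) planar_graph_of_plane_graph by blast
  interpret racg_action E x0 g
    by (unfold_locales) (use assms in auto)
  have three: "\<exists>v. v \<noteq> a \<and> v \<noteq> b" for a b :: 'v using plane_graph_two_vertices[OF assms(1), of a b] np by metis
  have nb: "\<exists>u. E v u" for v
  proof -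
    obtain w where w: "w \<noteq> v" using three by blast
    have "(\<lambda>a b. E a b \<and> a \<in> UNIV \<and> b \<in> UNIV)\<^sup>*\<^sup>* v w"
      using assms(3) by (simp add: inseparable_def connected_on_def)
    then show ?thesis
    proof (cases rule: converse_rtranclpE)
      case base
      then show ?thesis using w by simp
    next
      case (step y)
      then show ?thesis by blast
    qed
  qed
  have "\<exists>a b. a \<noteq> b \<and> \<not> E a b"
  proof (rule ccontr)
    assume "\<not> ?thesis"
    then have all: "E u v" if "v \<noteq> u" for u v using that by metis
    fix a :: 'v
    obtain b c where "b \<noteq> a" "c \<noteq> a" "c \<noteq> b" using three[of a a] three by blast
    then have "E a b" "E b c" "E a c" by (simp_all add: all)
    then show False using assms(2) unfolding triangle_free_def by blast
  qed
  then obtain a b where ab: "a \<noteq> b" "\<not> E a b" by blast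
  show False using plane_graph_of_planar_boundary[OF assms(3) nb ab assms(8,9) planar] np by blast
qed

end
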